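(* Let $\mathfrak g$ be the complex simple Lie algebra of type $G_2$ with Chevalley generators $e_i,f_i,h_i$ ($i=1,2$), $\alpha_1$ being the short simple root and $\alpha_2$ the long one. Put $x_2=e_2$, $x_3=[e_1,e_2]$, $x_4=[e_1,x_3]$, $x_5=[e_1,x_4]$, $x_6=[e_2,x_5]$, and let $\mathfrak h\subset\mathfrak g$ be the coisotropic subalgebra spanned by $$h_1+2h_2,\quad x_2,\quad x_3,\quad x_4,\quad x_5,\quad x_6 .$$ Let $B_h$ be the subalgebra of $U_q(\mathfrak g)$ (identified with $U_h(\mathfrak g)$) generated by $$K_1K_2^2,\quad E_2,\quad X=[E_2,E_1]_{q^3},\quad Y=[X,E_1]_q,\quad Z=[Y,E_1]_{q^{-1}},\quad T=[Z,E_2].$$ Then $B_h$ is a quantization of $\mathfrak h$.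
   Context: Quantum group. For a finite-dimensional complex semisimple Lie algebra $\mathfrak g$ with Cartan matrix $(a_{ij})_{1\le i,j\le n}$ and symmetrizing positive integers $d_i$ (so $(d_ia_{ij})$ is symmetric), $U_q(\mathfrak g)$ is the associative algebra over $\mathbb Q(q)$ with generators $X_i^+,X_i^-,K_i,K_i^{-1}$ ($1\le i\le n$) and relations $K_iK_j=K_jK_i$, $K_iK_i^{-1}=K_i^{-1}K_i=1$, $K_iX_j^{\pm}=q^{\pm d_ia_{ij}}X_j^{\pm}K_i$, $X_i^+X_j^--X_j^-X_i^+=\delta_{ij}\frac{K_i-K_i^{-1}}{q^{d_i}-q^{-d_i}}$, and the quantum Serre relations $\sum_{r=0}^{1-a_{ij}}(-1)^r\binom{1-a_{ij}}{r}_{q^{d_i}}(X_i^{\pm})^{1-a_{ij}-r}X_j^{\pm}(X_i^{\pm})^r=0$ for $i\ne j$. Its comultiplication is $\Delta(K_i)=K_i\otimes K_i$, $\Delta(X_i^+)=X_i^+\otimes K_i+1\otimes X_i^+$, $\Delta(X_i^-)=X_i^-\otimes1+K_i^{-1}\otimes X_i^-$. Write $E_i=X_i^+$ and $[A,B]_{q^k}=AB-q^kBA$, $[A,B]=AB-BA$. $U_q(\mathfrak g)$ is identified with the Drinfeld–Jimbo algebra $U_h(\mathfrak g)$ over $\mathbb C[[h]]$ by $q=e^{h}$, $K_i=e^{d_ihH_i}$; $U_h(\mathfrak g)/hU_h(\mathfrak g)\cong U(\mathfrak g)$, and $\pi_{U_h}:U_h(\mathfrak g)\to U(\mathfrak g)$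 is the specialization at $h=0$. For $G_2$: $a_{12}=-3$, $a_{21}=-1$, $d_1=1$, $d_2=3$. Coisotropic subalgebra. A coisotropic subalgebra of a Lie bialgebra $(\mathfrak g,[\,,],\delta)$ is a Lie subalgebra $\mathfrak h$ with $\delta(\mathfrak h)\subset\mathfrak h\wedge\mathfrak g$. Here $\mathfrak g$ carries the standard Lie bialgebra structure given by the $r$-matrix $\pi=\sum_{\alpha>0}\lambda_\alpha e_\alpha\wedge f_\alpha$, $\lambda_\alpha=1/K(e_\alpha,f_\alpha)$, $K$ the Killing form and $e_\alpha,f_\alpha$ root vectors for $\alpha$, $-\alpha$. Quantization. A quantization of a coisotropic subalgebra $\mathfrak h$ of $\mathfrak g$ is a subalgebra $B_h$ of $U_h(\mathfrak g)$ which is a left (or right) coideal ($\Delta(B_h)\subset B_h\otimes U_h(\mathfrak g)$ for left) such that $B_h/hB_h\cong\pi_{U_h}(B_h)=U(\mathfrak h)$; that is, the map $B_h/hB_h\to U(\mathfrak g)$ induced by $\pi_{U_h}$ is injective with image $U(\mathfrak h)$ (equivalently $B_h\cap hU_h(\mathfrak g)=hB_h$ and $\pi_{U_h}(B_h)=U(\mathfrak h)$).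
   Formalization: The element (K_1K_2^2-1)/h is added to the generators of B_h, since K_1K_2^2 is 1 mod h and the listed generators alone miss h_1+2h_2; and h_i is normalized as d_i times the coroot H_i (K_i=e^{h h_i}), since with coroots K_1K_2^2 gives H_1+6H_2. *)

theory Defs
  imports
    "HOL-Analysis.Analysis"
    "HOL-Computational_Algebra.Formal_Power_Series"
    "HOL-Library.Poly_Mapping"
    "HOL-Library.Product_Plus"
begin

section \<open>Algebras given by generators and relations\<close>

text \<open>
  The monoid algebra \<open>\<complex>[M]\<close> is \<^typ>\<open>'m \<Rightarrow>\<^sub>0 complex\<close>.  For the free monoid of words it is the
  free associative algebra, and \<open>\<complex>[M \<times> M] = \<complex>[M] \<otimes> \<complex>[M]\<close>.  Its power series in \<open>h\<close> form the
  h-adic completion of \<open>\<complex>[M] \<otimes> \<complex>[[h]]\<close>.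
\<close>

type_synonym 'm alg = "'m \<Rightarrow>\<^sub>0 complex"

definition cst :: "complex \<Rightarrow> 'm::monoid_add alg" where
  "cst c = Poly_Mapping.single 0 c"

definition scal :: "complex fps \<Rightarrow> 'm::monoid_add alg fps" where
  "scal f = Abs_fps (\<lambda>n. cst (fps_nth f n))"

inductive_set two_sided_ideal :: "'a::{ring,monoid_mult} set \<Rightarrow> 'a set" for S where
  zero: "0 \<in> two_sided_ideal S"
| step: "s \<in> S \<Longrightarrow> x \<in> two_sided_ideal S \<Longrightarrow> a * s * b + x \<in> two_sided_ideal S"

text \<open>A monoid carrying relations for its monoid algebra over the complex numbers (\<open>crels\<close>) and for
  the power series over that algebra (\<open>qrels\<close>).\<close>

class presented = monoid_add +
  fixes crels :: "('a \<Rightarrow>\<^sub>0 complex) set"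
  fixes qrels :: "('a \<Rightarrow>\<^sub>0 complex) fps set"

definition cideal :: "'m::presented alg set" where
  "cideal = two_sided_ideal crels"

text \<open>The closure is taken in the library metric on power series, which is the h-adic one.\<close>

definition qideal :: "'m::presented alg fps set" where
  "qideal = closure (two_sided_ideal qrels)"

lemma two_sided_ideal_add:
  "x \<in> two_sided_ideal S \<Longrightarrow> y \<in> two_sided_ideal S \<Longrightarrow> x + y \<in> two_sided_ideal S"
  by (induction rule: two_sided_ideal.induct) (auto simp: add.assoc intro: two_sided_ideal.step)

lemma two_sided_ideal_mult_left: "x \<in> two_sided_ideal S \<Longrightarrow> c * x \<in> two_sided_ideal S"
proof (induction rule: two_sided_ideal.induct)
  case (step s x a b)
  then have "(c * a) * s * b + c * x \<in> two_sided_ideal S"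
    by (intro two_sided_ideal.step)
  then show ?case by (simp add: algebra_simps)
qed (simp add: two_sided_ideal.zero)

lemma two_sided_ideal_mult_right: "x \<in> two_sided_ideal S \<Longrightarrow> x * c \<in> two_sided_ideal S"
proof (induction rule: two_sided_ideal.induct)
  case (step s x a b)
  then have "a * s * (b * c) + x * c \<in> two_sided_ideal S"
    by (intro two_sided_ideal.step)
  then show ?case by (simp add: algebra_simps)
qed (simp add: two_sided_ideal.zero)

lemma two_sided_ideal_base: "s \<in> S \<Longrightarrow> s \<in> two_sided_ideal S"
  using two_sided_ideal.step[OF _ two_sided_ideal.zero, of s S 1 1] by simp

lemma fps_in_closure_iff:
  fixes S :: "'a::group_add fps set"
  shows "x \<in> closure S \<longleftrightarrow> (\<forall>N. \<exists>y\<in>S. \<forall>n\<le>N. fps_nth y n = fps_nth x n)"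
proof
  assume x: "x \<in> closure S"
  show "\<forall>N. \<exists>y\<in>S. \<forall>n\<le>N. fps_nth y n = fps_nth x n"
  proof
    fix N
    have "\<exists>y\<in>S. dist y x < inverse (2 ^ N)"
      using x by (simp add: closure_approachable)
    then obtain y where y: "y \<in> S" "dist y x < inverse (2 ^ N)" by blast
    have "fps_nth y n = fps_nth x n" if "n \<le> N" for n
    proof (cases "y = x")
      case False
      then have "(2::real) ^ N < 2 ^ subdegree (y - x)"
        using y by (simp add: dist_fps_def)
      then have "n < subdegree (y - x)" using that by simp
      then have "fps_nth (y - x) n = 0" by (rule nth_less_subdegree_zero)
      then show ?thesis by simp
    qed simp
    then show "\<exists>y\<in>S. \<forall>n\<le>N. fps_nth y n = fps_nth x n" using y by blast
  qed
next
  assume *: "\<forall>N. \<exists>y\<in>S. \<forall>n\<le>N. fps_nth y n = fps_nth x n"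
  show "x \<in> closure S"
    unfolding closure_approachable
  proof (intro allI impI)
    fix e :: real assume "e > 0"
    then obtain N where N: "inverse (2 ^ N) < e"
      using real_arch_pow_inv[of e "1/2"] by (auto simp: power_one_over inverse_eq_divide)
    obtain y where y: "y \<in> S" "\<forall>n\<le>N. fps_nth y n = fps_nth x n" using * by blast
    have "dist y x < e"
    proof (cases "y = x")
      case False
      then have "fps_nth (y - x) (subdegree (y - x)) \<noteq> 0" by (intro nth_subdegree_nonzero) auto
      then have "subdegree (y - x) > N" using y by (metis fps_sub_nth not_le right_minus_eq)
      then have "inverse ((2::real) ^ subdegree (y - x)) \<le> inverse (2 ^ N)"
        by (intro le_imp_inverse_le power_increasing) auto
      moreover have "dist y x = inverse (2 ^ subdegree (y - x))"
        using False by (simp only: dist_fps_def if_False)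
      ultimately show ?thesis using N by linarith
    qed (use \<open>e > 0\<close> in simp)
    then show "\<exists>y\<in>S. dist y x < e" using y by blast
  qed
qed

lemma cideal_ideal:
  shows "0 \<in> (cideal :: 'm::presented alg set)"
    and "x \<in> cideal \<Longrightarrow> y \<in> cideal \<Longrightarrow> x + y \<in> (cideal :: 'm::presented alg set)"
    and "x \<in> cideal \<Longrightarrow> c * x \<in> (cideal :: 'm::presented alg set)"
    and "x \<in> cideal \<Longrightarrow> x * c \<in> (cideal :: 'm::presented alg set)"
  unfolding cideal_def
  by (auto intro: two_sided_ideal.zero two_sided_ideal_add two_sided_ideal_mult_left
      two_sided_ideal_mult_right)

lemma qideal_ideal:
  shows "0 \<in> (qideal :: 'm::presented alg fps set)"
    and "x \<in> qideal \<Longrightarrow> y \<in> qideal \<Longrightarrow> x + y \<in> (qideal :: 'm::presented alg fps set)"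
    and "x \<in> qideal \<Longrightarrow> c * x \<in> (qideal :: 'm::presented alg fps set)"
    and "x \<in> qideal \<Longrightarrow> x * c \<in> (qideal :: 'm::presented alg fps set)"
proof -
  let ?I = "two_sided_ideal qrels :: 'm alg fps set"
  show "0 \<in> (qideal :: 'm alg fps set)"
    unfolding qideal_def fps_in_closure_iff using two_sided_ideal.zero by blast
  show "x + y \<in> qideal" if xy: "x \<in> qideal" "y \<in> qideal" for x y :: "'m alg fps"
    unfolding qideal_def fps_in_closure_iff
  proof
    fix N
    obtain x' where x': "x' \<in> ?I" "\<forall>n\<le>N. fps_nth x' n = fps_nth x n"
      using xy(1) unfolding qideal_def fps_in_closure_iff by blast
    obtain y' where "y' \<in> ?I" "\<forall>n\<le>N. fps_nth y' n = fps_nth y n"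
      using xy(2) unfolding qideal_def fps_in_closure_iff by blast
    with x' show "\<exists>z\<in>?I. \<forall>n\<le>N. fps_nth z n = fps_nth (x + y) n"
      by (intro bexI[of _ "x' + y'"]) (auto intro: two_sided_ideal_add)
  qed
  show "c * x \<in> qideal" if x: "x \<in> qideal" for x c :: "'m alg fps"
    unfolding qideal_def fps_in_closure_iff
  proof
    fix N
    obtain x' where "x' \<in> ?I" "\<forall>n\<le>N. fps_nth x' n = fps_nth x n"
      using x unfolding qideal_def fps_in_closure_iff by blast
    then show "\<exists>z\<in>?I. \<forall>n\<le>N. fps_nth z n = fps_nth (c * x) n"
      by (intro bexI[of _ "c * x'"]) (auto intro: two_sided_ideal_mult_left simp: fps_mult_nth)
  qed
  show "x * c \<in> qideal" if x: "x \<in> qideal" for x c :: "'m alg fps"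
    unfolding qideal_def fps_in_closure_iff
  proof
    fix N
    obtain x' where "x' \<in> ?I" "\<forall>n\<le>N. fps_nth x' n = fps_nth x n"
      using x unfolding qideal_def fps_in_closure_iff by blast
    then show "\<exists>z\<in>?I. \<forall>n\<le>N. fps_nth z n = fps_nth (x * c) n"
      by (intro bexI[of _ "x' * c"]) (auto intro: two_sided_ideal_mult_right simp: fps_mult_nth)
  qed
qed

lemma ideal_cong:
  fixes J :: "'a::{ring,monoid_mult} set"
  assumes zero: "0 \<in> J" and add: "\<And>x y. x \<in> J \<Longrightarrow> y \<in> J \<Longrightarrow> x + y \<in> J"
    and left: "\<And>c x. x \<in> J \<Longrightarrow> c * x \<in> J" and right: "\<And>c x. x \<in> J \<Longrightarrow> x * c \<in> J"
  shows "equivp (\<lambda>x y. x - y \<in> J)"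
    and "x - x' \<in> J \<Longrightarrow> - x - (- x') \<in> J"
    and "x - x' \<in> J \<Longrightarrow> y - y' \<in> J \<Longrightarrow> x + y - (x' + y') \<in> J"
    and "x - x' \<in> J \<Longrightarrow> y - y' \<in> J \<Longrightarrow> x - y - (x' - y') \<in> J"
    and "x - x' \<in> J \<Longrightarrow> y - y' \<in> J \<Longrightarrow> x * y - (x' * y') \<in> J"
proof -
  have neg: "- x \<in> J" if "x \<in> J" for x
    using left[OF that, of "-1"] by simp
  show "equivp (\<lambda>x y. x - y \<in> J)"
  proof (intro equivpI reflpI sympI transpI)
    fix x y z assume "x - y \<in> J" "y - z \<in> J"
    then show "x - z \<in> J" using add by fastforce
  next
    fix x y assume "x - y \<in> J"
    then show "y - x \<in> J" using neg by fastforce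
  qed (simp add: zero)
  show "- x - (- x') \<in> J" if "x - x' \<in> J" for x x' using neg[OF that] by simp
  show "x + y - (x' + y') \<in> J" if "x - x' \<in> J" "y - y' \<in> J" for x x' y y'
    using add[OF that] by (simp add: algebra_simps)
  show "x - y - (x' - y') \<in> J" if "x - x' \<in> J" "y - y' \<in> J" for x x' y y'
    using add[OF that(1) neg[OF that(2)]] by (simp add: algebra_simps)
  show "x * y - (x' * y') \<in> J" if "x - x' \<in> J" "y - y' \<in> J" for x x' y y'
    using add[OF right[OF that(1), of y] left[OF that(2), of x']] by (simp add: algebra_simps)
qed

lemmas cideal_cong = ideal_cong[OF cideal_ideal]
lemmas qideal_cong = ideal_cong[OF qideal_ideal]

quotient_type (overloaded) 'm ualg =
  "'m::presented \<Rightarrow>\<^sub>0 complex" / "\<lambda>x y. x - y \<in> cideal"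
  by (rule cideal_cong)

quotient_type (overloaded) 'm halg =
  "('m::presented \<Rightarrow>\<^sub>0 complex) fps" / "\<lambda>x y. x - y \<in> qideal"
  by (rule qideal_cong)

instantiation ualg :: (presented) "{ring,monoid_mult}"
begin
lift_definition zero_ualg :: "'a ualg" is 0 .
lift_definition one_ualg :: "'a ualg" is 1 .
lift_definition plus_ualg :: "'a ualg \<Rightarrow> 'a ualg \<Rightarrow> 'a ualg" is "(+)" by (rule cideal_cong)
lift_definition minus_ualg :: "'a ualg \<Rightarrow> 'a ualg \<Rightarrow> 'a ualg" is "(-)" by (rule cideal_cong)
lift_definition uminus_ualg :: "'a ualg \<Rightarrow> 'a ualg" is uminus by (rule cideal_cong)
lift_definition times_ualg :: "'a ualg \<Rightarrow> 'a ualg \<Rightarrow> 'a ualg" is "(*)" by (rule cideal_cong)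
instance
  by standard (transfer; simp add: algebra_simps cideal_ideal)+
end

instantiation halg :: (presented) "{ring,monoid_mult}"
begin
lift_definition zero_halg :: "'a halg" is 0 .
lift_definition one_halg :: "'a halg" is 1 .
lift_definition plus_halg :: "'a halg \<Rightarrow> 'a halg \<Rightarrow> 'a halg" is "(+)" by (rule qideal_cong)
lift_definition minus_halg :: "'a halg \<Rightarrow> 'a halg \<Rightarrow> 'a halg" is "(-)" by (rule qideal_cong)
lift_definition uminus_halg :: "'a halg \<Rightarrow> 'a halg" is uminus by (rule qideal_cong)
lift_definition times_halg :: "'a halg \<Rightarrow> 'a halg \<Rightarrow> 'a halg" is "(*)" by (rule qideal_cong)
instance
  by standard (transfer; simp add: algebra_simps qideal_ideal)+
end


section \<open>Tensor squares\<close>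

lift_definition leg1 :: "'m alg \<Rightarrow> ('m \<times> 'n::monoid_add) alg" is "\<lambda>p (u, v). p u when v = 0"
proof -
  fix p :: "'m \<Rightarrow> complex" assume "finite {u. p u \<noteq> 0}"
  then have "finite ({u. p u \<noteq> 0} \<times> {0 :: 'n})" by simp
  then show "finite {w. (case w of (u, v) \<Rightarrow> p u when v = (0 :: 'n)) \<noteq> 0}"
    by (rule rev_finite_subset) (auto simp: when_def split: if_splits)
qed

lift_definition leg2 :: "'n alg \<Rightarrow> ('m::monoid_add \<times> 'n) alg" is "\<lambda>p (u, v). p v when u = 0"
proof -
  fix p :: "'n \<Rightarrow> complex" assume "finite {u. p u \<noteq> 0}"
  then have "finite ({0 :: 'm} \<times> {u. p u \<noteq> 0})" by simp
  then show "finite {w. (case w of (u, v) \<Rightarrow> p v when u = (0 :: 'm)) \<noteq> 0}"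
    by (rule rev_finite_subset) (auto simp: when_def split: if_splits)
qed

definition qleg1 :: "'m alg fps \<Rightarrow> ('m \<times> 'n::monoid_add) alg fps" where
  "qleg1 x = Abs_fps (\<lambda>n. leg1 (fps_nth x n))"

definition qleg2 :: "'n alg fps \<Rightarrow> ('m::monoid_add \<times> 'n) alg fps" where
  "qleg2 x = Abs_fps (\<lambda>n. leg2 (fps_nth x n))"

text \<open>With these relations \<^typ>\<open>('m \<times> 'n) ualg\<close> is the tensor product of \<^typ>\<open>'m ualg\<close> and
  \<^typ>\<open>'n ualg\<close>, and \<^typ>\<open>('m \<times> 'n) halg\<close> is the h-adically completed tensor product of
  \<^typ>\<open>'m halg\<close> and \<^typ>\<open>'n halg\<close>.\<close>

instantiation prod :: (presented, presented) presented
begin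
definition crels_prod :: "('a \<times> 'b) alg set" where
  "crels_prod = leg1 ` crels \<union> leg2 ` crels"
definition qrels_prod :: "('a \<times> 'b) alg fps set" where
  "qrels_prod = qleg1 ` qrels \<union> qleg2 ` qrels"
instance ..
end

lemma alg_induct [case_names zero single add]:
  assumes "P 0" "\<And>k c. P (Poly_Mapping.single k c)" "\<And>p q. P p \<Longrightarrow> P q \<Longrightarrow> P (p + q)"
  shows "P (p :: 'm alg)"
proof -
  have "P (\<Sum>k\<in>A. Poly_Mapping.single k (poly_mapping.lookup p k))" if "finite A" for A
    using that by (induction A rule: finite_induct) (auto intro: assms)
  moreover have "p = (\<Sum>k\<in>Poly_Mapping.keys p. Poly_Mapping.single k (poly_mapping.lookup p k))"
  proof (rule poly_mapping_eqI)
    fix k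
    have "poly_mapping.lookup (\<Sum>k\<in>Poly_Mapping.keys p. Poly_Mapping.single k (poly_mapping.lookup p k)) k
        = (\<Sum>x\<in>Poly_Mapping.keys p. if x = k then poly_mapping.lookup p x else 0)"
      by (simp only: lookup_sum lookup_single when_def)
    also have "\<dots> = poly_mapping.lookup p k"
      by (subst sum.delta) (auto simp: in_keys_iff)
    finally show "poly_mapping.lookup p k = poly_mapping.lookup (\<Sum>k\<in>Poly_Mapping.keys p. Poly_Mapping.single k (poly_mapping.lookup p k)) k" ..
  qed
  ultimately show ?thesis by (metis Poly_Mapping.finite_keys)
qed

lemma leg1_single: "leg1 (Poly_Mapping.single k c) = Poly_Mapping.single (k, 0) c"
  by (rule poly_mapping_eqI) (auto simp: leg1.rep_eq lookup_single when_def split: if_splits)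

lemma leg2_single: "leg2 (Poly_Mapping.single k c) = Poly_Mapping.single (0, k) c"
  by (rule poly_mapping_eqI) (auto simp: leg2.rep_eq lookup_single when_def split: if_splits)

lemma leg1_add: "leg1 (p + q) = leg1 p + leg1 q"
  by (rule poly_mapping_eqI) (auto simp: leg1.rep_eq lookup_add when_def)

lemma leg2_add: "leg2 (p + q) = leg2 p + leg2 q"
  by (rule poly_mapping_eqI) (auto simp: leg2.rep_eq lookup_add when_def)

lemma leg1_0: "leg1 0 = 0"
  by (rule poly_mapping_eqI) (auto simp: leg1.rep_eq when_def)

lemma leg2_0: "leg2 0 = 0"
  by (rule poly_mapping_eqI) (auto simp: leg2.rep_eq when_def)

lemma leg1_diff: "leg1 (p - q) = leg1 p - leg1 q"
  by (metis leg1_add add_diff_cancel diff_add_cancel)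

lemma leg2_diff: "leg2 (p - q) = leg2 p - leg2 q"
  by (metis leg2_add add_diff_cancel diff_add_cancel)

lemma leg1_mult:
  "(leg1 (p * q) :: ('m::monoid_add \<times> 'n::monoid_add) alg) = leg1 p * leg1 q"
proof (induction p rule: alg_induct)
  case (single k c)
  show ?case
    by (induction q rule: alg_induct)
      (simp_all add: mult_single leg1_single leg1_add leg1_0 distrib_left)
qed (simp_all add: leg1_add leg1_0 distrib_right)

lemma leg2_mult:
  "(leg2 (p * q) :: ('m::monoid_add \<times> 'n::monoid_add) alg) = leg2 p * leg2 q"
proof (induction p rule: alg_induct)
  case (single k c)
  show ?case
    by (induction q rule: alg_induct)
      (simp_all add: mult_single leg2_single leg2_add leg2_0 distrib_left)
qed (simp_all add: leg2_add leg2_0 distrib_right)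

lemma leg1_sum: "leg1 (\<Sum>i\<in>A. f i) = (\<Sum>i\<in>A. leg1 (f i))"
  by (induction A rule: infinite_finite_induct) (simp_all add: leg1_add leg1_0)

lemma leg2_sum: "leg2 (\<Sum>i\<in>A. f i) = (\<Sum>i\<in>A. leg2 (f i))"
  by (induction A rule: infinite_finite_induct) (simp_all add: leg2_add leg2_0)

lemma qleg1_hom:
  shows "qleg1 0 = 0" "qleg1 (x + y) = qleg1 x + qleg1 y" "qleg1 (x - y) = qleg1 x - qleg1 y"
    and "(qleg1 (x' * y') :: ('m::monoid_add \<times> 'n::monoid_add) alg fps) = qleg1 x' * qleg1 y'"
  by (auto simp: fps_eq_iff qleg1_def leg1_0 leg1_add leg1_diff leg1_sum leg1_mult fps_mult_nth)

lemma qleg2_hom: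
  shows "qleg2 0 = 0" "qleg2 (x + y) = qleg2 x + qleg2 y" "qleg2 (x - y) = qleg2 x - qleg2 y"
    and "(qleg2 (x' * y') :: ('m::monoid_add \<times> 'n::monoid_add) alg fps) = qleg2 x' * qleg2 y'"
  by (auto simp: fps_eq_iff qleg2_def leg2_0 leg2_add leg2_diff leg2_sum leg2_mult fps_mult_nth)

lemma hom_two_sided_ideal:
  assumes "f 0 = 0" "\<And>x y. f (x + y) = f x + f y" "\<And>x y. f (x * y) = f x * f y"
    and "f ` S \<subseteq> two_sided_ideal T" and "x \<in> two_sided_ideal S"
  shows "f x \<in> two_sided_ideal T"
  using assms(5)
proof (induction rule: two_sided_ideal.induct)
  case (step s x a b)
  then have "f s \<in> two_sided_ideal T" using assms(4) by blast
  then show ?case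
    by (simp add: assms step.IH two_sided_ideal_add two_sided_ideal_mult_left
        two_sided_ideal_mult_right)
qed (simp add: assms two_sided_ideal.zero)

lift_definition uleg1 :: "'m ualg \<Rightarrow> ('m::presented \<times> 'n::presented) ualg" is leg1
  unfolding leg1_diff[symmetric] cideal_def
  by (rule hom_two_sided_ideal[of _ crels])
    (auto simp: leg1_0 leg1_add leg1_mult crels_prod_def intro: two_sided_ideal_base)

lift_definition uleg2 :: "'n ualg \<Rightarrow> ('m::presented \<times> 'n::presented) ualg" is leg2
  unfolding leg2_diff[symmetric] cideal_def
  by (rule hom_two_sided_ideal[of _ crels])
    (auto simp: leg2_0 leg2_add leg2_mult crels_prod_def intro: two_sided_ideal_base)

lift_definition hleg1 :: "'m halg \<Rightarrow> ('m::presented \<times> 'n::presented) halg" is qleg1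
proof -
  fix x y :: "'m alg fps" assume *: "x - y \<in> qideal"
  show "(qleg1 x - qleg1 y :: ('m \<times> 'n) alg fps) \<in> qideal"
    unfolding qleg1_hom(3)[symmetric] qideal_def fps_in_closure_iff
  proof
    fix N
    obtain z where z: "z \<in> two_sided_ideal qrels" "\<forall>n\<le>N. fps_nth z n = fps_nth (x - y) n"
      using * unfolding qideal_def fps_in_closure_iff by blast
    have "(qleg1 z :: ('m \<times> 'n) alg fps) \<in> two_sided_ideal qrels"
      by (rule hom_two_sided_ideal[OF _ _ _ _ z(1)])
        (auto simp: qleg1_hom qrels_prod_def intro: two_sided_ideal_base)
    then show "\<exists>w\<in>two_sided_ideal qrels. \<forall>n\<le>N.
        fps_nth w n = fps_nth (qleg1 (x - y) :: ('m \<times> 'n) alg fps) n"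
      using z(2) by (intro bexI[of _ "qleg1 z"]) (auto simp: qleg1_def)
  qed
qed

lift_definition hleg2 :: "'n halg \<Rightarrow> ('m::presented \<times> 'n::presented) halg" is qleg2
proof -
  fix x y :: "'n alg fps" assume *: "x - y \<in> qideal"
  show "(qleg2 x - qleg2 y :: ('m \<times> 'n) alg fps) \<in> qideal"
    unfolding qleg2_hom(3)[symmetric] qideal_def fps_in_closure_iff
  proof
    fix N
    obtain z where z: "z \<in> two_sided_ideal qrels" "\<forall>n\<le>N. fps_nth z n = fps_nth (x - y) n"
      using * unfolding qideal_def fps_in_closure_iff by blast
    have "(qleg2 z :: ('m \<times> 'n) alg fps) \<in> two_sided_ideal qrels"
      by (rule hom_two_sided_ideal[OF _ _ _ _ z(1)])
        (auto simp: qleg2_hom qrels_prod_def intro: two_sided_ideal_base)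
    then show "\<exists>w\<in>two_sided_ideal qrels. \<forall>n\<le>N.
        fps_nth w n = fps_nth (qleg2 (x - y) :: ('m \<times> 'n) alg fps) n"
      using z(2) by (intro bexI[of _ "qleg2 z"]) (auto simp: qleg2_def)
  qed
qed

definition utensor :: "'m::presented ualg \<Rightarrow> 'n::presented ualg \<Rightarrow> ('m \<times> 'n) ualg"
    (infixr \<open>\<otimes>\<^sub>U\<close> 75) where
  "x \<otimes>\<^sub>U y = uleg1 x * uleg2 y"

definition htensor :: "'m::presented halg \<Rightarrow> 'n::presented halg \<Rightarrow> ('m \<times> 'n) halg"
    (infixr \<open>\<otimes>\<^sub>h\<close> 75) where
  "x \<otimes>\<^sub>h y = hleg1 x * hleg2 y"


section \<open>The quantized enveloping algebra of type \<open>G\<^sub>2\<close>\<close>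

text \<open>\<open>Short\<close> is the index 1, \<open>Long\<close> the index 2.\<close>

datatype node = Short | Long

fun cartan :: "node \<Rightarrow> node \<Rightarrow> int" where
  "cartan Short Short = 2"
| "cartan Short Long = -3"
| "cartan Long Short = -1"
| "cartan Long Long = 2"

fun symm :: "node \<Rightarrow> int" where
  "symm Short = 1"
| "symm Long = 3"

datatype gen = Xp node | Xm node | Hg node

datatype gword = Word "gen list"

instantiation gword :: monoid_add
begin
definition zero_gword :: gword where "0 = Word []"
fun plus_gword :: "gword \<Rightarrow> gword \<Rightarrow> gword" where "Word u + Word v = Word (u @ v)"
instance
proof
  fix u v w :: gword
  show "u + v + w = u + (v + w)" by (cases u; cases v; cases w) simp
  show "0 + u = u" "u + 0 = u" by (cases u; simp add: zero_gword_def)+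
qed
end

definition letter :: "gen \<Rightarrow> gword alg" where
  "letter g = Poly_Mapping.single (Word [g]) 1"

text \<open>\<open>qpow k\<close> is \<open>q\<^sup>k\<close> with \<open>q = e\<^sup>h\<close>; \<open>qint d m\<close> is the symmetric quantum integer
  \<open>(q\<^sup>d\<^sup>m - q\<^sup>-\<^sup>d\<^sup>m) / (q\<^sup>d - q\<^sup>-\<^sup>d)\<close>, written as a sum.\<close>

definition qpow :: "int \<Rightarrow> complex fps" where
  "qpow k = fps_exp (of_int k)"

definition qint :: "int \<Rightarrow> nat \<Rightarrow> complex fps" where
  "qint d m = (\<Sum>k<m. qpow (d * (int m - 1 - 2 * int k)))"

definition qfact :: "int \<Rightarrow> nat \<Rightarrow> complex fps" where
  "qfact d m = (\<Prod>k=1..m. qint d k)"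

definition qbinom :: "int \<Rightarrow> nat \<Rightarrow> nat \<Rightarrow> complex fps" where
  "qbinom d m r = qfact d m / (qfact d r * qfact d (m - r))"

definition hexp :: "int \<Rightarrow> 'm::monoid_add alg \<Rightarrow> 'm alg fps" where
  "hexp c x = Abs_fps (\<lambda>n. cst (of_int c ^ n / fact n) * x ^ n)"

definition freeK :: "node \<Rightarrow> gword alg fps" where
  "freeK i = hexp (symm i) (letter (Hg i))"

definition freeKinv :: "node \<Rightarrow> gword alg fps" where
  "freeKinv i = hexp (- symm i) (letter (Hg i))"

text \<open>\<open>(K\<^sub>i - K\<^sub>i\<^sup>-\<^sup>1) / (q\<^sub>i - q\<^sub>i\<^sup>-\<^sup>1)\<close>: numerator and denominator are both divisible by \<open>h\<close>, and
  \<^term>\<open>fps_shift 1\<close> is division by \<open>h\<close>.\<close>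

definition Kquot :: "node \<Rightarrow> gword alg fps" where
  "Kquot i = scal (inverse (fps_shift 1 (qpow (symm i) - qpow (- symm i))))
             * fps_shift 1 (freeK i - freeKinv i)"

definition cserre :: "gen \<Rightarrow> gen \<Rightarrow> nat \<Rightarrow> gword alg" where
  "cserre x y m = (\<Sum>r\<le>m. cst ((-1) ^ r * of_nat (m choose r))
                     * letter x ^ (m - r) * letter y * letter x ^ r)"

definition qserre :: "int \<Rightarrow> gen \<Rightarrow> gen \<Rightarrow> nat \<Rightarrow> gword alg fps" where
  "qserre d x y m = (\<Sum>r\<le>m. scal ((-1) ^ r * qbinom d m r)
     * fps_const (letter x) ^ (m - r) * fps_const (letter y) * fps_const (letter x) ^ r)"

definition comm :: "'a::ring \<Rightarrow> 'a \<Rightarrow> 'a" where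
  "comm x y = x * y - y * x"

text \<open>The classical relations present \<open>U(\<gg>)\<close> (Serre), the quantum ones \<open>U\<^sub>h(\<gg>)\<close> (Drinfeld, Jimbo);
  here \<open>H\<^sub>i\<close> is the coroot, so that \<open>K\<^sub>i = e\<^bsup>d\<^sub>i h H\<^sub>i\<^esup>\<close> satisfies the relations of \<open>U\<^sub>q(\<gg>)\<close>.\<close>

instantiation gword :: presented
begin

definition crels_gword :: "gword alg set" where
  "crels_gword =
     {comm (letter (Hg i)) (letter (Hg j)) | i j. True}
   \<union> {comm (letter (Hg i)) (letter (Xp j)) - cst (of_int (cartan i j)) * letter (Xp j) | i j. True}
   \<union> {comm (letter (Hg i)) (letter (Xm j)) + cst (of_int (cartan i j)) * letter (Xm j) | i j. True}
   \<union> {comm (letter (Xp i)) (letter (Xm j)) - (if i = j then letter (Hg i) else 0) | i j. True}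
   \<union> {cserre (Xp i) (Xp j) (nat (1 - cartan i j)) | i j. i \<noteq> j}
   \<union> {cserre (Xm i) (Xm j) (nat (1 - cartan i j)) | i j. i \<noteq> j}"

definition qrels_gword :: "gword alg fps set" where
  "qrels_gword =
     {fps_const (comm (letter (Hg i)) (letter (Hg j))) | i j. True}
   \<union> {fps_const (comm (letter (Hg i)) (letter (Xp j)) - cst (of_int (cartan i j)) * letter (Xp j))
       | i j. True}
   \<union> {fps_const (comm (letter (Hg i)) (letter (Xm j)) + cst (of_int (cartan i j)) * letter (Xm j))
       | i j. True}
   \<union> {fps_const (comm (letter (Xp i)) (letter (Xm j))) - (if i = j then Kquot i else 0) | i j. True}
   \<union> {qserre (symm i) (Xp i) (Xp j) (nat (1 - cartan i j)) | i j. i \<noteq> j}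
   \<union> {qserre (symm i) (Xm i) (Xm j) (nat (1 - cartan i j)) | i j. i \<noteq> j}"

instance ..

end

type_synonym Ug = "gword ualg"
type_synonym Uh = "gword halg"

subsection \<open>Specialization at \<open>h = 0\<close>\<close>

lemma cst_mult: "cst a * cst b = cst (a * b)"
  by (simp add: cst_def mult_single)

lemma cst_diff: "cst a - cst b = cst (a - b)"
  by (simp add: cst_def single_diff)

lemma cst_1: "cst 1 = 1"
  by (simp add: cst_def single_one)

lemma qint_nth_0: "fps_nth (qint d m) 0 = of_nat m"
  by (simp add: qint_def qpow_def fps_sum_nth)

lemma qfact_nth_0: "fps_nth (qfact d m) 0 = fact m"
  by (induction m) (simp_all add: qfact_def qint_nth_0 mult.commute)

lemma qbinom_nth_0:
  assumes "r \<le> m"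
  shows "fps_nth (qbinom d m r) 0 = of_nat (m choose r)"
proof -
  have "fps_nth (qbinom d m r) 0 = fact m / (fact r * fact (m - r))"
    unfolding qbinom_def by (subst fps_divide_unit) (simp_all add: qfact_nth_0 divide_inverse)
  then show ?thesis using assms by (simp add: binomial_fact)
qed

lemma qserre_nth_0: "fps_nth (qserre d x y m) 0 = cserre x y m"
proof -
  have "fps_nth ((- 1) ^ r :: complex fps) 0 = (- 1) ^ r" for r :: nat
    by (cases "even r") simp_all
  then show ?thesis
    unfolding qserre_def cserre_def fps_sum_nth
    by (intro sum.cong) (simp_all add: scal_def qbinom_nth_0)
qed

lemma Kquot_nth_0: "fps_nth (Kquot i) 0 = letter (Hg i)"
proof -
  have "fps_nth (Kquot i) 0 = cst (1 / (2 * of_int (symm i)))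
      * (cst (of_int (symm i)) * letter (Hg i) - cst (- of_int (symm i)) * letter (Hg i))"
    by (simp add: Kquot_def scal_def qpow_def freeK_def freeKinv_def hexp_def inverse_eq_divide)
  also have "\<dots> = cst (1 / (2 * of_int (symm i)) * (of_int (symm i) + of_int (symm i)))
      * letter (Hg i)"
    by (simp only: left_diff_distrib[symmetric] mult.assoc[symmetric] cst_mult cst_diff) simp
  also have "\<dots> = letter (Hg i)"
    by (cases i) (simp_all add: cst_1)
  finally show ?thesis .
qed

lift_definition specialize :: "Uh \<Rightarrow> Ug" is "\<lambda>x. fps_nth x 0"
proof -
  have base: "fps_nth s 0 \<in> cideal" if "s \<in> qrels" for s :: "gword alg fps"
  proof -
    have if0: "fps_nth (if i = j then Kquot i else 0) 0 = (if i = j then letter (Hg i) else 0)"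
      for i j by (simp add: Kquot_nth_0)
    have "fps_nth s 0 \<in> crels"
      using that unfolding qrels_gword_def crels_gword_def
      by (elim UnE CollectE exE conjE; hypsubst;
          simp only: qserre_nth_0 if0 fps_sub_nth fps_nth_fps_const if_True refl; blast)
    then show ?thesis unfolding cideal_def by (rule two_sided_ideal_base)
  qed
  have ideal: "fps_nth z 0 \<in> cideal" if "z \<in> two_sided_ideal qrels" for z :: "gword alg fps"
    using that by induction (auto intro: cideal_ideal base)
  fix x y :: "gword alg fps" assume "x - y \<in> qideal"
  then obtain z where "z \<in> two_sided_ideal qrels" "fps_nth z 0 = fps_nth (x - y) 0"
    unfolding qideal_def fps_in_closure_iff by blast
  then show "fps_nth x 0 - fps_nth y 0 \<in> cideal" using ideal by fastforce
qed


subsection \<open>Comultiplication\<close>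

fun gen_comult :: "gen \<Rightarrow> (gword \<times> gword) alg fps" where
  "gen_comult (Xp i) = qleg1 (fps_const (letter (Xp i))) * qleg2 (freeK i)
                       + qleg2 (fps_const (letter (Xp i)))"
| "gen_comult (Xm i) = qleg1 (fps_const (letter (Xm i)))
                       + qleg1 (freeKinv i) * qleg2 (fps_const (letter (Xm i)))"
| "gen_comult (Hg i) = qleg1 (fps_const (letter (Hg i))) + qleg2 (fps_const (letter (Hg i)))"

fun word_comult :: "gword \<Rightarrow> (gword \<times> gword) alg fps" where
  "word_comult (Word gs) = prod_list (map gen_comult gs)"

definition poly_comult :: "gword alg \<Rightarrow> (gword \<times> gword) alg fps" where
  "poly_comult p = (\<Sum>w\<in>Poly_Mapping.keys p. scal (fps_const (poly_mapping.lookup p w)) * word_comult w)"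

text \<open>The continuous algebra homomorphism extending \<^const>\<open>gen_comult\<close>; the sum is
  \<open>\<Sum>\<^sub>n h\<^sup>n \<Delta>(x\<^sub>n)\<close> for \<open>x = \<Sum>\<^sub>n h\<^sup>n x\<^sub>n\<close>.\<close>

definition free_comult :: "gword alg fps \<Rightarrow> (gword \<times> gword) alg fps" where
  "free_comult x = Abs_fps (\<lambda>m. \<Sum>n\<le>m. fps_nth (poly_comult (fps_nth x n)) (m - n))"

text \<open>The image \<open>\<Delta>(B)\<close>.  It ranges over all representatives of the elements of \<open>B\<close>, so that the
  definition does not depend on the (true) fact that the comultiplication is compatible with the
  defining relations.\<close>

definition comult_image :: "Uh set \<Rightarrow> (gword \<times> gword) halg set" where
  "comult_image B = {abs_halg (free_comult x) | x. abs_halg x \<in> B}"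

text \<open>\<open>A \<otimes> B\<close>: finite sums of pure tensors inside the completed tensor product.\<close>

inductive_set tensor_set ::
    "'m::presented halg set \<Rightarrow> 'n::presented halg set \<Rightarrow> ('m \<times> 'n) halg set" for A B where
  zero: "0 \<in> tensor_set A B"
| step: "a \<in> A \<Longrightarrow> b \<in> B \<Longrightarrow> z \<in> tensor_set A B \<Longrightarrow> a \<otimes>\<^sub>h b + z \<in> tensor_set A B"

section \<open>The Lie bialgebra \<open>\<gg>\<close>\<close>

lift_definition uscale :: "complex \<Rightarrow> 'm::presented ualg \<Rightarrow> 'm ualg" is "\<lambda>c x. cst c * x"
  by (simp add: cideal_ideal flip: right_diff_distrib)

lemma cst_add: "cst a + cst b = cst (a + b)"
  by (simp add: cst_def single_add)

global_interpretation ualg: vector_space "uscale :: complex \<Rightarrow> 'm::presented ualg \<Rightarrow> 'm ualg"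
proof
  fix a b :: complex and x y :: "'m ualg"
  show "uscale a (x + y) = uscale a x + uscale a y"
    by transfer (simp add: distrib_left cideal_ideal)
  show "uscale (a + b) x = uscale a x + uscale b x"
    by transfer (simp add: distrib_right cideal_ideal flip: cst_add)
  show "uscale a (uscale b x) = uscale (a * b) x"
    by transfer (simp add: cideal_ideal mult.assoc flip: cst_mult)
  show "uscale 1 x = x"
    by transfer (simp add: cideal_ideal cst_1)
qed

definition ugen :: "gen \<Rightarrow> Ug" where
  "ugen g = abs_ualg (letter g)"

text \<open>\<open>\<gg>\<close> is realized inside \<open>U(\<gg>)\<close> as the Lie subalgebra generated by the Chevalley generators.\<close>

inductive_set g2 :: "Ug set" where
  gen: "ugen g \<in> g2"
| zero: "0 \<in> g2"
| add: "x \<in> g2 \<Longrightarrow> y \<in> g2 \<Longrightarrow> x + y \<in> g2"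
| scale: "x \<in> g2 \<Longrightarrow> uscale c x \<in> g2"
| bracket: "x \<in> g2 \<Longrightarrow> y \<in> g2 \<Longrightarrow> comm x y \<in> g2"

text \<open>The trace of a linear endomorphism of a (finite-dimensional) subspace, which does not depend on
  the chosen basis.\<close>

definition trace_on :: "Ug set \<Rightarrow> (Ug \<Rightarrow> Ug) \<Rightarrow> complex" where
  "trace_on V f = (let b = (SOME b. ualg.independent b \<and> ualg.span b = V)
                   in \<Sum>v\<in>b. ualg.representation b (f v) v)"

definition killing :: "Ug \<Rightarrow> Ug \<Rightarrow> complex" where
  "killing x y = trace_on g2 (\<lambda>z. comm x (comm y z))"

text \<open>The root space for \<open>a \<alpha>\<^sub>1 + b \<alpha>\<^sub>2\<close>, where \<open>\<alpha>\<^sub>j(H\<^sub>i) = a\<^sub>i\<^sub>j\<close>.\<close>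

definition root_space :: "int \<times> int \<Rightarrow> Ug set" where
  "root_space \<nu> = {x \<in> g2. \<forall>i. comm (ugen (Hg i)) x
      = uscale (of_int (fst \<nu> * cartan i Short + snd \<nu> * cartan i Long)) x}"

definition pos_roots :: "(int \<times> int) set" where
  "pos_roots = {\<nu>. \<nu> \<noteq> 0 \<and> fst \<nu> \<ge> 0 \<and> snd \<nu> \<ge> 0 \<and> root_space \<nu> \<noteq> {0}}"

definition root_vector :: "int \<times> int \<Rightarrow> Ug" where
  "root_vector \<nu> = (SOME x. x \<in> root_space \<nu> \<and> x \<noteq> 0)"

definition wedge :: "Ug \<Rightarrow> Ug \<Rightarrow> (gword \<times> gword) ualg" where
  "wedge x y = x \<otimes>\<^sub>U y - y \<otimes>\<^sub>U x"

text \<open>The choice of root vectors is immaterial, because the root spaces are lines and the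
  coefficient scales inversely.\<close>

definition rmatrix :: "(gword \<times> gword) ualg" where
  "rmatrix = (\<Sum>\<alpha>\<in>pos_roots. uscale (1 / killing (root_vector \<alpha>) (root_vector (- \<alpha>)))
                (wedge (root_vector \<alpha>) (root_vector (- \<alpha>))))"

definition cobracket :: "Ug \<Rightarrow> (gword \<times> gword) ualg" where
  "cobracket x = comm (x \<otimes>\<^sub>U 1 + 1 \<otimes>\<^sub>U x) rmatrix"

definition coisotropic_subalgebra :: "Ug set \<Rightarrow> bool" where
  "coisotropic_subalgebra L \<longleftrightarrow>
     ualg.subspace L \<and> L \<subseteq> g2 \<and> (\<forall>x\<in>L. \<forall>y\<in>L. comm x y \<in> L)
     \<and> cobracket ` L \<subseteq> ualg.span {wedge x y | x y. x \<in> L \<and> y \<in> g2}"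

section \<open>Quantization of coisotropic subalgebras\<close>

definition subalgebra :: "'a::{ring,monoid_mult} set \<Rightarrow> 'a set \<Rightarrow> bool" where
  "subalgebra R B \<longleftrightarrow> R \<subseteq> B \<and> (\<forall>x\<in>B. \<forall>y\<in>B. x + y \<in> B \<and> x * y \<in> B)"

definition generated_subalgebra :: "'a::{ring,monoid_mult} set \<Rightarrow> 'a set \<Rightarrow> 'a set" where
  "generated_subalgebra R S = \<Inter> {B. subalgebra R B \<and> S \<subseteq> B}"

text \<open>The rings of scalars inside the two algebras.\<close>

definition uscalars :: "Ug set" where
  "uscalars = range (\<lambda>c. uscale c 1)"

definition hscalar :: "complex fps \<Rightarrow> Uh" where
  "hscalar f = abs_halg (scal f)"

text \<open>\<open>U(\<hh>)\<close>, which embeds into \<open>U(\<gg>)\<close> by Poincare-Birkhoff-Witt.\<close>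

definition env :: "Ug set \<Rightarrow> Ug set" where
  "env L = generated_subalgebra uscalars L"

text \<open>With \<open>B\<close> stable under the scalars, additive spans are \<open>\<complex>[[h]]\<close>-spans.\<close>

definition left_coideal :: "Uh set \<Rightarrow> bool" where
  "left_coideal B \<longleftrightarrow> comult_image B \<subseteq> tensor_set B UNIV"

definition right_coideal :: "Uh set \<Rightarrow> bool" where
  "right_coideal B \<longleftrightarrow> comult_image B \<subseteq> tensor_set UNIV B"

definition hmult :: "Uh \<Rightarrow> Uh" where
  "hmult x = hscalar fps_X * x"

text \<open>The last two conditions say that \<open>B/hB \<rightarrow> U(\<gg>)\<close> is injective with image \<open>U(\<hh>)\<close>.\<close>

definition is_quantization :: "Uh set \<Rightarrow> Ug set \<Rightarrow> bool" where
  "is_quantization B L \<longleftrightarrow>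
     coisotropic_subalgebra L
     \<and> subalgebra (range hscalar) B
     \<and> (left_coideal B \<or> right_coideal B)
     \<and> B \<inter> range hmult = hmult ` B
     \<and> specialize ` B = env L"

section \<open>Generators\<close>

text \<open>Chevalley generators, normalized by \<open>[e\<^sub>i, f\<^sub>i] = h\<^sub>i\<close> and \<open>[h\<^sub>i, e\<^sub>j] = d\<^sub>i a\<^sub>i\<^sub>j e\<^sub>j\<close>,
  so that \<open>h\<^sub>i\<close> corresponds to \<open>\<alpha>\<^sub>i\<close> under the invariant form and \<open>K\<^sub>i = e\<^bsup>h h\<^sub>i\<^esup>\<close>; the coroot is
  \<open>H\<^sub>i = h\<^sub>i / d\<^sub>i\<close>.\<close>

definition chev_e :: "node \<Rightarrow> Ug" where
  "chev_e i = ugen (Xp i)"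

definition chev_f :: "node \<Rightarrow> Ug" where
  "chev_f i = uscale (of_int (symm i)) (ugen (Xm i))"

definition chev_h :: "node \<Rightarrow> Ug" where
  "chev_h i = uscale (of_int (symm i)) (ugen (Hg i))"

lemma uscale_comm:
  fixes x y :: "'a::presented ualg"
  shows "comm (uscale c x) y = uscale c (comm x y)"
    and "comm x (uscale c y) = uscale c (comm x y)"
proof -
  have central: "p * cst k = cst k * p" for k and p :: "'a alg"
    by (induction p rule: alg_induct) (simp_all add: cst_def mult_single algebra_simps)
  then have pull: "p * (cst k * r) = cst k * (p * r)" for k and p r :: "'a alg"
    by (metis mult.assoc)
  show "comm (uscale c x) y = uscale c (comm x y)"
    unfolding comm_def
    by transfer (simp add: right_diff_distrib cideal_ideal mult.assoc pull)
  show "comm x (uscale c y) = uscale c (comm x y)"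
    unfolding comm_def
    by transfer (simp add: right_diff_distrib cideal_ideal mult.assoc pull)
qed

lemma chevalley_relations:
  shows "comm (chev_e i) (chev_f i) = chev_h i"
    and "comm (chev_h i) (chev_e j) = uscale (of_int (symm i * cartan i j)) (chev_e j)"
proof -
  have rel: "abs_ualg x = abs_ualg y" if "x - y \<in> crels" for x y :: "gword alg"
    using that by (simp add: ualg.abs_eq_iff cideal_def two_sided_ideal_base)
  have "comm (ugen (Xp i)) (ugen (Xm i)) = ugen (Hg i)"
    unfolding ugen_def comm_def times_ualg.abs_eq minus_ualg.abs_eq
    by (rule rel) (auto simp: crels_gword_def comm_def)
  then show "comm (chev_e i) (chev_f i) = chev_h i"
    by (simp add: chev_e_def chev_f_def chev_h_def uscale_comm)
  have "comm (ugen (Hg i)) (ugen (Xp j)) = uscale (of_int (cartan i j)) (ugen (Xp j))"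
    unfolding ugen_def comm_def times_ualg.abs_eq minus_ualg.abs_eq uscale.abs_eq
    by (rule rel) (auto simp: crels_gword_def comm_def)
  then show "comm (chev_h i) (chev_e j) = uscale (of_int (symm i * cartan i j)) (chev_e j)"
    by (simp add: chev_e_def chev_h_def uscale_comm)
qed

definition Eh :: "node \<Rightarrow> Uh" where
  "Eh i = abs_halg (fps_const (letter (Xp i)))"

definition Kh :: "node \<Rightarrow> Uh" where
  "Kh i = abs_halg (freeK i)"

text \<open>\<open>[A, B]\<close> with parameter \<open>q\<^sup>k\<close>.\<close>

definition qcomm :: "int \<Rightarrow> Uh \<Rightarrow> Uh \<Rightarrow> Uh" where
  "qcomm k a b = a * b - hscalar (qpow k) * b * a"

text \<open>\<open>(K\<^sub>1 K\<^sub>2\<^sup>2 - 1) / h\<close>.  Over \<open>\<complex>[[h]]\<close> the group-like element \<open>K\<^sub>1 K\<^sub>2\<^sup>2\<close> is \<open>1\<close> modulo \<open>h\<close>,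
  and the toral part it stands for is only generated once it is divided by \<open>h\<close> (equivalently, by
  \<open>q - 1\<close>).\<close>

definition divided_toral :: Uh where
  "divided_toral = abs_halg (fps_shift 1 (freeK Short * freeK Long ^ 2 - 1))"

lemma divided_toral: "hmult divided_toral = Kh Short * Kh Long ^ 2 - 1"
proof -
  have X: "scal fps_X = (fps_X :: gword alg fps)"
    by (auto simp: fps_eq_iff scal_def cst_def fps_X_def)
  have "scal fps_X * fps_shift 1 x = x" if "fps_nth x 0 = 0" for x :: "gword alg fps"
    unfolding X using that by (auto simp: fps_eq_iff fps_X_mult_nth)
  moreover have "fps_nth (freeK Short * freeK Long ^ 2 - 1) 0 = 0"
    by (simp add: freeK_def hexp_def cst_1 power2_eq_square)
  ultimately show ?thesis
    unfolding hmult_def hscalar_def divided_toral_def Kh_def power2_eq_square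
    by (simp add: times_halg.abs_eq minus_halg.abs_eq one_halg.abs_eq)
qed

lemma specialize_divided_toral: "specialize divided_toral = chev_h Short + uscale 2 (chev_h Long)"
proof -
  have "cst 2 = (2 :: gword alg)"
    by (simp add: cst_def single_numeral)
  then show ?thesis
    unfolding divided_toral_def specialize.abs_eq chev_h_def ugen_def uscale.abs_eq plus_ualg.abs_eq
    by (simp add: freeK_def hexp_def power2_eq_square cst_1 mult_2 distrib_right add_ac)
qed

end

theory Submission
  imports Defs
begin

text \<open>
  \<^emph>\<open>Coideal.\<close>  The comultiplication is compatible with the defining relations, and on the iterated
  q-commutators \<open>E\<^sub>2, X, Y, Z, \<dots>\<close> it is computed from the q-commutation rules of
  \<open>a = E\<^sub>1 \<otimes> K\<^sub>1\<close>, \<open>b = 1 \<otimes> E\<^sub>1\<close>, \<open>c = E\<^sub>2 \<otimes> K\<^sub>2\<close>, \<open>d = 1 \<otimes> E\<^sub>2\<close>; one formula gives both the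
  compatibility with the quantum Serre relations (the mixed terms of the fourth commutator cancel)
  and \<open>\<Delta>(X), \<Delta>(Y), \<Delta>(Z) \<in> B \<otimes> U\<close>.

  \<^emph>\<open>Saturation.\<close>  The Serre relations imply q-commutation relations which say that modulo \<open>hB\<close> the
  generators satisfy the Lie brackets of \<open>\<hh>\<close>; those involving \<open>T\<close> follow from the Jacobi identity.
  Hence every element of \<open>B\<close> is a complex combination of ordered monomials modulo \<open>hB\<close>.  The
  specializations of these monomials are linearly independent, as one sees by letting \<open>U(\<gg>)\<close> act on
  the duals of the generalized Verma modules induced from the opposite of the parabolic subalgebra
  with nilradical \<open>\<langle>x\<^sub>2, \<dots>, x\<^sub>6\<rangle>\<close>.  So \<open>hu \<in> B\<close> forces \<open>hu \<in> hB\<close>.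

  \<^emph>\<open>Coisotropy.\<close>  By invariance of the Killing form, the r-matrix is a multiple of an explicit one, so
  that \<open>\<delta>(e\<^sub>i)\<close> is a multiple of \<open>e\<^sub>i \<wedge> h\<^sub>i\<close> and \<open>\<delta>(h\<^sub>i) = 0\<close>; the cocycle property propagates this.
\<close>

text \<open>Division by h is not an operation on classes of the completed quotient. Every divided
  difference, (K - K^-1)/h, (K - 1)/h or (q^m - 1)/h, is therefore handled on representatives, where
  h can be cancelled, and only then passed to the quotient.

  Saturation becomes a statement about U(g) alone: modulo hB the ordered monomials span B over the
  complex numbers, and their specializations have to be independent. For a fixed l, evaluation at
  the origin sees the powers of the toral generator only as powers of one number. Hence the family
  in l: the eigenvalue moves with l, and a dependence becomes a polynomial that vanishes everywhere.

  T is an ordinary commutator. It is reached in two ways, as [Z, E_2] and, modulo hB, as -[Y, X];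
  the Jacobi identity is applied to whichever expression has entries that commute with the third
  factor.

  For the r-matrix only ratios of Killing values matter. Invariance provides them, and the value on
  the long simple root remains as an overall factor.\<close>

section \<open>Scalars and completeness\<close>

lemma cst_central: "p * cst k = cst k * (p :: 'm::monoid_add alg)"
  by (induction p rule: alg_induct) (simp_all add: cst_def mult_single algebra_simps)

lemma cst_0: "cst 0 = 0"
  by (simp add: cst_def)

lemma cst_uminus: "cst (- c) = - cst c"
  by (simp add: cst_def single_uminus)

lemma cst_sum: "cst (\<Sum>i\<in>A. f i) = (\<Sum>i\<in>A. cst (f i))"
  by (induction A rule: infinite_finite_induct) (simp_all add: cst_0 cst_add[symmetric])

lemma scal_hom:
  shows "scal 0 = 0" "scal 1 = 1" "scal (f + g) = scal f + scal g" "scal (f - g) = scal f - scal g"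
    and "scal (f * g) = (scal f * scal g :: 'm::monoid_add alg fps)"
  by (auto simp: fps_eq_iff scal_def cst_add cst_diff cst_0 cst_1 fps_mult_nth cst_sum cst_mult)

lemma scal_const: "scal (fps_const c) = fps_const (cst c)"
  by (auto simp: fps_eq_iff scal_def cst_0)

lemma scal_X: "scal fps_X = fps_X"
  by (auto simp: fps_eq_iff scal_def cst_def fps_X_def)

lemma scal_central: "x * scal f = scal f * (x :: 'm::monoid_add alg fps)"
proof (rule fps_ext)
  fix n
  have "fps_nth (x * scal f) n = (\<Sum>i=0..n. cst (fps_nth f (n - i)) * fps_nth x i)"
    by (simp add: fps_mult_nth scal_def cst_central)
  also have "\<dots> = (\<Sum>i=0..n. cst (fps_nth f i) * fps_nth x (n - i))"
    by (rule sum.reindex_bij_witness[of _ "\<lambda>i. n - i" "\<lambda>i. n - i"]) auto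
  finally show "fps_nth (x * scal f) n = fps_nth (scal f * x) n"
    by (simp add: fps_mult_nth scal_def)
qed

lemma abs_halg_eq_iff: "abs_halg x = abs_halg y \<longleftrightarrow> x - y \<in> qideal"
  by (rule halg.abs_eq_iff)

lemma abs_halg_eq_0_iff: "abs_halg x = 0 \<longleftrightarrow> x \<in> qideal"
  by (simp add: zero_halg_def abs_halg_eq_iff)

lemma abs_halg_surj: "\<exists>y. x = abs_halg y"
  by (induct x) blast

lemmas abs_halg_hom = plus_halg.abs_eq[symmetric] times_halg.abs_eq[symmetric]
  minus_halg.abs_eq[symmetric] uminus_halg.abs_eq[symmetric]
  one_halg.abs_eq[symmetric] zero_halg.abs_eq[symmetric]

lemma abs_halg_power: "abs_halg (x ^ n) = abs_halg x ^ n"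
  by (induction n) (simp_all add: abs_halg_hom)

lemma qideal_base: "x \<in> qrels \<Longrightarrow> x \<in> qideal"
  unfolding qideal_def using closure_subset two_sided_ideal_base by blast

lemma qideal_closed:
  assumes "\<And>N. \<exists>y\<in>qideal. \<forall>n\<le>N. fps_nth y n = fps_nth x n"
  shows "x \<in> (qideal :: 'm::presented alg fps set)"
proof -
  have "x \<in> closure qideal"
    unfolding fps_in_closure_iff using assms by blast
  then show ?thesis by (simp add: qideal_def)
qed

text \<open>The series is the h-adic sum of h^n y_n. Its partial sums lie in the ideal and agree
  with it up to any prescribed order, and the ideal is closed. This is what lets relations pass to
  exponentials.\<close>

lemma qideal_sums:
  assumes "\<And>n. y n \<in> (qideal :: 'm::presented alg fps set)"
  shows "Abs_fps (\<lambda>m. \<Sum>n\<le>m. fps_nth (y n) (m - n)) \<in> qideal"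
proof (rule qideal_closed)
  fix N
  have "(\<Sum>n\<in>A. fps_X ^ n * y n) \<in> qideal" if "finite A" for A
    using that by induction (auto intro: qideal_ideal assms)
  moreover have "fps_nth (\<Sum>n\<le>N. fps_X ^ n * y n) m = (\<Sum>n\<le>m. fps_nth (y n) (m - n))"
    if "m \<le> N" for m
  proof -
    have "fps_nth (\<Sum>n\<le>N. fps_X ^ n * y n) m = (\<Sum>n\<le>N. if n \<le> m then fps_nth (y n) (m - n) else 0)"
      by (auto simp: fps_sum_nth fps_X_power_mult_nth intro!: sum.cong)
    also have "\<dots> = (\<Sum>n\<in>{n\<in>{..N}. n \<le> m}. fps_nth (y n) (m - n))"
      by (simp only: sum.inter_filter finite_atMost)
    also have "{n\<in>{..N}. n \<le> m} = {..m}" using that by auto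
    finally show ?thesis .
  qed
  ultimately show "\<exists>z\<in>qideal. \<forall>n\<le>N. fps_nth z n
      = fps_nth (Abs_fps (\<lambda>m. \<Sum>n\<le>m. fps_nth (y n) (m - n))) n"
    by (intro bexI[of _ "\<Sum>n\<le>N. fps_X ^ n * y n"]) auto
qed

text \<open>\<open>hscalar\<close> lives on the single algebra; the polymorphic version also serves
  the tensor square.\<close>

definition hs :: "complex fps \<Rightarrow> 'm::presented halg" where
  "hs f = abs_halg (scal f)"

lemma hscalar_eq_hs: "hscalar f = hs f"
  by (simp add: hscalar_def hs_def)

lemma hs_hom:
  shows "hs 0 = 0" "hs 1 = 1" "hs (f + g) = hs f + hs g" "hs (f - g) = hs f - hs g"
    and "hs (f * g) = (hs f * hs g :: 'm::presented halg)"
  by (simp_all add: hs_def scal_hom abs_halg_hom)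

lemma hs_uminus: "hs (- f) = - hs f"
  using hs_hom(4)[of 0 f] by (simp add: hs_hom)

lemma hs_central: "x * hs f = hs f * x"
  by (induct x) (simp add: hs_def times_halg.abs_eq scal_central)

lemma hs_left_commute: "x * (hs f * y) = hs f * (x * y)"
  by (metis hs_central mult.assoc)

section \<open>Exponentials\<close>

lemma cst_of_nat_Suc_cancel:
  assumes "cst (of_nat (Suc n)) * x = cst (of_nat (Suc n)) * y"
  shows "x = (y :: 'm::monoid_add alg)"
proof -
  have "cst (inverse (of_nat (Suc n))) * (cst (of_nat (Suc n)) * z) = z" for z :: "'m alg"
    by (simp add: mult.assoc[symmetric] cst_mult cst_1 del: of_nat_Suc)
  then show ?thesis using assms by metis
qed

lemma cst_left_commute: "p * (cst k * r) = cst k * (p * r :: 'm::monoid_add alg)"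
  by (metis cst_central mult.assoc)

lemma hexp_nth_0: "fps_nth (hexp c x) 0 = 1"
  by (simp add: hexp_def cst_1)

text \<open>The differential equation f' = c x f read coefficientwise; with f(0) = 1 it determines
  the exponential.\<close>

lemma hexp_nth_Suc:
  "cst (of_nat (Suc n)) * fps_nth (hexp c x) (Suc n) = cst (of_int c) * x * fps_nth (hexp c x) n"
proof -
  have "x * (cst (of_int c ^ n / fact n) * x ^ n) = cst (of_int c ^ n / fact n) * x ^ Suc n"
    by (simp add: cst_left_commute)
  moreover have "of_nat (Suc n) * (of_int c ^ Suc n / fact (Suc n)) = of_int c * (of_int c ^ n / fact n :: complex)"
    by (simp add: field_simps del: of_nat_Suc)
  ultimately show ?thesis
    by (simp only: hexp_def fps_nth_Abs_fps mult.assoc)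
      (simp only: mult.assoc[symmetric] cst_mult)
qed

lemma hexp_unique:
  assumes "fps_nth f 0 = 1"
    and "\<And>n. cst (of_nat (Suc n)) * fps_nth f (Suc n) = cst (of_int c) * x * fps_nth f n"
  shows "f = (hexp c x :: 'm::monoid_add alg fps)"
proof (rule fps_ext)
  fix n show "fps_nth f n = fps_nth (hexp c x) n"
  proof (induction n)
    case (Suc n)
    show ?case
      by (rule cst_of_nat_Suc_cancel[of n]) (simp only: assms(2) hexp_nth_Suc Suc)
  qed (simp add: assms hexp_nth_0)
qed

lemma hexp_commute:
  assumes "y * x = x * y"
  shows "y * fps_nth (hexp c x) n = fps_nth (hexp c x) n * (y :: 'm::monoid_add alg)"
proof -
  have "y * x ^ n = x ^ n * y"
    by (metis assms power_commuting_commutes)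
  then show ?thesis
    by (simp add: hexp_def mult.assoc cst_left_commute)
qed

text \<open>Both sides solve \<open>f' = c (x + y) f\<close>.\<close>

lemma hexp_add:
  assumes comm: "x * y = y * x"
  shows "hexp c (x + y) = hexp c x * (hexp c y :: 'm::monoid_add alg fps)"
proof (rule hexp_unique[symmetric])
  show "fps_nth (hexp c x * hexp c y) 0 = 1"
    by (simp add: hexp_nth_0)
  fix n
  let ?a = "fps_nth (hexp c x)" and ?b = "fps_nth (hexp c y)"
  \<comment> \<open>The factor n + 1 is split as i + (n + 1 - i): the first share differentiates the
    left exponential, the second the right one.\<close>
  have 1: "(\<Sum>i=0..Suc n. cst (of_nat i) * (?a i * ?b (Suc n - i)))
      = cst (of_int c) * x * (\<Sum>i=0..n. ?a i * ?b (n - i))"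
  proof -
    have "(\<Sum>i=0..Suc n. cst (of_nat i) * (?a i * ?b (Suc n - i)))
        = (\<Sum>i=0..n. cst (of_nat (Suc i)) * (?a (Suc i) * ?b (n - i)))"
      by (subst sum.atLeast0_atMost_Suc_shift) (simp add: cst_0 del: of_nat_Suc)
    also have "\<dots> = (\<Sum>i=0..n. cst (of_int c) * x * (?a i * ?b (n - i)))"
      by (simp only: mult.assoc[symmetric] hexp_nth_Suc)
    finally show ?thesis by (simp add: sum_distrib_left)
  qed
  have 2: "(\<Sum>i=0..Suc n. cst (of_nat (Suc n - i)) * (?a i * ?b (Suc n - i)))
      = cst (of_int c) * y * (\<Sum>i=0..n. ?a i * ?b (n - i))"
  proof -
    have "(\<Sum>i=0..Suc n. cst (of_nat (Suc n - i)) * (?a i * ?b (Suc n - i)))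
        = (\<Sum>i=0..n. cst (of_nat (Suc n - i)) * (?a i * ?b (Suc n - i)))"
      by (simp add: cst_0)
    also have "\<dots> = (\<Sum>i=0..n. cst (of_int c) * y * (?a i * ?b (n - i)))"
    proof (rule sum.cong)
      fix i assume "i \<in> {0..n}"
      then have *: "Suc n - i = Suc (n - i)" by auto
      have "cst (of_nat (Suc n - i)) * (?a i * ?b (Suc n - i))
          = ?a i * (cst (of_int c) * y * ?b (n - i))"
        unfolding * hexp_nth_Suc[symmetric] by (simp only: cst_left_commute)
      also have "\<dots> = cst (of_int c) * (y * ?a i * ?b (n - i))"
        by (simp only: mult.assoc cst_left_commute) (simp only: mult.assoc[symmetric] hexp_commute[OF comm[symmetric]])
      finally show "cst (of_nat (Suc n - i)) * (?a i * ?b (Suc n - i))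
          = cst (of_int c) * y * (?a i * ?b (n - i))" by (simp only: mult.assoc)
    qed simp
    finally show ?thesis by (simp add: sum_distrib_left)
  qed
  have "cst (of_nat (Suc n)) * fps_nth (hexp c x * hexp c y) (Suc n)
      = (\<Sum>i=0..Suc n. cst (of_nat i + of_nat (Suc n - i)) * (?a i * ?b (Suc n - i)))"
    unfolding fps_mult_nth sum_distrib_left
    by (rule sum.cong) (simp_all del: of_nat_Suc flip: of_nat_add)
  also have "\<dots> = cst (of_int c) * (x + y) * fps_nth (hexp c x * hexp c y) n"
    by (simp only: cst_add[symmetric] distrib_right distrib_left sum.distrib 1 2 fps_mult_nth)
  finally show "cst (of_nat (Suc n)) * fps_nth (hexp c x * hexp c y) (Suc n)
      = cst (of_int c) * (x + y) * fps_nth (hexp c x * hexp c y) n" .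
qed

lemma hexp_cst: "hexp c (cst a :: 'm::monoid_add alg) = scal (fps_exp (of_int c * a))"
proof -
  have *: "cst a ^ n = (cst (a ^ n) :: 'm alg)" for n
    by (induction n) (simp_all add: cst_1 cst_mult)
  show ?thesis
    by (auto simp: fps_eq_iff hexp_def scal_def cst_mult power_mult_distrib *)
qed

text \<open>Here an eigenvalue of H turns into a power of q: a root generator shifts H by an
  integer, and the shift leaves the exponential as a scalar factor.\<close>

lemma hexp_add_cst:
  "hexp c (x + cst (of_int a)) = scal (qpow (c * a)) * (hexp c x :: 'm::monoid_add alg fps)"
  by (subst hexp_add) (simp_all add: cst_central hexp_cst scal_central qpow_def)

text \<open>Termwise x^n E = E y^n, so the difference of the two series is an h-adic sum of elements
  of the ideal. The offset r covers both e^(hx), with r = 0, and (e^(hx) - 1)/h, with r = 1.\<close>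

lemma series_intertwine:
  fixes E' :: "'m::presented halg"
  assumes "abs_halg (fps_const x) * E' = E' * abs_halg (fps_const y)"
  shows "abs_halg (Abs_fps (\<lambda>n. cst (k n) * x ^ (n + r))) * E'
    = E' * abs_halg (Abs_fps (\<lambda>n. cst (k n) * y ^ (n + r)))"
proof -
  obtain E where E: "E' = abs_halg E" using abs_halg_surj by blast
  note abs_eq = assms[unfolded E]
  let ?k = "\<lambda>n. fps_const (cst (k n)) :: 'm alg fps"
  let ?s = "\<lambda>x. Abs_fps (\<lambda>n. cst (k n) * x ^ (n + r)) :: 'm alg fps"
  have "abs_halg (fps_const x) ^ n * abs_halg E = abs_halg E * abs_halg (fps_const y) ^ n" for n
  proof (induction n)
    case (Suc n)
    have "abs_halg (fps_const x) ^ Suc n * abs_halg E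
        = abs_halg (fps_const x) ^ n * (abs_halg (fps_const x) * abs_halg E)"
      by (simp only: power_Suc2 mult.assoc)
    also have "\<dots> = abs_halg E * abs_halg (fps_const y) ^ Suc n"
      by (simp only: abs_eq mult.assoc[symmetric] Suc) (simp only: mult.assoc power_Suc2)
    finally show ?case .
  qed simp
  then have "abs_halg (fps_const x ^ n * E - E * fps_const y ^ n) = 0" for n
    by (simp only: abs_halg_hom abs_halg_power diff_self)
  then have *: "?k n * (fps_const x ^ (n + r) * E - E * fps_const y ^ (n + r)) \<in> qideal" for n
    by (simp add: abs_halg_eq_0_iff qideal_ideal)
  have "?s x * E - E * ?s y = Abs_fps (\<lambda>m. \<Sum>n\<le>m.
      fps_nth (?k n * (fps_const x ^ (n + r) * E - E * fps_const y ^ (n + r))) (m - n))"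
  proof (rule fps_ext)
    fix m
    have const_power: "fps_const z ^ n = fps_const (z ^ n)" for z :: "'m alg" and n
      by (induction n) simp_all
    have "fps_nth (E * ?s y) m = (\<Sum>i=0..m. fps_nth E (m - i) * fps_nth (?s y) i)"
      unfolding fps_mult_nth
      by (rule sum.reindex_bij_witness[of _ "\<lambda>i. m - i" "\<lambda>i. m - i"]) auto
    then have "fps_nth (?s x * E - E * ?s y) m = (\<Sum>n=0..m. cst (k n)
        * (x ^ (n + r) * fps_nth E (m - n) - fps_nth E (m - n) * y ^ (n + r)))"
      by (simp add: fps_mult_nth sum_subtractf right_diff_distrib mult.assoc cst_left_commute)
    then show "fps_nth (?s x * E - E * ?s y) m = fps_nth (Abs_fps (\<lambda>m. \<Sum>n\<le>m.
      fps_nth (?k n * (fps_const x ^ (n + r) * E - E * fps_const y ^ (n + r))) (m - n))) m"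
      by (simp add: const_power atMost_atLeast0)
  qed
  then have "?s x * E - E * ?s y \<in> qideal"
    using qideal_sums[OF *] by simp
  then show ?thesis
    by (simp add: E times_halg.abs_eq abs_halg_eq_iff)
qed

lemma hexp_intertwine:
  fixes E :: "'m::presented halg"
  assumes "abs_halg (fps_const x) * E = E * abs_halg (fps_const y)"
  shows "abs_halg (hexp c x) * E = E * abs_halg (hexp c y)"
    and "abs_halg (fps_shift 1 (hexp c x - 1)) * E = E * abs_halg (fps_shift 1 (hexp c y - 1))"
proof -
  have "hexp c z = Abs_fps (\<lambda>n. cst (of_int c ^ n / fact n) * z ^ (n + 0))"
    and "fps_shift 1 (hexp c z - 1)
      = Abs_fps (\<lambda>n. cst (of_int c ^ Suc n / fact (Suc n)) * z ^ (n + 1))" for z :: "'m alg"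
    by (simp_all add: fps_eq_iff hexp_def)
  then show "abs_halg (hexp c x) * E = E * abs_halg (hexp c y)"
    and "abs_halg (fps_shift 1 (hexp c x - 1)) * E = E * abs_halg (fps_shift 1 (hexp c y - 1))"
    by (simp_all only: series_intertwine[OF assms])
qed

section \<open>The comultiplication descends to the quantized enveloping algebra\<close>

lemma leg_commute: "leg1 p * leg2 q = leg2 q * leg1 p"
proof (induction p rule: alg_induct)
  case (single k c)
  show ?case
    by (induction q rule: alg_induct)
      (simp_all add: mult_single leg1_single leg2_single leg2_add leg2_0 distrib_left
        distrib_right mult.commute)
qed (simp_all add: leg1_add leg1_0 distrib_left distrib_right)

lemma qleg_commute: "qleg1 x * qleg2 y = qleg2 y * qleg1 x"
proof (rule fps_ext)
  fix n
  have "fps_nth (qleg1 x * qleg2 y) n = (\<Sum>i=0..n. leg2 (fps_nth y (n - i)) * leg1 (fps_nth x i))"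
    by (simp add: fps_mult_nth qleg1_def qleg2_def leg_commute)
  also have "\<dots> = fps_nth (qleg2 y * qleg1 x) n"
    unfolding fps_mult_nth
    by (rule sum.reindex_bij_witness[of _ "\<lambda>i. n - i" "\<lambda>i. n - i"]) (auto simp: qleg1_def qleg2_def)
  finally show "fps_nth (qleg1 x * qleg2 y) n = fps_nth (qleg2 y * qleg1 x) n" .
qed

lemma leg_cst: "leg1 (cst c) = cst c" "leg2 (cst c) = cst c"
  by (simp_all add: cst_def leg1_single leg2_single zero_prod_def)

lemma qleg_scal: "qleg1 (scal f) = scal f" "qleg2 (scal f) = scal f"
  by (simp_all add: fps_eq_iff qleg1_def qleg2_def scal_def leg_cst)

lemmas qleg_1 = qleg_scal[of 1, unfolded scal_hom(2)]

lemmas leg_1 = leg_cst[of 1, unfolded cst_1]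

lemma leg1_power: "leg1 (x ^ n) = leg1 x ^ n"
  by (induction n) (simp_all add: leg1_mult leg_1)

lemma leg2_power: "leg2 (x ^ n) = leg2 x ^ n"
  by (induction n) (simp_all add: leg2_mult leg_1)

lemma qleg_hexp: "qleg1 (hexp c x) = hexp c (leg1 x)" "qleg2 (hexp c x) = hexp c (leg2 x)"
  by (simp_all add: fps_eq_iff qleg1_def qleg2_def hexp_def leg1_mult leg2_mult leg_cst leg1_power leg2_power)

lemma qleg_const: "qleg1 (fps_const p) = fps_const (leg1 p)" "qleg2 (fps_const p) = fps_const (leg2 p)"
  by (simp_all add: fps_eq_iff qleg1_def qleg2_def leg1_0 leg2_0)

lemma hleg_abs: "hleg1 (abs_halg x) = abs_halg (qleg1 x)" "hleg2 (abs_halg x) = abs_halg (qleg2 x)"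
  by (simp_all add: hleg1.abs_eq hleg2.abs_eq)

lemma hleg1_hom:
  shows "hleg1 0 = 0" "hleg1 1 = 1" "hleg1 (x + y) = hleg1 x + hleg1 y"
    "hleg1 (x - y) = hleg1 x - hleg1 y" "hleg1 (x * y) = hleg1 x * hleg1 y" "hleg1 (hs f) = hs f"
  by (use abs_halg_surj[of x] abs_halg_surj[of y] in
    \<open>auto simp: hs_def hleg_abs qleg1_hom qleg_scal qleg_1 plus_halg.abs_eq minus_halg.abs_eq
      times_halg.abs_eq zero_halg_def one_halg_def\<close>)+

lemma hleg2_hom:
  shows "hleg2 0 = 0" "hleg2 1 = 1" "hleg2 (x + y) = hleg2 x + hleg2 y"
    "hleg2 (x - y) = hleg2 x - hleg2 y" "hleg2 (x * y) = hleg2 x * hleg2 y" "hleg2 (hs f) = hs f"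
  by (use abs_halg_surj[of x] abs_halg_surj[of y] in
    \<open>auto simp: hs_def hleg_abs qleg2_hom qleg_scal qleg_1 plus_halg.abs_eq minus_halg.abs_eq
      times_halg.abs_eq zero_halg_def one_halg_def\<close>)+

lemma hleg_commute: "hleg1 x * hleg2 y = hleg2 y * hleg1 x"
proof -
  obtain x' y' where [simp]: "x = abs_halg x'" "y = abs_halg y'" using abs_halg_surj by metis
  show ?thesis by (simp add: hleg_abs times_halg.abs_eq qleg_commute)
qed

lemma htensor_mult: "(x \<otimes>\<^sub>h y) * (x' \<otimes>\<^sub>h y') = (x * x') \<otimes>\<^sub>h (y * y')"
proof -
  have "hleg2 y * (hleg1 x' * z) = hleg1 x' * (hleg2 y * z)" for z :: "('a \<times> 'b) halg"
    by (simp add: mult.assoc[symmetric] hleg_commute)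
  then show ?thesis
    by (simp add: htensor_def hleg1_hom hleg2_hom mult.assoc)
qed

lemma htensor_add:
  "(x + x') \<otimes>\<^sub>h y = x \<otimes>\<^sub>h y + x' \<otimes>\<^sub>h y" "x \<otimes>\<^sub>h (y + y') = x \<otimes>\<^sub>h y + x \<otimes>\<^sub>h y'"
  "(x - x') \<otimes>\<^sub>h y = x \<otimes>\<^sub>h y - x' \<otimes>\<^sub>h y" "x \<otimes>\<^sub>h (y - y') = x \<otimes>\<^sub>h y - x \<otimes>\<^sub>h y'"
  by (simp_all add: htensor_def hleg1_hom hleg2_hom algebra_simps)

lemma htensor_hs:
  "(hs f * x) \<otimes>\<^sub>h y = hs f * (x \<otimes>\<^sub>h y)" "x \<otimes>\<^sub>h (hs f * y) = hs f * (x \<otimes>\<^sub>h y)"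
  by (simp_all add: htensor_def hleg1_hom hleg2_hom mult.assoc hs_left_commute)

lemma htensor_0: "0 \<otimes>\<^sub>h y = 0" "x \<otimes>\<^sub>h 0 = 0" "1 \<otimes>\<^sub>h 1 = 1"
  by (simp_all add: htensor_def hleg1_hom hleg2_hom)

section \<open>The comultiplication as a homomorphism on the free algebra\<close>

lemma poly_comult_superset:
  assumes "finite A" "Poly_Mapping.keys p \<subseteq> A"
  shows "poly_comult p = (\<Sum>w\<in>A. scal (fps_const (poly_mapping.lookup p w)) * word_comult w)"
  unfolding poly_comult_def using assms
  by (intro sum.mono_neutral_left) (auto simp: in_keys_iff scal_hom)

lemma poly_comult_add: "poly_comult (p + q) = poly_comult p + poly_comult q"
proof -
  let ?A = "Poly_Mapping.keys p \<union> Poly_Mapping.keys q"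
  have "poly_comult (p + q) = (\<Sum>w\<in>?A. scal (fps_const (poly_mapping.lookup (p + q) w)) * word_comult w)"
    by (rule poly_comult_superset) (auto intro!: Poly_Mapping.keys_add)
  also have "\<dots> = (\<Sum>w\<in>?A. scal (fps_const (poly_mapping.lookup p w)) * word_comult w)
      + (\<Sum>w\<in>?A. scal (fps_const (poly_mapping.lookup q w)) * word_comult w)"
    by (simp add: lookup_add scal_hom distrib_right sum.distrib flip: fps_const_add)
  also have "\<dots> = poly_comult p + poly_comult q"
    by (simp add: poly_comult_superset[of ?A])
  finally show ?thesis .
qed

lemma poly_comult_single:
  "poly_comult (Poly_Mapping.single w c) = scal (fps_const c) * word_comult w"
  by (subst poly_comult_superset[of "{w}"]) (auto simp: lookup_single)

lemma poly_comult_0: "poly_comult 0 = 0"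
  by (simp add: poly_comult_def)

lemma poly_comult_cst: "poly_comult (cst c) = scal (fps_const c)"
  by (simp add: cst_def poly_comult_single zero_gword_def)

lemma poly_comult_letter: "poly_comult (letter g) = gen_comult g"
  by (simp add: letter_def poly_comult_single scal_hom)

lemma word_comult_add: "word_comult (u + v) = word_comult u * word_comult v"
  by (cases u; cases v) simp

lemma poly_comult_mult: "poly_comult (p * q) = poly_comult p * poly_comult q"
proof (induction p rule: alg_induct)
  case (single k c)
  show ?case
  proof (induction q rule: alg_induct)
    case (single l d)
    have "scal (fps_const (c * d)) * (word_comult k * word_comult l)
        = scal (fps_const c) * (scal (fps_const d) * word_comult k) * word_comult l"
      by (simp add: scal_hom mult.assoc flip: fps_const_mult)
    also have "scal (fps_const d) * word_comult k = word_comult k * scal (fps_const d)"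
      by (rule scal_central[symmetric])
    finally show ?case
      by (simp add: mult_single poly_comult_single word_comult_add mult.assoc)
  qed (simp_all add: poly_comult_0 poly_comult_add distrib_left)
qed (simp_all add: poly_comult_0 poly_comult_add distrib_right)

lemma free_comult_add: "free_comult (x + y) = free_comult x + free_comult y"
  by (simp add: fps_eq_iff free_comult_def poly_comult_add sum.distrib)

lemma free_comult_0: "free_comult 0 = 0"
  by (simp add: fps_eq_iff free_comult_def poly_comult_0)

lemma free_comult_sum: "free_comult (\<Sum>i\<in>A. f i) = (\<Sum>i\<in>A. free_comult (f i))"
  by (induction A rule: infinite_finite_induct) (simp_all add: free_comult_add free_comult_0)

lemma free_comult_monom: "free_comult (fps_X ^ n * fps_const p) = fps_X ^ n * poly_comult p"
proof (rule fps_ext)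
  fix m
  have "fps_nth (free_comult (fps_X ^ n * fps_const p)) m
      = (\<Sum>k\<le>m. if k = n then fps_nth (poly_comult p) (m - k) else 0)"
    unfolding free_comult_def fps_nth_Abs_fps
  proof (intro sum.cong refl)
    fix k
    show "fps_nth (poly_comult (fps_nth (fps_X ^ n * fps_const p) k)) (m - k)
        = (if k = n then fps_nth (poly_comult p) (m - k) else 0)"
      by (cases "k = n") (simp_all add: fps_X_power_mult_nth poly_comult_0)
  qed
  then show "fps_nth (free_comult (fps_X ^ n * fps_const p)) m = fps_nth (fps_X ^ n * poly_comult p) m"
    by (simp add: fps_X_power_mult_nth)
qed

lemma free_comult_const: "free_comult (fps_const p) = poly_comult p"
  using free_comult_monom[of 0] by simp

lemma free_comult_cong:
  assumes "\<And>k. k \<le> n \<Longrightarrow> fps_nth x k = fps_nth y k"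
  shows "fps_nth (free_comult x) n = fps_nth (free_comult y) n"
  using assms by (simp add: free_comult_def)

lemma fps_mult_cong:
  assumes "\<And>k. k \<le> n \<Longrightarrow> fps_nth x k = fps_nth x' k" "\<And>k. k \<le> n \<Longrightarrow> fps_nth y k = fps_nth y' k"
  shows "fps_nth (x * y) n = fps_nth (x' * y') n"
  using assms by (simp add: fps_mult_nth)

lemma fps_X_power_central: "x * fps_X ^ n = fps_X ^ n * x" for x :: "'a::ring_1 fps"
  by (simp add: fps_eq_iff fps_X_power_mult_nth fps_X_power_mult_right_nth)

text \<open>Coefficient n on either side depends only on the coefficients of x and y up to n. Both
  may thus be cut off to polynomials in h, where bilinearity reduces the claim to monomials.\<close>

lemma free_comult_mult: "free_comult (x * y) = free_comult x * free_comult y"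
proof (rule fps_ext)
  fix n
  define t where "t z = (\<Sum>i\<le>n. fps_X ^ i * fps_const (fps_nth z i))" for z :: "gword alg fps"
  have t: "fps_nth (t z) k = fps_nth z k" if "k \<le> n" for z k
  proof -
    have "fps_nth (t z) k = (\<Sum>i\<le>n. if i = k then fps_nth z i else 0)"
      unfolding t_def fps_sum_nth
    proof (intro sum.cong refl)
      fix i
      show "fps_nth (fps_X ^ i * fps_const (fps_nth z i)) k = (if i = k then fps_nth z i else 0)"
        by (cases "i = k") (simp_all add: fps_X_power_mult_nth)
    qed
    then show ?thesis using that by simp
  qed
  have X: "fps_X ^ i * p * (fps_X ^ j * q) = fps_X ^ (i + j) * (p * q)" for i j and p q :: "'b::ring_1 fps"
    unfolding power_add mult.assoc using fps_X_power_central[of p j]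
    by (simp only: mult.assoc[symmetric])
  have "free_comult (t x * t y) = free_comult (t x) * free_comult (t y)"
    unfolding t_def sum_product free_comult_sum X fps_const_mult free_comult_monom
      poly_comult_mult by (simp only: X)
  moreover have "fps_nth (free_comult (x * y)) n = fps_nth (free_comult (t x * t y)) n"
    by (intro free_comult_cong fps_mult_cong) (simp_all add: t)
  moreover have "fps_nth (free_comult x * free_comult y) n
      = fps_nth (free_comult (t x) * free_comult (t y)) n"
    by (intro free_comult_cong fps_mult_cong) (simp_all add: t)
  ultimately show "fps_nth (free_comult (x * y)) n = fps_nth (free_comult x * free_comult y) n"
    by simp
qed

lemma free_comult_scal: "free_comult (scal f) = scal f"
proof (rule fps_ext)
  fix n
  have "fps_nth (free_comult (scal f)) n = (\<Sum>k\<le>n. if k = n then cst (fps_nth f k) else 0)"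
    unfolding free_comult_def fps_nth_Abs_fps
  proof (intro sum.cong refl)
    fix k assume "k \<in> {..n}"
    then show "fps_nth (poly_comult (fps_nth (scal f) k)) (n - k)
        = (if k = n then cst (fps_nth f k) else 0)"
      by (cases "k = n") (simp_all add: scal_def poly_comult_cst cst_0)
  qed
  then show "fps_nth (free_comult (scal f)) n = fps_nth (scal f) n"
    by (simp add: scal_def)
qed

lemma free_comult_1: "free_comult 1 = 1"
  using free_comult_scal[of 1] by (simp add: scal_hom)

lemma free_comult_diff: "free_comult (x - y) = free_comult x - free_comult y"
  by (metis free_comult_add add_diff_cancel diff_add_cancel)

text \<open>H is primitive, so the coproduct of its exponential is the exponential of a sum of two
  commuting legs.\<close>

lemma free_comult_hexp_Hg:
  "free_comult (hexp c (letter (Hg i))) = qleg1 (hexp c (letter (Hg i))) * qleg2 (hexp c (letter (Hg i)))"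
proof -
  let ?h = "letter (Hg i)"
  let ?d = "leg1 ?h + leg2 ?h"
  have "poly_comult ?h = fps_const ?d"
    by (simp add: poly_comult_letter qleg_const)
  moreover have "poly_comult (?h ^ n) = poly_comult ?h ^ n" for n
    by (induction n) (simp_all add: poly_comult_mult poly_comult_cst[of 1, unfolded cst_1] scal_hom)
  moreover have "fps_const p ^ n = fps_const (p ^ n)" for p :: "(gword \<times> gword) alg" and n
    by (induction n) simp_all
  ultimately have *: "poly_comult (cst k * ?h ^ n) = fps_const (cst k * ?d ^ n)" for k n
    by (simp add: poly_comult_mult poly_comult_cst scal_const)
  have "free_comult (hexp c ?h) = hexp c ?d"
  proof (rule fps_ext)
    fix n
    have "fps_nth (free_comult (hexp c ?h)) n
        = (\<Sum>k\<le>n. if k = n then cst (of_int c ^ n / fact n) * ?d ^ n else 0)"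
      by (auto simp: free_comult_def hexp_def * intro!: sum.cong)
    then show "fps_nth (free_comult (hexp c ?h)) n = fps_nth (hexp c ?d) n"
      by (simp add: hexp_def)
  qed
  also have "\<dots> = hexp c (leg1 ?h) * hexp c (leg2 ?h)"
    by (rule hexp_add) (rule leg_commute)
  finally show ?thesis by (simp add: qleg_hexp)
qed

section \<open>Iterated q-commutators\<close>

definition qbr :: "'a::{ring,monoid_mult} \<Rightarrow> 'a \<Rightarrow> 'a \<Rightarrow> 'a" where
  "qbr t x y = x * y - t * y * x"

text \<open>For a = E_1 and c = E_2 the parameters are q^3, q, q^-1, q^-3, with p in the role of
  q^-1. They form the q-analogue of the fourfold bracket of E_2 with E_1, and \<open>nest4\<close>
  vanishes by the quantum Serre relation.\<close>

definition nest1 where "nest1 q a c = qbr (q * q * q) c a"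
definition nest2 where "nest2 q a c = qbr q (nest1 q a c) a"
definition nest3 where "nest3 q p a c = qbr p (nest2 q a c) a"
definition nest4 where "nest4 q p a c = qbr (p * p * p) (nest3 q p a c) a"

text \<open>The scalars are central ring elements rather than coefficients, so one computation
  serves the free algebra, the quantized algebra and its tensor square.\<close>

locale central_unit =
  fixes q p :: "'a::{ring,monoid_mult}"
  assumes q_central: "x * q = q * x" and p_central: "x * p = p * x" and qp: "q * p = 1"
begin

lemma pq: "p * q = 1"
  using p_central[of q] qp by simp

lemma cancels: "q * (p * x) = x" "p * (q * x) = x"
  by (simp_all add: qp pq flip: mult.assoc)

lemma central_left: "x * (q * y) = q * (x * y)" "x * (p * y) = p * (x * y)"
  by (metis q_central mult.assoc, metis p_central mult.assoc)

lemmas central_rules = q_central p_central central_left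

text \<open>Commuting b^k c with b at parameter t gives the factor q^-3 - t, and t runs through q^3,
  q, q^-1, q^-3. The last factor is zero, so b^4 c is absent from the fourth commutator. In the
  lower ones each mixed term is a power of b times a commutator of a and c.\<close>

lemma nest_comult:
  assumes ab: "a * b = q * (q * (b * a))" and cb: "c * b = p * (p * (p * (b * c)))"
    and ad: "a * d = p * (p * (p * (d * a)))"
  shows "nest1 q (a + b) (c + d) = nest1 q b d + nest1 q a c + (p * p * p - q * q * q) * (b * c)" (is ?n1)
    and "nest2 q (a + b) (c + d) = nest2 q b d + nest2 q a c
        + (p - q + p * p * p - q * q * q) * (b * nest1 q a c)
        + (p * p * p - q * q * q) * (p * p * p - q) * (b * b * c)" (is ?n2)
    and "nest3 q p (a + b) (c + d) = nest3 q p b d + nest3 q p a c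
        + (p * p * p - q * q * q) * (b * nest2 q a c)
        + (p * p * p - q * q * q) * (p * p * p - q) * (b * b * nest1 q a c)
        + (p * p * p - q * q * q) * (p * p * p - q) * (p * p * p - p) * (b * b * b * c)" (is ?n3)
    and "nest4 q p (a + b) (c + d) = nest4 q p b d + nest4 q p a c"
proof -
  define u1 u2 u3 v1 v2 v3 where uv: "u1 = nest1 q a c" "u2 = nest2 q a c" "u3 = nest3 q p a c"
    "v1 = nest1 q b d" "v2 = nest2 q b d" "v3 = nest3 q p b d"
  have cent: "z * q = q * z" "z * p = p * z" "z * (q * y) = q * (z * y)" "z * (p * y) = p * (z * y)"
    if "z \<in> {a, b, c, d, u1, u2, u3, v1, v2, v3}" for y z
    by (simp_all add: central_rules)
  note S = cent qp pq cancels
  \<comment> \<open>Products are kept right-associated, so every exchange rule is also needed with a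
    trailing factor.\<close>
  have ext: "x * (y * z) = w * z" if "x * y = w" for x y z w :: 'a
    using that by (simp flip: mult.assoc)
  note ab' = ab ext[OF ab]
  note cb' = cb ext[OF cb]
  note ad' = ad ext[OF ad]
  have ca: "c * a = u1 + q * (q * (q * (a * c)))" and db: "d * b = v1 + q * (q * (q * (b * d)))"
    by (simp_all add: uv nest1_def qbr_def mult.assoc)
  note ca' = ca ext[OF ca] db ext[OF db]
  have u1a: "u1 * a = u2 + q * (a * u1)" and v1b: "v1 * b = v2 + q * (b * v1)"
    and u2a: "u2 * a = u3 + p * (a * u2)" and v2b: "v2 * b = v3 + p * (b * v2)"
    by (simp_all add: uv nest2_def nest3_def qbr_def mult.assoc)
  note ua = u1a u2a v1b v2b ext[OF u1a] ext[OF u2a] ext[OF v1b] ext[OF v2b]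
  \<comment> \<open>The successive commutators have weights that pair with alpha_1 to -1, 1, 3; this
    explains the exchange factors q^-1, q, q^3 below.\<close>
  have u1b: "u1 * b = p * (b * u1)"
    unfolding uv(1) nest1_def qbr_def by (simp add: S ab' cb' algebra_simps)
  have av1: "a * v1 = p * (v1 * a)"
    unfolding uv(4) nest1_def qbr_def by (simp add: S ab' ad' algebra_simps)
  note 1 = u1b ext[OF u1b] av1 ext[OF av1]
  have "u2 = u1 * a - q * (a * u1)" "v2 = v1 * b - q * (b * v1)"
    by (simp_all add: u1a v1b)
  then have u2b: "u2 * b = q * (b * u2)" and av2: "a * v2 = q * (v2 * a)"
    by (simp_all only:) (simp_all add: S ab' 1 algebra_simps)
  note 2 = u2b ext[OF u2b] av2 ext[OF av2]
  have "u3 = u2 * a - p * (a * u2)" "v3 = v2 * b - p * (b * v2)"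
    by (simp_all add: u2a v2b)
  then have u3b: "u3 * b = q * (q * (q * (b * u3)))" and av3: "a * v3 = q * (q * (q * (v3 * a)))"
    by (simp_all only:) (simp_all add: S ab' 2 algebra_simps)
  note 3 = u3b ext[OF u3b] av3 ext[OF av3]
  show n1: ?n1
    unfolding uv[symmetric] unfolding nest1_def qbr_def
    by (simp add: S ab' cb' ad' ca' algebra_simps)
  show n2: ?n2
    unfolding nest2_def[of q "a + b"] n1 qbr_def unfolding uv[symmetric]
    by (simp add: S ab' cb' ca' 1 ua algebra_simps)
  show n3: ?n3
    unfolding nest3_def[of q p "a + b"] n2 qbr_def unfolding uv[symmetric]
    by (simp add: S ab' cb' ca' 1 2 ua algebra_simps)
  show "nest4 q p (a + b) (c + d) = nest4 q p b d + nest4 q p a c"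
    unfolding nest4_def[of q p "a + b"] n3 qbr_def unfolding nest4_def qbr_def uv[symmetric]
    by (simp add: S ab' cb' ca' 1 2 3 ua algebra_simps)
qed

text \<open>The long root counterpart, with a, b long and c, d short: (alpha_2, alpha_2) = 6
  accounts for q^6, and the parameters are q^3 and q^-3.\<close>

lemma short_nest_comult:
  assumes ab: "a * b = q * (q * (q * (q * (q * (q * (b * a))))))"
    and cb: "c * b = p * (p * (p * (b * c)))" and ad: "a * d = p * (p * (p * (d * a)))"
  shows "qbr (p * p * p) (nest1 q (a + b) (c + d)) (a + b)
    = qbr (p * p * p) (nest1 q b d) b + qbr (p * p * p) (nest1 q a c) a"
proof -
  have cent: "z * q = q * z" "z * p = p * z" "z * (q * y) = q * (z * y)" "z * (p * y) = p * (z * y)"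
    if "z \<in> {a, b, c, d}" for y z
    by (simp_all add: central_rules)
  have ext: "x * (y * z) = w * z" if "x * y = w" for x y z w :: 'a
    using that by (simp flip: mult.assoc)
  show ?thesis
    unfolding nest1_def qbr_def
    by (simp add: cent qp pq cancels ab cb ad ext[OF ab] ext[OF cb] ext[OF ad] algebra_simps)
qed

text \<open>Each relation is obtained from the previous one \<open>D = 0\<close> of weight \<open>\<beta>\<close> as
  \<open>D a - q\<^bsup>-(\<beta>, \<alpha>\<^sub>1)\<^esup> a D = 0\<close>.\<close>

lemma nest_relations:
  assumes serre: "nest4 q p a c = 0" "qbr (p * p * p) (nest1 q c a) c = 0"
  defines "x1 \<equiv> nest1 q a c" and "x2 \<equiv> nest2 q a c" and "x3 \<equiv> nest3 q p a c"
  shows "x1 * c - q * q * q * (c * x1) = 0" (is "?D1 = 0")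
    and "q * q * q * (x2 * c) - q * q * q * (c * x2) - (q * q * q * q - 1) * (x1 * x1) = 0" (is "?D2 = 0")
    and "q * q * q * q * q * q * (x3 * c) - q * q * q * (c * x3)
      + (q * q * q - q * q * q * q * q + q) * (x2 * x1)
      - (q * q + q * q * q * q - 1) * (x1 * x2) = 0" (is "?D3 = 0")
    and "(q * q * q * q + q * q) * (x3 * x1 - x1 * x3) + (p - q * q * q * q * q) * (x2 * x2) = 0" (is "?D4 = 0")
    and "(q * q + p * p) * (x3 * x2 - q * q * q * (x2 * x3)) = 0" (is "?D5 = 0")
proof -
  have cent: "z * q = q * z" "z * p = p * z" "z * (q * y) = q * (z * y)" "z * (p * y) = p * (z * y)"
    if "z \<in> {a, c, x1, x2, x3}" for y z
    by (simp_all add: central_rules)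
  have ext: "x * (y * z) = w * z" if "x * y = w" for x y z w :: 'a
    using that by (simp flip: mult.assoc)
  have 0: "c * a = x1 + q * (q * (q * (a * c)))"
    by (simp add: x1_def nest1_def qbr_def mult.assoc)
  have 1: "x1 * a = x2 + q * (a * x1)"
    by (simp add: x1_def x2_def nest2_def qbr_def mult.assoc)
  have 2: "x2 * a = x3 + p * (a * x2)"
    by (simp add: x2_def x3_def nest3_def qbr_def mult.assoc)
  have 3: "x3 * a = p * (p * (p * (a * x3)))"
    using serre(1) by (simp add: x3_def nest4_def qbr_def mult.assoc)
  note R = 0 1 2 3 ext[OF 0] ext[OF 1] ext[OF 2] ext[OF 3] cent qp pq cancels
  \<comment> \<open>The Serre relation of the long root, read as a q-commutation of
    \<open>x1\<close> with c; the chain starts from it.\<close>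
  have "?D1 = - (q * q * q * qbr (p * p * p) (nest1 q c a) c)"
    unfolding x1_def nest1_def qbr_def by (simp add: cent qp pq cancels algebra_simps)
  then show D1: "?D1 = 0" using serre by simp
  \<comment> \<open>The weights of the first four relations pair with alpha_1 to -4, -2, 0, 2,
    whence the factors q^4, q^2, 1, q^-2.\<close>
  have "?D2 = ?D1 * a - q * q * q * q * (a * ?D1)"
    by (simp add: R algebra_simps)
  then show D2: "?D2 = 0" by (simp only: D1) simp
  have "?D3 = ?D2 * a - q * q * (a * ?D2)"
    by (simp add: R algebra_simps)
  then show D3: "?D3 = 0" by (simp only: D2) simp
  have "?D4 = ?D3 * a - a * ?D3"
    by (simp add: R algebra_simps)
  then show D4: "?D4 = 0" by (simp only: D3) simp
  have "?D5 = ?D4 * a - p * p * (a * ?D4)"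
    by (simp add: R algebra_simps)
  then show "?D5 = 0" by (simp only: D4) simp
qed

end

section \<open>Relations in the quantized enveloping algebra\<close>

lemma qpow_mult: "qpow a * qpow b = qpow (a + b)"
  by (simp add: qpow_def fps_exp_add_mult)

lemma qpow_0: "qpow 0 = 1"
  by (simp add: qpow_def)

lemma qpow_nth_0: "fps_nth (qpow k) 0 = 1"
  by (simp add: qpow_def)

lemma qpow_words:
  "qpow 2 = qpow 1 * qpow 1" "qpow 3 = qpow 1 * qpow 1 * qpow 1"
  "qpow 4 = qpow 1 * qpow 1 * qpow 1 * qpow 1"
  "qpow 6 = qpow 1 * qpow 1 * qpow 1 * qpow 1 * qpow 1 * qpow 1"
  "qpow (-2) = qpow (-1) * qpow (-1)" "qpow (-3) = qpow (-1) * qpow (-1) * qpow (-1)"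
  "qpow (-4) = qpow (-1) * qpow (-1) * qpow (-1) * qpow (-1)"
  "qpow (-6) = qpow (-1) * qpow (-1) * qpow (-1) * qpow (-1) * qpow (-1) * qpow (-1)"
  by (simp_all add: qpow_mult)

lemma qfact_Suc: "qfact d (Suc m) = qint d (Suc m) * qfact d m"
  by (simp add: qfact_def mult.commute)

lemma qfact_nonzero: "qfact d m \<noteq> 0"
  using qfact_nth_0[of d m] by (metis fact_nonzero fps_zero_nth)

lemma qbinom_eqI:
  assumes "qfact d m = x * (qfact d r * qfact d (m - r))"
  shows "qbinom d m r = x"
  unfolding qbinom_def assms using qfact_nonzero by simp

lemma qint_eval:
  "qint d 1 = 1" "qint d 2 = qpow d + qpow (- d)" "qint d 3 = qpow (2 * d) + 1 + qpow (- 2 * d)"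
  "qint d 4 = qpow (3 * d) + qpow d + qpow (- d) + qpow (- 3 * d)"
  by (simp_all add: qint_def numeral_eq_Suc qpow_0 algebra_simps)

lemma qfact_eval:
  "qfact d 0 = 1" "qfact d (Suc 0) = 1" "qfact d 1 = 1" "qfact d 2 = qint d 2"
  "qfact d 3 = qint d 3 * qint d 2"
  "qfact d 4 = qint d 4 * (qint d 3 * qint d 2)"
  using qint_eval(1)[of d]
  by (simp_all add: qfact_Suc numeral_eq_Suc) (simp_all add: qfact_def)

lemma qbinom_eval:
  "qbinom d m 0 = 1" "qbinom d m m = 1"
  "qbinom d 2 (Suc 0) = qpow d + qpow (- d)"
  "qbinom d 4 (Suc 0) = qpow (3 * d) + qpow d + qpow (- d) + qpow (- 3 * d)"
  "qbinom d 4 3 = qpow (3 * d) + qpow d + qpow (- d) + qpow (- 3 * d)"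
  by (rule qbinom_eqI; simp add: qfact_eval qint_eval qpow_mult qpow_0 algebra_simps)+

lemma qbinom_eval_4_2:
  "qbinom d 4 2 = qpow (4 * d) + qpow (2 * d) + 1 + 1 + qpow (- 2 * d) + qpow (- 4 * d)" (is "_ = ?x")
proof -
  have "qint d 4 * qint d 3 = ?x * qint d 2"
    unfolding qint_eval by (simp add: distrib_left distrib_right qpow_mult qpow_0 algebra_simps)
  then show ?thesis
    by (intro qbinom_eqI) (simp add: qfact_eval flip: mult.assoc)
qed

text \<open>Left multiplication L and right multiplication R by x commute, so the product of R - t L
  over t = q^(d(m-1)), q^(d(m-3)), ..., q^(-d(m-1)) expands by the quantum binomial theorem. The
  identity already holds in the free algebra.\<close>

lemma qserre_nested:
  fixes d :: int
  defines "Q \<equiv> scal (qpow 1)" and "P \<equiv> scal (qpow (-1))"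
  shows "qserre 1 x y 4 = nest4 Q P (fps_const (letter x)) (fps_const (letter y))"
    and "qserre 3 x y 2 = qbr (P * P * P)
      (nest1 Q (fps_const (letter x)) (fps_const (letter y))) (fps_const (letter x))"
proof -
  interpret central_unit Q P
  proof
    show "Q * P = 1"
      by (simp add: Q_def P_def qpow_mult qpow_0 scal_hom(2) flip: scal_hom(5))
  qed (simp_all add: Q_def P_def scal_central)
  define a c where "a = fps_const (letter x)" and "c = fps_const (letter y)"
  have cent: "z * Q = Q * z" "z * P = P * z" "z * (Q * w) = Q * (z * w)" "z * (P * w) = P * (z * w)"
    if "z \<in> {a, c}" for z w
    by (simp_all add: central_rules)
  note S = cent qp pq cancels
  have 4: "{..4::nat} = {0, 1, 2, 3, 4}" and 2: "{..2::nat} = {0, 1, 2}" by auto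
  have s: "scal (qpow 2) = Q * Q" "scal (qpow 3) = Q * Q * Q" "scal (qpow 4) = Q * Q * Q * Q"
    "scal (qpow (-2)) = P * P" "scal (qpow (-3)) = P * P * P" "scal (qpow (-4)) = P * P * P * P"
    "scal (qpow 1) = Q" "scal (qpow (-1)) = P" "scal (- f) = - scal f"
    "scal 2 = 1 + 1" for f
    using scal_hom(4)[of 0 f] scal_hom(3)[of 1 1]
    by (simp_all add: Q_def P_def qpow_words scal_hom)
  show "qserre 1 x y 4 = nest4 Q P a c"
    unfolding qserre_def a_def[symmetric] c_def[symmetric] 4 nest4_def nest3_def nest2_def nest1_def qbr_def
    by (simp add: qbinom_eval qbinom_eval_4_2 scal_hom s)
      (simp add: S algebra_simps numeral_eq_Suc mult_2)
  show "qserre 3 x y 2 = qbr (P * P * P) (nest1 Q a c) a"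
    unfolding qserre_def a_def[symmetric] c_def[symmetric] 2 nest1_def qbr_def
    by (simp add: qbinom_eval qbinom_eval_4_2 scal_hom s)
      (simp add: S algebra_simps numeral_eq_Suc mult_2)
qed


section \<open>Generators of the quantized algebra and their exchange rules\<close>

definition hg :: "gen \<Rightarrow> Uh" where
  "hg g = abs_halg (fps_const (letter g))"

text \<open>The exponential of c h H_i; K_i and its inverse are the instances c = d_i and c =
  -d_i.\<close>

definition Kpow :: "int \<Rightarrow> node \<Rightarrow> Uh" where
  "Kpow c i = abs_halg (hexp c (letter (Hg i)))"

lemma Kh_eq: "Kh i = Kpow (symm i) i"
  by (simp add: Kh_def Kpow_def freeK_def)

lemma Eh_eq: "Eh i = hg (Xp i)"
  by (simp add: Eh_def hg_def)

lemma fps_const_hom: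
  "fps_const (a * b) = fps_const a * fps_const (b :: 'm::monoid_add alg)"
  "fps_const (a + b) = fps_const a + fps_const (b :: 'm::monoid_add alg)"
  "fps_const (a - b) = fps_const a - fps_const (b :: 'm::monoid_add alg)"
  "fps_const (cst c) = (scal (fps_const c) :: 'm::monoid_add alg fps)"
  by (simp_all add: scal_const)

lemma qrels_0: "s \<in> qrels \<Longrightarrow> abs_halg s = 0"
  by (simp add: abs_halg_eq_0_iff qideal_base)

lemma qrels_H_H: "fps_const (comm (letter (Hg i)) (letter (Hg j))) \<in> qrels"
  and qrels_H_Xp: "fps_const (comm (letter (Hg i)) (letter (Xp j))
      - cst (of_int (cartan i j)) * letter (Xp j)) \<in> qrels"
  and qrels_H_Xm: "fps_const (comm (letter (Hg i)) (letter (Xm j))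
      + cst (of_int (cartan i j)) * letter (Xm j)) \<in> qrels"
  and qrels_Xp_Xm: "fps_const (comm (letter (Xp i)) (letter (Xm j)))
      - (if i = j then Kquot i else 0) \<in> qrels"
  and qrels_serre: "i \<noteq> j \<Longrightarrow> qserre (symm i) (Xp i) (Xp j) (nat (1 - cartan i j)) \<in> qrels"
    "i \<noteq> j \<Longrightarrow> qserre (symm i) (Xm i) (Xm j) (nat (1 - cartan i j)) \<in> qrels"
  unfolding qrels_gword_def by blast+

lemma H_H: "hg (Hg i) * hg (Hg j) = hg (Hg j) * hg (Hg i)"
  using qrels_0[OF qrels_H_H[of i j]]
  unfolding comm_def fps_const_hom abs_halg_hom hg_def[symmetric] by simp

text \<open>Passing E_j shifts H_i by a constant. The rule is kept in this shifted form because
  \<open>hexp_intertwine\<close> asks for it.\<close>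

lemma H_Xp: "hg (Hg i) * hg (Xp j) = hg (Xp j) * abs_halg (fps_const (letter (Hg i) + cst (of_int (cartan i j))))"
  using qrels_0[OF qrels_H_Xp[of i j]]
  unfolding comm_def fps_const_hom abs_halg_hom hg_def[symmetric] hs_def[symmetric]
  by (simp add: distrib_left hs_central algebra_simps)

lemma H_Xm: "hg (Hg i) * hg (Xm j) = hg (Xm j) * abs_halg (fps_const (letter (Hg i) + cst (of_int (- cartan i j))))"
  using qrels_0[OF qrels_H_Xm[of i j]]
  unfolding comm_def fps_const_hom abs_halg_hom hg_def[symmetric] hs_def[symmetric]
  by (simp add: distrib_left hs_central hs_uminus algebra_simps flip: fps_const_neg)

lemma Xp_Xm: "hg (Xp i) * hg (Xm j) - hg (Xm j) * hg (Xp i) = (if i = j then abs_halg (Kquot i) else 0)"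
  using qrels_0[OF qrels_Xp_Xm[of i j]]
  unfolding comm_def fps_const_hom abs_halg_hom hg_def[symmetric]
  by (cases "i = j") (simp_all add: abs_halg_hom)

lemma Kpow_H: "Kpow c i * hg (Hg j) = hg (Hg j) * Kpow c i"
  unfolding Kpow_def by (rule hexp_intertwine(1)) (simp add: H_H flip: hg_def)

lemma Kpow_Kpow: "Kpow c i * Kpow d j = Kpow d j * Kpow c i"
  unfolding Kpow_def[of c i]
  by (rule hexp_intertwine(1)) (simp add: Kpow_H flip: hg_def)

lemma Kpow_Xp: "Kpow c i * hg (Xp j) = hs (qpow (c * cartan i j)) * (hg (Xp j) * Kpow c i)"
  unfolding Kpow_def
  using hexp_intertwine(1)[OF H_Xp[of i j, unfolded hg_def[of "Hg i"]], of c]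
  by (simp add: hexp_add_cst abs_halg_hom hs_left_commute flip: hs_def)

lemma Kpow_Xm: "Kpow c i * hg (Xm j) = hs (qpow (- (c * cartan i j))) * (hg (Xm j) * Kpow c i)"
  unfolding Kpow_def
  using hexp_intertwine(1)[OF H_Xm[of i j, unfolded hg_def[of "Hg i"]], of c]
  unfolding hexp_add_cst
  by (simp add: abs_halg_hom hs_left_commute flip: hs_def)

definition qq :: "'m::presented halg" where "qq = hs (qpow 1)"
definition pp :: "'m::presented halg" where "pp = hs (qpow (-1))"

global_interpretation Q: central_unit "qq :: 'm::presented halg" pp
proof
  show "(qq * pp :: 'm halg) = 1"
    by (simp add: qq_def pp_def qpow_mult qpow_0 hs_hom(2) flip: hs_hom(5))
qed (simp_all add: qq_def pp_def hs_central)

lemma hs_qpow_words: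
  "hs (qpow 1) = qq" "hs (qpow (-1)) = pp" "hs (qpow 2) = qq * qq" "hs (qpow (-2)) = pp * pp"
  "hs (qpow 3) = qq * qq * qq" "hs (qpow (-3)) = pp * pp * pp"
  "hs (qpow 6) = qq * qq * qq * qq * qq * qq" "hs (qpow (-6)) = pp * pp * pp * pp * pp * pp"
  by (simp_all add: qq_def pp_def qpow_words hs_hom)

lemma serre_relations:
  assumes "x = Xp \<or> x = Xm"
  shows "nest4 qq pp (hg (x Short)) (hg (x Long)) = 0"
    and "qbr (pp * pp * pp) (nest1 qq (hg (x Long)) (hg (x Short))) (hg (x Long)) = 0"
proof -
  have "qserre 1 (x Short) (x Long) 4 \<in> qrels" "qserre 3 (x Long) (x Short) 2 \<in> qrels"
    using qrels_serre[of Short Long] qrels_serre[of Long Short] assms by auto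
  then have *: "abs_halg (qserre 1 (x Short) (x Long) 4) = 0"
    "abs_halg (qserre 3 (x Long) (x Short) 2) = 0"
    by (simp_all add: qrels_0)
  show "nest4 qq pp (hg (x Short)) (hg (x Long)) = 0"
    using *(1) unfolding qserre_nested
    by (simp only: nest1_def nest2_def nest3_def nest4_def qbr_def abs_halg_hom hg_def qq_def pp_def hs_def)
  show "qbr (pp * pp * pp) (nest1 qq (hg (x Long)) (hg (x Short))) (hg (x Long)) = 0"
    using *(2) unfolding qserre_nested
    by (simp only: nest1_def qbr_def abs_halg_hom hg_def qq_def pp_def hs_def)
qed

section \<open>The comultiplication\<close>

text \<open>The coproduct of a representative, taken in the quotient. It is multiplicative on the
  free algebra, so compatibility with the relations becomes a computation with the
  generators.\<close>

definition pcomult :: "gword alg fps \<Rightarrow> (gword \<times> gword) halg" where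
  "pcomult x = abs_halg (free_comult x)"

lemma pcomult_hom:
  shows "pcomult 0 = 0" "pcomult 1 = 1" "pcomult (x + y) = pcomult x + pcomult y"
    "pcomult (x - y) = pcomult x - pcomult y" "pcomult (x * y) = pcomult x * pcomult y"
    "pcomult (scal f) = hs f"
  by (simp_all add: pcomult_def free_comult_0 free_comult_1 free_comult_add free_comult_diff
      free_comult_mult free_comult_scal hs_def abs_halg_hom)

definition cop :: "gen \<Rightarrow> (gword \<times> gword) halg" where
  "cop g = pcomult (fps_const (letter g))"

lemma cop_eq:
  shows "cop (Xp i) = hg (Xp i) \<otimes>\<^sub>h Kpow (symm i) i + 1 \<otimes>\<^sub>h hg (Xp i)"
    and "cop (Xm i) = hg (Xm i) \<otimes>\<^sub>h 1 + Kpow (- symm i) i \<otimes>\<^sub>h hg (Xm i)"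
    and "cop (Hg i) = hg (Hg i) \<otimes>\<^sub>h 1 + 1 \<otimes>\<^sub>h hg (Hg i)"
  by (simp_all add: cop_def pcomult_def free_comult_const poly_comult_letter abs_halg_hom hleg_abs[symmetric]
      htensor_def hleg1_hom hleg2_hom hg_def Kpow_def freeK_def freeKinv_def)

lemma pcomult_hexp: "pcomult (hexp c (letter (Hg i))) = Kpow c i \<otimes>\<^sub>h Kpow c i"
  by (simp add: pcomult_def free_comult_hexp_Hg abs_halg_hom hleg_abs[symmetric] htensor_def Kpow_def)

text \<open>In the free algebra h is not a zero divisor. Divided expressions are compared there
  after multiplication by h, before passing to the quotient.\<close>

lemma fps_X_left_cancel: "fps_X * x = fps_X * y \<Longrightarrow> x = y" for x y :: "'a::ring_1 fps"
proof (rule fps_ext)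
  fix n assume "fps_X * x = fps_X * y"
  then have "fps_nth (fps_X * x) (Suc n) = fps_nth (fps_X * y) (Suc n)" by simp
  then show "fps_nth x n = fps_nth y n" by (simp add: fps_X_mult_nth)
qed

lemma fps_X_shift: "fps_nth x 0 = 0 \<Longrightarrow> fps_X * fps_shift 1 x = x" for x :: "'a::ring_1 fps"
  by (auto simp: fps_eq_iff fps_X_mult_nth)

lemma free_comult_X: "free_comult (fps_X * x) = fps_X * free_comult x"
  by (simp add: free_comult_mult free_comult_scal flip: scal_X)

lemma qleg_X: "qleg1 (fps_X * x) = fps_X * qleg1 x" "qleg2 (fps_X * x) = fps_X * qleg2 x"
  by (simp_all add: qleg1_hom(4) qleg2_hom(4) qleg_scal flip: scal_X)

lemma fps_X_left_commute: "x * (fps_X * y) = fps_X * (x * y)" for x y :: "'a::ring_1 fps"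
  using fps_X_power_central[of x 1] by (simp flip: mult.assoc)

text \<open>K - K^-1 is skew-primitive: K \<otimes> K - K^-1 \<otimes> K^-1 telescopes through K^-1
  \<otimes> K. Division by h keeps this shape.\<close>

lemma pcomult_Kquot:
  "pcomult (Kquot i) = abs_halg (Kquot i) \<otimes>\<^sub>h Kpow (symm i) i + Kpow (- symm i) i \<otimes>\<^sub>h abs_halg (Kquot i)"
proof -
  define D where "D = freeK i - freeKinv i"
  let ?s = "fps_shift 1 D"
  have D: "fps_X * ?s = D"
    by (rule fps_X_shift) (simp add: D_def freeK_def freeKinv_def hexp_nth_0)
  have "fps_X * free_comult ?s = free_comult D"
    by (simp only: D flip: free_comult_X)
  also have "\<dots> = qleg1 (freeK i) * qleg2 (freeK i) - qleg1 (freeKinv i) * qleg2 (freeKinv i)"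
    by (simp add: D_def free_comult_diff freeK_def freeKinv_def free_comult_hexp_Hg)
  also have "\<dots> = qleg1 D * qleg2 (freeK i) + qleg1 (freeKinv i) * qleg2 D"
    by (simp add: D_def qleg1_hom qleg2_hom algebra_simps)
  also have "\<dots> = qleg1 (fps_X * ?s) * qleg2 (freeK i) + qleg1 (freeKinv i) * qleg2 (fps_X * ?s)"
    by (simp only: D)
  also have "\<dots> = fps_X * (qleg1 ?s * qleg2 (freeK i) + qleg1 (freeKinv i) * qleg2 ?s)"
    by (simp add: qleg_X fps_X_left_commute mult.assoc distrib_left)
  finally have "free_comult ?s = qleg1 ?s * qleg2 (freeK i) + qleg1 (freeKinv i) * qleg2 ?s"
    by (rule fps_X_left_cancel)
  then have s: "pcomult ?s = abs_halg ?s \<otimes>\<^sub>h Kpow (symm i) i + Kpow (- symm i) i \<otimes>\<^sub>h abs_halg ?s"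
    by (simp add: pcomult_def abs_halg_hom hleg_abs[symmetric] htensor_def Kpow_def freeK_def freeKinv_def)
  show ?thesis
    unfolding Kquot_def D_def[symmetric] pcomult_hom s abs_halg_hom hs_def[symmetric] htensor_hs
    by (simp add: distrib_left)
qed

lemma pcomult_const:
  "pcomult (fps_const (letter g)) = cop g"
  "pcomult (fps_const (comm p q)) = comm (pcomult (fps_const p)) (pcomult (fps_const q))"
  by (simp_all only: cop_def comm_def fps_const_hom pcomult_hom)

lemma H_Xp_comm: "hg (Hg i) * hg (Xp j)
    = hg (Xp j) * hg (Hg i) + hs (fps_const (of_int (cartan i j))) * hg (Xp j)"
  unfolding H_Xp fps_const_hom abs_halg_hom hg_def[symmetric] hs_def[symmetric]
  by (simp add: distrib_left hs_central)

lemma H_Xm_comm: "hg (Hg i) * hg (Xm j)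
    = hg (Xm j) * hg (Hg i) - hs (fps_const (of_int (cartan i j))) * hg (Xm j)"
  unfolding H_Xm fps_const_hom abs_halg_hom hg_def[symmetric] hs_def[symmetric]
  by (simp add: distrib_left right_diff_distrib hs_central hs_uminus flip: fps_const_neg)

lemma pcomult_H_H: "comm (cop (Hg i)) (cop (Hg j)) = 0"
  by (simp add: comm_def cop_eq distrib_left distrib_right htensor_mult H_H)

lemma pcomult_H_Xp: "comm (cop (Hg i)) (cop (Xp j)) = hs (fps_const (of_int (cartan i j))) * cop (Xp j)"
  by (simp add: comm_def cop_eq distrib_left distrib_right htensor_mult H_Xp_comm Kpow_H[of _ _ i]
      htensor_add htensor_hs)

lemma pcomult_H_Xm: "comm (cop (Hg i)) (cop (Xm j)) = - (hs (fps_const (of_int (cartan i j))) * cop (Xm j))"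
  by (simp add: comm_def cop_eq distrib_left distrib_right htensor_mult H_Xm_comm Kpow_H[of _ _ i]
      htensor_add htensor_hs)

lemma symm_cartan: "symm i * cartan i j = symm j * cartan j i"
  by (cases i; cases j) simp_all

text \<open>The mixed terms pair E_i \<otimes> K_i with K_j^-1 \<otimes> F_j. Exchanging them costs
  the same power of q in both legs, because d_i a_ij is symmetric, so they cancel.\<close>

lemma pcomult_Xp_Xm: "comm (cop (Xp i)) (cop (Xm j)) = (if i = j then pcomult (Kquot i) else 0)"
proof -
  let ?q = "hs (qpow (- (symm i * cartan i j))) :: (gword \<times> gword) halg"
  have "comm (cop (Xp i)) (cop (Xm j))
      = (hg (Xp i) * hg (Xm j) - hg (Xm j) * hg (Xp i)) \<otimes>\<^sub>h Kpow (symm i) i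
      + (?q * ((hg (Xp i) * Kpow (- symm j) j) \<otimes>\<^sub>h (hg (Xm j) * Kpow (symm i) i))
      - ?q * ((hg (Xp i) * Kpow (- symm j) j) \<otimes>\<^sub>h (hg (Xm j) * Kpow (symm i) i)))
      + Kpow (- symm j) j \<otimes>\<^sub>h (hg (Xp i) * hg (Xm j) - hg (Xm j) * hg (Xp i))"
    by (simp add: comm_def cop_eq distrib_left distrib_right htensor_mult htensor_add htensor_hs
        Kpow_Xp Kpow_Xm symm_cartan[of j i])
  then show ?thesis
    by (simp add: Xp_Xm pcomult_Kquot htensor_0)
qed

lemma qbr_htensor:
  assumes "l * k = k * l"
  shows "qbr (hs f) (x \<otimes>\<^sub>h k) (y \<otimes>\<^sub>h l) = qbr (hs f) x y \<otimes>\<^sub>h (k * l)"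
    and "qbr (hs f) (k \<otimes>\<^sub>h x) (l \<otimes>\<^sub>h y) = (k * l) \<otimes>\<^sub>h qbr (hs f) x y"
  by (simp_all add: qbr_def htensor_mult htensor_add htensor_hs mult.assoc assms)

lemma left_commute: "k * l = l * k \<Longrightarrow> k * (l * z) = l * (k * z)" for k l z :: "'a::monoid_mult"
  by (simp flip: mult.assoc)

lemma nest_htensor:
  assumes "k * l = l * k"
  shows "nest1 qq (x \<otimes>\<^sub>h k) (y \<otimes>\<^sub>h l) = nest1 qq x y \<otimes>\<^sub>h (l * k)"
    and "nest2 qq (x \<otimes>\<^sub>h k) (y \<otimes>\<^sub>h l) = nest2 qq x y \<otimes>\<^sub>h (l * k * k)"
    and "nest3 qq pp (x \<otimes>\<^sub>h k) (y \<otimes>\<^sub>h l) = nest3 qq pp x y \<otimes>\<^sub>h (l * k * k * k)"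
    and "nest4 qq pp (x \<otimes>\<^sub>h k) (y \<otimes>\<^sub>h l) = nest4 qq pp x y \<otimes>\<^sub>h (l * k * k * k * k)"
    and "qbr (pp * pp * pp) (nest1 qq (x \<otimes>\<^sub>h k) (y \<otimes>\<^sub>h l)) (x \<otimes>\<^sub>h k)
      = qbr (pp * pp * pp) (nest1 qq x y) x \<otimes>\<^sub>h (l * k * k)"
    and "nest4 qq pp (k \<otimes>\<^sub>h x) (l \<otimes>\<^sub>h y) = (l * k * k * k * k) \<otimes>\<^sub>h nest4 qq pp x y"
    and "qbr (pp * pp * pp) (nest1 qq (k \<otimes>\<^sub>h x) (l \<otimes>\<^sub>h y)) (k \<otimes>\<^sub>h x)
      = (l * k * k) \<otimes>\<^sub>h qbr (pp * pp * pp) (nest1 qq x y) x"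
  unfolding nest4_def nest3_def nest2_def nest1_def
  unfolding hs_qpow_words(5,6)[symmetric] unfolding hs_qpow_words(1,2)[symmetric]
  by (simp_all add: qbr_htensor mult.assoc assms left_commute[OF assms])

lemma nest_qleg:
  shows "nest1 qq (1 \<otimes>\<^sub>h x) (1 \<otimes>\<^sub>h y) = 1 \<otimes>\<^sub>h nest1 qq x y"
    and "nest2 qq (1 \<otimes>\<^sub>h x) (1 \<otimes>\<^sub>h y) = 1 \<otimes>\<^sub>h nest2 qq x y"
    and "nest3 qq pp (1 \<otimes>\<^sub>h x) (1 \<otimes>\<^sub>h y) = 1 \<otimes>\<^sub>h nest3 qq pp x y"
  unfolding nest3_def nest2_def nest1_def unfolding hs_qpow_words(5,6)[symmetric] unfolding hs_qpow_words(1,2)[symmetric]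
  by (simp_all add: qbr_htensor)

lemma cop_exchange:
  "(hg (Xp i) \<otimes>\<^sub>h Kpow (symm i) i) * (1 \<otimes>\<^sub>h hg (Xp j))
    = hs (qpow (symm i * cartan i j)) * ((1 \<otimes>\<^sub>h hg (Xp j)) * (hg (Xp i) \<otimes>\<^sub>h Kpow (symm i) i))"
  "(Kpow (- symm i) i \<otimes>\<^sub>h hg (Xm i)) * (hg (Xm j) \<otimes>\<^sub>h 1)
    = hs (qpow (symm i * cartan i j)) * ((hg (Xm j) \<otimes>\<^sub>h 1) * (Kpow (- symm i) i \<otimes>\<^sub>h hg (Xm i)))"
  by (simp_all add: htensor_mult Kpow_Xp Kpow_Xm htensor_hs)

lemma cop_serre:
  assumes "x = Xp \<or> x = Xm"
  shows "nest4 qq pp (cop (x Short)) (cop (x Long)) = 0"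
    and "qbr (pp * pp * pp) (nest1 qq (cop (x Long)) (cop (x Short))) (cop (x Long)) = 0"
proof -
  \<comment> \<open>For the negative generators the summands trade places, K^-1 \<otimes> F acting
    as a and F \<otimes> 1 as b; both signs then obey the same exchange rules.\<close>
  define a b where "a i = (if x = Xp then hg (Xp i) \<otimes>\<^sub>h Kpow (symm i) i
      else Kpow (- symm i) i \<otimes>\<^sub>h hg (Xm i))"
    and "b i = (if x = Xp then 1 \<otimes>\<^sub>h hg (Xp i) else hg (Xm i) \<otimes>\<^sub>h 1)" for i
  have ne: "Xm \<noteq> Xp" by (metis gen.distinct(1))
  have cop: "cop (x i) = a i + b i" for i
    using assms ne by (auto simp: a_def b_def cop_eq)
  have ex: "a i * b j = hs (qpow (symm i * cartan i j)) * (b j * a i)" for i j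
    using assms ne by (auto simp: a_def b_def cop_exchange)
  have ex': "a Short * b Short = qq * (qq * (b Short * a Short))"
    "a Long * b Long = qq * (qq * (qq * (qq * (qq * (qq * (b Long * a Long))))))"
    "a Short * b Long = pp * (pp * (pp * (b Long * a Short)))"
    "a Long * b Short = pp * (pp * (pp * (b Short * a Long)))"
    unfolding ex by (simp_all add: hs_qpow_words mult.assoc)
  have S: "nest4 qq pp (a Short) (a Long) = 0" "nest4 qq pp (b Short) (b Long) = 0"
    "qbr (pp * pp * pp) (nest1 qq (a Long) (a Short)) (a Long) = 0"
    "qbr (pp * pp * pp) (nest1 qq (b Long) (b Short)) (b Long) = 0"
    using assms ne serre_relations[OF assms]
    by (auto simp: a_def b_def nest_htensor(4-7) htensor_0 Kpow_Kpow)
  show "nest4 qq pp (cop (x Short)) (cop (x Long)) = 0"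
    unfolding cop Q.nest_comult(4)[OF ex'(1,4,3)] by (simp add: S)
  show "qbr (pp * pp * pp) (nest1 qq (cop (x Long)) (cop (x Short))) (cop (x Long)) = 0"
    unfolding cop Q.short_nest_comult[OF ex'(2,3,4)] by (simp add: S)
qed

lemma pcomult_serre:
  "pcomult (qserre 1 x y 4) = nest4 qq pp (cop x) (cop y)"
  "pcomult (qserre 3 x y 2) = qbr (pp * pp * pp) (nest1 qq (cop x) (cop y)) (cop x)"
  unfolding qserre_nested nest4_def nest3_def nest2_def nest1_def qbr_def qq_def pp_def
  by (simp_all only: pcomult_hom pcomult_const)

lemma pcomult_qrels: "s \<in> qrels \<Longrightarrow> pcomult s = 0"
proof -
  have serre: "pcomult (qserre (symm i) (x i) (x j) (nat (1 - cartan i j))) = 0"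
    if "i \<noteq> j" "x = Xp \<or> x = Xm" for i j x
    using that cop_serre[OF that(2)] by (cases i; cases j) (auto simp: pcomult_serre)
  show "s \<in> qrels \<Longrightarrow> pcomult s = 0"
    unfolding qrels_gword_def
  proof (elim UnE CollectE exE conjE)
    fix i j
    show "s = fps_const (comm (letter (Hg i)) (letter (Hg j))) \<Longrightarrow> pcomult s = 0"
      by (simp add: pcomult_const pcomult_H_H)
    show "s = fps_const (comm (letter (Hg i)) (letter (Xp j))
        - cst (of_int (cartan i j)) * letter (Xp j)) \<Longrightarrow> pcomult s = 0"
      by (simp only: fps_const_hom pcomult_hom pcomult_const pcomult_H_Xp diff_self)
    show "s = fps_const (comm (letter (Hg i)) (letter (Xm j))
        + cst (of_int (cartan i j)) * letter (Xm j)) \<Longrightarrow> pcomult s = 0"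
      by (simp only: fps_const_hom pcomult_hom pcomult_const pcomult_H_Xm left_minus)
    show "s = fps_const (comm (letter (Xp i)) (letter (Xm j))) - (if i = j then Kquot i else 0)
        \<Longrightarrow> pcomult s = 0"
      by (simp add: pcomult_hom pcomult_const pcomult_Xp_Xm)
  qed (use serre in blast)+
qed

text \<open>Killing the relations settles the algebraic ideal. Its closure follows because the
  coproduct up to order N depends only on the argument up to order N.\<close>

lift_definition comult :: "Uh \<Rightarrow> (gword \<times> gword) halg" is free_comult
proof -
  have 0: "pcomult z = 0" if "z \<in> two_sided_ideal qrels" for z
    using that by induction (simp_all add: pcomult_hom pcomult_qrels)
  fix x y :: "gword alg fps" assume xy: "x - y \<in> qideal"
  have "free_comult (x - y) \<in> qideal"
  proof (rule qideal_closed)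
    fix N
    obtain z where z: "z \<in> two_sided_ideal qrels" "\<forall>n\<le>N. fps_nth z n = fps_nth (x - y) n"
      using xy unfolding qideal_def fps_in_closure_iff by blast
    have "\<forall>n\<le>N. fps_nth (free_comult z) n = fps_nth (free_comult (x - y)) n"
      using z(2) by (intro allI impI free_comult_cong) auto
    then show "\<exists>w\<in>qideal. \<forall>n\<le>N. fps_nth w n = fps_nth (free_comult (x - y)) n"
      using 0[OF z(1)] by (auto simp: pcomult_def abs_halg_eq_0_iff)
  qed
  then show "free_comult x - free_comult y \<in> qideal"
    by (simp add: free_comult_diff)
qed

lemma comult_abs: "comult (abs_halg x) = pcomult x"
  by (simp add: comult.abs_eq pcomult_def)

lemma comult_hom:
  shows "comult (x + y) = comult x + comult y" "comult (x - y) = comult x - comult y"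
    "comult (x * y) = comult x * comult y" "comult (hs f) = hs f" "comult (hg g) = cop g"
    "comult (Kpow c i) = Kpow c i \<otimes>\<^sub>h Kpow c i"
  by (use abs_halg_surj[of x] abs_halg_surj[of y] in
    \<open>auto simp: hs_def hg_def Kpow_def cop_def comult_abs pcomult_hom pcomult_hexp plus_halg.abs_eq
      minus_halg.abs_eq times_halg.abs_eq\<close>)+

text \<open>All representatives of a class now have one coproduct, so ranging over them reduces to
  an ordinary image.\<close>

lemma comult_image_eq: "comult_image B = comult ` B"
  unfolding comult_image_def
  by (auto simp: image_iff) (metis comult.abs_eq, metis abs_halg_surj comult.abs_eq)

section \<open>Tensor subsets and coideals\<close>

lemma hs_htensor_1: "hs f \<otimes>\<^sub>h 1 = hs f"
  using htensor_hs(1)[of f 1 1] by (simp add: htensor_0)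

lemma tensor_set_add: "x \<in> tensor_set A B \<Longrightarrow> y \<in> tensor_set A B \<Longrightarrow> x + y \<in> tensor_set A B"
  by (induction rule: tensor_set.induct) (auto simp: add.assoc intro: tensor_set.step)

lemma tensor_set_pure: "a \<in> A \<Longrightarrow> b \<in> B \<Longrightarrow> a \<otimes>\<^sub>h b \<in> tensor_set A B"
  using tensor_set.step[OF _ _ tensor_set.zero] by fastforce

lemma tensor_set_mult:
  assumes "\<And>x y. x \<in> A \<Longrightarrow> y \<in> A \<Longrightarrow> x * y \<in> A" "\<And>x y. x \<in> B \<Longrightarrow> y \<in> B \<Longrightarrow> x * y \<in> B"
    and "x \<in> tensor_set A B" "y \<in> tensor_set A B"
  shows "x * y \<in> tensor_set A B"
  using assms(3)
proof induction
  case (step a b z)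
  have "(a \<otimes>\<^sub>h b) * y \<in> tensor_set A B"
    using assms(4)
  proof induction
    case (step a' b' z')
    then show ?case
      using assms(1,2) \<open>a \<in> A\<close> \<open>b \<in> B\<close>
      by (auto simp: distrib_left htensor_mult intro: tensor_set.step)
  qed (simp add: tensor_set.zero)
  then show ?case
    using step by (simp add: distrib_right tensor_set_add)
qed (simp add: tensor_set.zero)

lemma htensor_uminus: "- (a \<otimes>\<^sub>h b) = a \<otimes>\<^sub>h (- b)"
  using htensor_add(4)[of a 0 b] by (simp add: htensor_0)

lemma tensor_set_diff:
  assumes "\<And>x. x \<in> B \<Longrightarrow> - x \<in> B" "x \<in> tensor_set A B" "y \<in> tensor_set A B"
  shows "x - y \<in> tensor_set A B"
proof -
  have "- y \<in> tensor_set A B"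
    using assms(3)
  proof induction
    case (step a b z)
    have "- (a \<otimes>\<^sub>h b + z) = a \<otimes>\<^sub>h (- b) + - z"
      by (simp flip: htensor_uminus)
    then show ?case using step assms(1) by (simp only: tensor_set.step)
  qed (simp add: tensor_set.zero)
  then show ?thesis using tensor_set_add[OF assms(2)] by fastforce
qed

lemma generated_subalgebra_minimal:
  "subalgebra R B \<Longrightarrow> S \<subseteq> B \<Longrightarrow> generated_subalgebra R S \<subseteq> B"
  by (auto simp: generated_subalgebra_def)

lemma generated_subalgebra_subalgebra: "subalgebra R (generated_subalgebra R S)"
  and generated_subalgebra_superset: "S \<subseteq> generated_subalgebra R S"
  by (auto simp: generated_subalgebra_def subalgebra_def)

text \<open>The elements whose coproduct lies in B \<otimes> U form a subalgebra, so only generators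
  need checking.\<close>

lemma left_coideal_generated:
  assumes "\<And>s. s \<in> S \<Longrightarrow> comult s \<in> tensor_set (generated_subalgebra (range hscalar) S) UNIV"
  shows "left_coideal (generated_subalgebra (range hscalar) S)"
proof -
  let ?B = "generated_subalgebra (range hscalar) S"
  let ?T = "tensor_set ?B UNIV"
  have B: "range hscalar \<subseteq> ?B" "\<And>x y. x \<in> ?B \<Longrightarrow> y \<in> ?B \<Longrightarrow> x * y \<in> ?B"
    using generated_subalgebra_subalgebra[of "range hscalar" S] by (auto simp: subalgebra_def)
  have "hs f \<in> ?T" for f
  proof -
    have "hs f \<otimes>\<^sub>h 1 \<in> ?T" using B by (intro tensor_set_pure) (auto simp: hscalar_eq_hs)
    then show ?thesis by (simp only: hs_htensor_1)
  qed
  then have "subalgebra (range hscalar) {x. comult x \<in> ?T}"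
    using B by (auto simp: subalgebra_def comult_hom hscalar_eq_hs
        intro: tensor_set_add tensor_set_mult)
  then have "?B \<subseteq> {x. comult x \<in> ?T}"
    using assms by (intro generated_subalgebra_minimal) auto
  then show ?thesis
    by (auto simp: left_coideal_def comult_image_eq)
qed

text \<open>A group-like K gives K \<otimes> K - 1 = (K - 1) \<otimes> K + 1 \<otimes> (K - 1). The
  division by h happens on representatives.\<close>

lemma comult_divided_toral:
  "comult divided_toral = divided_toral \<otimes>\<^sub>h (Kh Short * Kh Long ^ 2) + 1 \<otimes>\<^sub>h divided_toral"
proof -
  define k where "k = freeK Short * freeK Long ^ 2"
  let ?s = "fps_shift 1 (k - 1)"
  have D: "fps_X * ?s = k - 1"
    by (rule fps_X_shift) (simp add: k_def freeK_def hexp_nth_0 power2_eq_square)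
  have K: "free_comult k = qleg1 k * qleg2 k"
  proof -
    have *: "free_comult (x * y) = qleg1 (x * y) * qleg2 (x * y)"
      if "free_comult x = qleg1 x * qleg2 x" "free_comult y = qleg1 y * qleg2 y" for x y
    proof -
      have "qleg2 x * (qleg1 y * z) = qleg1 y * (qleg2 x * z)" for z :: "(gword \<times> gword) alg fps"
        by (simp add: qleg_commute flip: mult.assoc)
      then show ?thesis
        by (simp add: free_comult_mult that qleg1_hom(4) qleg2_hom(4) mult.assoc)
    qed
    show ?thesis
      unfolding k_def power2_eq_square freeK_def by (intro * free_comult_hexp_Hg)
  qed
  have "fps_X * free_comult ?s = qleg1 k * qleg2 k - 1"
    by (simp only: D free_comult_diff K free_comult_1 flip: free_comult_X)
  also have "\<dots> = qleg1 (k - 1) * qleg2 k + qleg2 (k - 1)"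
    by (simp add: qleg1_hom qleg2_hom qleg_1 algebra_simps)
  also have "\<dots> = qleg1 (fps_X * ?s) * qleg2 k + qleg2 (fps_X * ?s)"
    by (simp only: D)
  also have "\<dots> = fps_X * (qleg1 ?s * qleg2 k + qleg2 ?s)"
    by (simp add: qleg_X fps_X_left_commute mult.assoc distrib_left)
  finally have "free_comult ?s = qleg1 ?s * qleg2 k + qleg2 ?s"
    by (rule fps_X_left_cancel)
  then show ?thesis
    unfolding divided_toral_def k_def[symmetric] comult_abs pcomult_def
    by (simp add: abs_halg_hom hleg_abs[symmetric] htensor_def hleg1_hom k_def Kh_def power2_eq_square)
qed

lemma qcomm_eq: "qcomm k a b = qbr (hs (qpow k)) a b"
  by (simp add: qcomm_def qbr_def hscalar_eq_hs)

lemma nested_generators: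
  "qcomm 3 (Eh Long) (Eh Short) = nest1 qq (hg (Xp Short)) (hg (Xp Long))"
  "qcomm 1 (nest1 qq (hg (Xp Short)) y) (Eh Short) = nest2 qq (hg (Xp Short)) y"
  "qcomm (-1) (nest2 qq (hg (Xp Short)) y) (Eh Short) = nest3 qq pp (hg (Xp Short)) y"
  by (simp_all add: qcomm_eq nest1_def nest2_def nest3_def hs_qpow_words Eh_eq)

text \<open>In \<open>nest_comult\<close> the element b = 1 \<otimes> E_1 puts E_1 into the second
  leg only. The first leg retains 1, E_2 and the nested commutators, all of which lie in B.\<close>

lemma comult_nested:
  assumes B: "subalgebra (range hscalar) B"
    and gens: "hg (Xp Long) \<in> B" "nest1 qq (hg (Xp Short)) (hg (Xp Long)) \<in> B"
      "nest2 qq (hg (Xp Short)) (hg (Xp Long)) \<in> B"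
      "nest3 qq pp (hg (Xp Short)) (hg (Xp Long)) \<in> B"
  shows "comult (nest1 qq (hg (Xp Short)) (hg (Xp Long))) \<in> tensor_set B UNIV"
    and "comult (nest2 qq (hg (Xp Short)) (hg (Xp Long))) \<in> tensor_set B UNIV"
    and "comult (nest3 qq pp (hg (Xp Short)) (hg (Xp Long))) \<in> tensor_set B UNIV"
proof -
  let ?T = "tensor_set B UNIV"
  let ?e = "\<lambda>i. hg (Xp i)"
  let ?a = "\<lambda>i. ?e i \<otimes>\<^sub>h Kpow (symm i) i" and ?b = "\<lambda>i. 1 \<otimes>\<^sub>h ?e i :: (gword \<times> gword) halg"
  have scal: "hs f \<in> B" and mult: "x * y \<in> B" if "x \<in> B" "y \<in> B" for x y f
    using B that by (auto simp: subalgebra_def hscalar_eq_hs)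
  have "hscalar 1 = 1" by (simp add: hscalar_eq_hs hs_hom)
  then have one: "1 \<in> B" using B unfolding subalgebra_def by (metis rangeI subsetD)
  have T: "x * y \<in> ?T" "x + y \<in> ?T" "x - y \<in> ?T" if "x \<in> ?T" "y \<in> ?T" for x y
    using that mult by (auto intro: tensor_set_mult tensor_set_add tensor_set_diff)
  have qT: "qq \<in> ?T" "pp \<in> ?T"
    using tensor_set_pure[OF scal[OF one one], of 1 UNIV]
    by (auto simp: hs_htensor_1 qq_def pp_def)
  have pure: "x \<otimes>\<^sub>h y \<in> ?T" if "x \<in> B" for x y
    using that by (intro tensor_set_pure) auto
  have ex: "?a i * ?b j = hs (qpow (symm i * cartan i j)) * (?b j * ?a i)" for i j
    by (rule cop_exchange)
  have ex': "?a Short * ?b Short = qq * (qq * (?b Short * ?a Short))"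
    "?a Long * ?b Short = pp * (pp * (pp * (?b Short * ?a Long)))"
    "?a Short * ?b Long = pp * (pp * (pp * (?b Long * ?a Short)))"
    unfolding ex by (simp_all add: hs_qpow_words mult.assoc)
  have C: "comult (nest1 qq (?e Short) (?e Long)) = nest1 qq (cop (Xp Short)) (cop (Xp Long))"
    "comult (nest2 qq (?e Short) (?e Long)) = nest2 qq (cop (Xp Short)) (cop (Xp Long))"
    "comult (nest3 qq pp (?e Short) (?e Long)) = nest3 qq pp (cop (Xp Short)) (cop (Xp Long))"
    unfolding nest3_def nest2_def nest1_def qbr_def qq_def pp_def by (simp_all only: comult_hom)
  show "comult (nest1 qq (?e Short) (?e Long)) \<in> ?T" "comult (nest2 qq (?e Short) (?e Long)) \<in> ?T"
    "comult (nest3 qq pp (?e Short) (?e Long)) \<in> ?T"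
    unfolding C cop_eq Q.nest_comult[OF ex'] nest_htensor[OF Kpow_Kpow] nest_qleg
    by (intro T qT pure gens one)+
qed

section \<open>A family of representations\<close>

text \<open>The dual of the generalized Verma module \<open>U(\<gg>) \<otimes>\<^bsub>U(\<pp>)\<^esub> \<complex>\<^bsub>l\<^esub>\<close>, where \<open>\<pp>\<close> is
  spanned by the \<open>h\<^sub>i\<close>, \<open>e\<^sub>1\<close> and the negative root vectors: a functional \<open>F\<close> is given by its values
  \<open>F b c d e f\<close> on the products of the divided powers of \<open>x\<^sub>2\<close>, \<open>x\<^sub>3\<close>, \<open>x\<^sub>4/2\<close>, \<open>x\<^sub>5/6\<close>, \<open>x\<^sub>6/6\<close>, so that
  Lie algebra elements act by first order operators.  The coefficients are polynomials in the
  exponents, hence the formulas define a right action on functions of arbitrary integers as well,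
  which avoids truncated subtraction.\<close>

type_synonym functional = "int \<Rightarrow> int \<Rightarrow> int \<Rightarrow> int \<Rightarrow> int \<Rightarrow> complex"

fun act :: "complex \<Rightarrow> gen \<Rightarrow> functional \<Rightarrow> functional" where
  "act l (Xp Short) F = (\<lambda>b c d e f. (of_int c + 1) * F (b - 1) (c + 1) d e f
      + 2 * (of_int d + 1) * F b (c - 1) (d + 1) e f
      + 3 * (of_int f + 1) * F b (c - 2) d e (f + 1)
      + 3 * (of_int e + 1) * F b c (d - 1) (e + 1) f)"
| "act l (Xp Long) F = (\<lambda>b c d e f. (of_int b + 1) * F (b + 1) c d e f)"
| "act l (Xm Short) F = (\<lambda>b c d e f. 3 * (of_int b + 1) * F (b + 1) (c - 1) d e f
      + 2 * (of_int c + 1) * F b (c + 1) (d - 1) e f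
      + 3 * (of_int f + 1) * F b c (d - 2) e (f + 1)
      + (of_int d + 1) * F b c (d + 1) (e - 1) f)"
| "act l (Xm Long) F = (\<lambda>b c d e f.
      - ((of_int b - 1 + of_int c - of_int e + of_int f + l) * F (b - 1) c d e f)
      - (of_int d + 1) * F b (c - 2) (d + 1) e f
      - (of_int f + 1) * F b (c - 3) d e (f + 1)
      - 3 * (of_int e + 1) * F b (c - 1) (d - 1) (e + 1) f
      + (of_int e + 1) * F b c d (e + 1) (f - 1))"
| "act l (Hg Short) F = (\<lambda>b c d e f.
      (- 3 * of_int b - of_int c + of_int d + 3 * of_int e) * F b c d e f)"
| "act l (Hg Long) F = (\<lambda>b c d e f.
      (2 * of_int b + of_int c - of_int e + of_int f + l) * F b c d e f)"

text \<open>\<open>fold\<close> lets the leftmost letter act first, which makes this a right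
  action.\<close>

fun word_act :: "complex \<Rightarrow> gword \<Rightarrow> functional \<Rightarrow> functional" where
  "word_act l (Word gs) F = fold (act l) gs F"

definition alg_act :: "complex \<Rightarrow> gword alg \<Rightarrow> functional \<Rightarrow> functional" where
  "alg_act l p F = (\<lambda>b c d e f. \<Sum>w\<in>Poly_Mapping.keys p.
      poly_mapping.lookup p w * word_act l w F b c d e f)"

lemma act_linear:
  "act l g (\<lambda>b c d e f. x * F b c d e f + G b c d e f)
    = (\<lambda>b c d e f. x * act l g F b c d e f + act l g G b c d e f)"
proof (cases g)
  case (Xp i) then show ?thesis by (cases i) (auto simp: fun_eq_iff algebra_simps add_divide_distrib)
next
  case (Xm i) then show ?thesis by (cases i) (auto simp: fun_eq_iff algebra_simps add_divide_distrib diff_divide_distrib)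
next
  case (Hg i) then show ?thesis by (cases i) (auto simp: fun_eq_iff algebra_simps)
qed

lemma word_act_linear:
  "word_act l w (\<lambda>b c d e f. x * F b c d e f + G b c d e f)
    = (\<lambda>b c d e f. x * word_act l w F b c d e f + word_act l w G b c d e f)"
proof (cases w)
  case (Word gs)
  have "fold (act l) gs (\<lambda>b c d e f. x * F b c d e f + G b c d e f)
    = (\<lambda>b c d e f. x * fold (act l) gs F b c d e f + fold (act l) gs G b c d e f)"
    by (induction gs arbitrary: F G) (simp_all add: act_linear)
  then show ?thesis by (simp add: Word)
qed

lemma word_act_add: "word_act l (u + v) F = word_act l v (word_act l u F)"
  by (cases u; cases v) simp

lemma alg_act_superset:
  assumes "finite A" "Poly_Mapping.keys p \<subseteq> A"
  shows "alg_act l p F = (\<lambda>b c d e f. \<Sum>w\<in>A. poly_mapping.lookup p w * word_act l w F b c d e f)"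
  unfolding alg_act_def using assms
  by (intro ext sum.mono_neutral_left) (auto simp: in_keys_iff)

lemma alg_act_0: "alg_act l 0 F = (\<lambda>b c d e f. 0)"
  by (simp add: alg_act_def)

lemma alg_act_add: "alg_act l (p + q) F = (\<lambda>b c d e f. alg_act l p F b c d e f + alg_act l q F b c d e f)"
proof -
  let ?A = "Poly_Mapping.keys p \<union> Poly_Mapping.keys q"
  have "Poly_Mapping.keys (p + q) \<subseteq> ?A"
    by (rule Poly_Mapping.keys_add)
  then show ?thesis
    by (simp add: alg_act_superset[of ?A] lookup_add distrib_right sum.distrib)
qed

lemma alg_act_diff: "alg_act l (p - q) F = (\<lambda>b c d e f. alg_act l p F b c d e f - alg_act l q F b c d e f)"
  using alg_act_add[of l "p - q" q F] by (auto simp: fun_eq_iff)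

lemma alg_act_single: "alg_act l (Poly_Mapping.single w x) F = (\<lambda>b c d e f. x * word_act l w F b c d e f)"
  by (subst alg_act_superset[of "{w}"]) (auto simp: lookup_single)

lemma alg_act_linear:
  "alg_act l p (\<lambda>b c d e f. x * F b c d e f + G b c d e f)
    = (\<lambda>b c d e f. x * alg_act l p F b c d e f + alg_act l p G b c d e f)"
  by (simp add: alg_act_def word_act_linear fun_eq_iff distrib_left sum.distrib sum_distrib_left
      mult.left_commute)

lemma alg_act_zero_fun: "alg_act l p (\<lambda>b c d e f. 0) = (\<lambda>b c d e f. 0)"
  using alg_act_linear[of l p "-1" "\<lambda>b c d e f. 0" "\<lambda>b c d e f. 0"] by (simp add: fun_eq_iff)

lemma alg_act_scale: "alg_act l p (\<lambda>b c d e f. x * F b c d e f) = (\<lambda>b c d e f. x * alg_act l p F b c d e f)"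
  using alg_act_linear[of l p x F "\<lambda>b c d e f. 0"] by (simp add: alg_act_zero_fun)

lemma alg_act_plus_fun: "alg_act l p (\<lambda>b c d e f. F b c d e f + G b c d e f)
    = (\<lambda>b c d e f. alg_act l p F b c d e f + alg_act l p G b c d e f)"
  using alg_act_linear[of l p 1 F G] by simp

lemma alg_act_mult: "alg_act l (p * q) F = alg_act l q (alg_act l p F)"
proof (induction p arbitrary: F rule: alg_induct)
  case (single u x)
  show ?case
    by (induction q rule: alg_induct)
      (simp_all add: alg_act_0 alg_act_add mult_single alg_act_single word_act_add distrib_left
        alg_act_scale alg_act_plus_fun mult.assoc mult.left_commute)
qed (simp_all add: alg_act_0 alg_act_add distrib_right alg_act_zero_fun alg_act_plus_fun)

lemma alg_act_letter: "alg_act l (letter g) F = act l g F"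
  by (simp add: letter_def alg_act_single)

lemma alg_act_cst_mult: "alg_act l (cst x * p) F = (\<lambda>b c d e f. x * alg_act l p F b c d e f)"
  by (simp add: alg_act_mult cst_def alg_act_single zero_gword_def alg_act_scale)

lemma alg_act_comm: "alg_act l (comm p q) F = (\<lambda>b c d e f.
    alg_act l q (alg_act l p F) b c d e f - alg_act l p (alg_act l q F) b c d e f)"
  by (simp add: comm_def alg_act_diff alg_act_mult)

lemma cserre_comm:
  "cserre x y 2 = comm (letter x) (comm (letter x) (letter y))"
  "cserre x y 4 = comm (letter x) (comm (letter x) (comm (letter x) (comm (letter x) (letter y))))"
proof -
  have num: "cst (numeral n) = (numeral n :: gword alg)" for n
    by (simp add: cst_def single_numeral)
  have 4: "{..4::nat} = {0, 1, 2, 3, 4}" and 2: "{..2::nat} = {0, 1, 2}" by auto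
  have c: "(4::nat) choose 2 = 6" "(4::nat) choose 3 = 4" "(4::nat) choose (Suc 0) = 4" "(2::nat) choose (Suc 0) = 2"
    by (simp_all add: numeral_eq_Suc)
  show "cserre x y 2 = comm (letter x) (comm (letter x) (letter y))"
    unfolding cserre_def comm_def 2
    by (simp add: c cst_1 cst_uminus num power2_eq_square algebra_simps mult_2)
  have "cserre x y 4 = letter x ^ 4 * letter y - 4 * (letter x ^ 3 * letter y * letter x)
      + 6 * (letter x ^ 2 * letter y * letter x ^ 2) - 4 * (letter x * letter y * letter x ^ 3)
      + letter y * letter x ^ 4"
    unfolding cserre_def 4 by (simp add: c cst_1 cst_uminus num mult.assoc)
  also have "\<dots> = comm (letter x) (comm (letter x) (comm (letter x) (comm (letter x) (letter y))))"
  proof -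
    have "(4 :: gword alg) = 1 + 1 + 1 + 1" "(6 :: gword alg) = 1 + 1 + 1 + 1 + 1 + 1" by simp_all
    then have "4 * z = z + z + z + z" "6 * z = z + z + z + z + z + z" for z :: "gword alg"
      by (simp_all only: distrib_right mult_1)
    then show ?thesis unfolding comm_def by (simp add: numeral_eq_Suc algebra_simps)
  qed
  finally show "cserre x y 4 = comm (letter x) (comm (letter x) (comm (letter x) (comm (letter x) (letter y))))" .
qed

section \<open>The root vectors as operators on functionals\<close>

abbreviation (input) "le i \<equiv> letter (Xp i)"

lemma act_x3: "alg_act l (comm (le Short) (le Long)) F = (\<lambda>b c d e f. (of_int c + 1) * F b (c + 1) d e f)"
  unfolding alg_act_comm by (simp add: fun_eq_iff alg_act_letter algebra_simps)

text \<open>The functional F x sends a monomial m to F (x m). Moving x_4 past the powers of x_3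
  leaves [x_4, x_3] = x_6, which is the second term; for x_5 the second term comes from [x_5, x_2] =
  -x_6 in the same way.\<close>

lemma act_x4: "alg_act l (comm (le Short) (comm (le Short) (le Long))) F
    = (\<lambda>b c d e f. 2 * (of_int d + 1) * F b c (d + 1) e f + 6 * (of_int f + 1) * F b (c - 1) d e (f + 1))"
  unfolding alg_act_comm[of _ "le Short" "comm (le Short) y" for y] act_x3
  by (simp add: fun_eq_iff alg_act_letter field_simps)

lemma act_x5: "alg_act l (comm (le Short) (comm (le Short) (comm (le Short) (le Long)))) F
    = (\<lambda>b c d e f. 6 * (of_int e + 1) * F b c d (e + 1) f - 6 * (of_int f + 1) * F (b - 1) c d e (f + 1))"
  unfolding alg_act_comm[of _ "le Short" "comm (le Short) (comm (le Short) y)" for y] act_x4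
  by (simp add: fun_eq_iff alg_act_letter field_simps)

lemma act_x6: "alg_act l (comm (le Long) (comm (le Short) (comm (le Short) (comm (le Short) (le Long))))) F
    = (\<lambda>b c d e f. 6 * (of_int f + 1) * F b c d e (f + 1))"
  unfolding alg_act_comm[of _ "le Long"] act_x5
  by (simp add: fun_eq_iff alg_act_letter algebra_simps)

lemma act_serre_positive:
  shows "alg_act l (comm (le Short) (comm (le Short) (comm (le Short) (comm (le Short) (le Long))))) F
      = (\<lambda>b c d e f. 0)"
    and "alg_act l (comm (le Long) (comm (le Long) (le Short))) F = (\<lambda>b c d e f. 0)"
proof -
  show "alg_act l (comm (le Short) (comm (le Short) (comm (le Short) (comm (le Short) (le Long))))) F
      = (\<lambda>b c d e f. 0)"
    unfolding alg_act_comm[of _ "le Short" "comm (le Short) (comm (le Short) (comm (le Short) y))" for y] act_x5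
    by (simp add: fun_eq_iff alg_act_letter field_simps)
  have "alg_act l (comm (le Long) (le Short)) F = (\<lambda>b c d e f. - ((of_int c + 1) * F b (c + 1) d e f))" for F
    unfolding alg_act_comm by (simp add: fun_eq_iff alg_act_letter algebra_simps)
  then show "alg_act l (comm (le Long) (comm (le Long) (le Short))) F = (\<lambda>b c d e f. 0)"
    unfolding alg_act_comm[of _ "le Long" "comm y z" for y z] by (simp add: fun_eq_iff alg_act_letter)
qed

text \<open>The intermediate commutators are recorded in closed form, so that each step remains a
  polynomial identity in the exponents and l that \<open>algebra\<close> can decide.\<close>

lemma act_serre_negative:
  fixes l :: complex
  defines "f1 \<equiv> letter (Xm Short)" and "f2 \<equiv> letter (Xm Long)"
  shows "alg_act l (comm f1 (comm f1 (comm f1 (comm f1 f2)))) F = (\<lambda>b c d e f. 0)"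
    and "alg_act l (comm f2 (comm f2 f1)) F = (\<lambda>b c d e f. 0)"
proof -
  note A = alg_act_letter
  have 3: "alg_act l (comm f1 f2) F = (\<lambda>b c d e f.
      (3 * of_int b + of_int c + of_int d + 3 * of_int f + 3 * l - 1) * F b (c - 1) d e f
      + 2 * (of_int c + 1) * F (b - 1) (c + 1) (d - 1) e f
      + 3 * (of_int f + 1) * F (b - 1) c (d - 2) e (f + 1)
      + (of_int d + 1) * F (b - 1) c (d + 1) (e - 1) f
      + 3 * (of_int e + 1) * F b c (d - 2) (e + 1) f
      + (of_int d + 1) * F b c (d + 1) e (f - 1))" for F
    unfolding alg_act_comm f1_def f2_def by (intro ext) (simp add: A, algebra)
  have 4: "alg_act l (comm f1 (comm f1 f2)) F = (\<lambda>b c d e f.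
      - 6 * (of_int b + 1) * F (b + 1) (c - 2) d e f
      + (2 - 8 * of_int c - 2 * of_int d - 6 * of_int e - 6 * l) * F b c (d - 1) e f
      - 12 * (of_int f + 1) * F b (c - 1) (d - 2) e (f + 1)
      - 4 * (of_int d + 1) * F b (c - 1) (d + 1) (e - 1) f
      + 2 * (of_int c + 1) * F b (c + 1) d e (f - 1))" for F
    unfolding alg_act_comm[of _ f1 "comm f1 f2"] 3 unfolding f1_def
    by (intro ext) (simp add: A, algebra)
  have 5: "alg_act l (comm f1 (comm f1 (comm f1 f2))) F = (\<lambda>b c d e f.
      6 * (of_int c + 1) * F b (c + 1) (d - 2) e f
      + 12 * (of_int f + 1) * F b c (d - 3) e (f + 1)
      + 6 * (of_int d + of_int e + l - 1) * F b c d (e - 1) f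
      + 6 * (of_int b + 1) * F (b + 1) c d e (f - 1))" for F
    unfolding alg_act_comm[of _ f1 "comm f1 (comm f1 f2)"] 4 unfolding f1_def
    by (intro ext) (simp add: A, algebra)
  show "alg_act l (comm f1 (comm f1 (comm f1 (comm f1 f2)))) F = (\<lambda>b c d e f. 0)"
    unfolding alg_act_comm[of _ f1 "comm f1 (comm f1 (comm f1 f2))"] 5 unfolding f1_def
    by (intro ext) (simp add: A, algebra)
  have swap: "comm f2 f1 = 0 - comm f1 f2"
    by (simp add: comm_def)
  show "alg_act l (comm f2 (comm f2 f1)) F = (\<lambda>b c d e f. 0)"
    unfolding alg_act_comm[of _ f2 "comm f2 f1"] unfolding swap alg_act_diff alg_act_0 3
    unfolding f2_def
    by (intro ext) (simp add: A, algebra)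
qed

lemma act_crels: "s \<in> crels \<Longrightarrow> alg_act l s F = (\<lambda>b c d e f. 0)"
proof -
  note A = alg_act_letter alg_act_comm alg_act_diff alg_act_add alg_act_cst_mult
  have serre: "alg_act l (cserre (x i) (x j) (nat (1 - cartan i j))) F = (\<lambda>b c d e f. 0)"
    if "i \<noteq> j" "x = Xp \<or> x = Xm" for i j x
    using that act_serre_negative act_serre_positive
    by (cases i; cases j) (auto simp: cserre_comm)
  have Hp: "alg_act l (comm (letter (Hg i)) (letter (Xp j)) - cst (of_int (cartan i j)) * letter (Xp j)) F
      = (\<lambda>b c d e f. 0)" for i j
    \<comment> \<open>Without the cancellation rules the goal stays one polynomial identity instead
      of splitting into cases.\<close>
    by (cases i; cases j; intro ext; simp add: A del: mult_cancel_left mult_cancel_right mult_eq_0_iff; (algebra | simp add: algebra_simps))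
  have Hm: "alg_act l (comm (letter (Hg i)) (letter (Xm j)) + cst (of_int (cartan i j)) * letter (Xm j)) F
      = (\<lambda>b c d e f. 0)" for i j
    by (cases i; cases j; intro ext; simp add: A del: mult_cancel_left mult_cancel_right mult_eq_0_iff; (algebra | simp add: algebra_simps))
  have pm: "alg_act l (comm (letter (Xp i)) (letter (Xm j)) - (if i = j then letter (Hg i) else 0)) F
      = (\<lambda>b c d e f. 0)" for i j
    by (cases i; cases j; intro ext; simp add: A alg_act_0 del: mult_cancel_left mult_cancel_right mult_eq_0_iff; (algebra | simp add: algebra_simps))
  have HH: "alg_act l (comm (letter (Hg i)) (letter (Hg j))) F = (\<lambda>b c d e f. 0)" for i j
    by (cases i; cases j; intro ext; simp add: A del: mult_cancel_left mult_cancel_right mult_eq_0_iff; (algebra | simp add: algebra_simps))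
  show "s \<in> crels \<Longrightarrow> alg_act l s F = (\<lambda>b c d e f. 0)"
    unfolding crels_gword_def using HH Hp Hm pm serre by (elim UnE CollectE exE conjE) auto
qed

lift_definition uact :: "complex \<Rightarrow> Ug \<Rightarrow> functional \<Rightarrow> functional" is alg_act
proof -
  fix l and x y :: "gword alg" assume xy: "x - y \<in> cideal"
  have "alg_act l z F = (\<lambda>b c d e f. 0)" if "z \<in> two_sided_ideal crels" for z F
    using that
  proof (induction arbitrary: F)
    case (step s x a b)
    then show ?case
      by (simp only: alg_act_add alg_act_mult act_crels alg_act_zero_fun) simp
  qed (rule alg_act_0)
  then have "alg_act l (x - y) F = (\<lambda>b c d e f. 0)" for F
    using xy by (simp add: cideal_def)
  then have "alg_act l x F b c d e f = alg_act l y F b c d e f" for F b c d e f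
    by (metis alg_act_diff right_minus_eq)
  then show "alg_act l x = alg_act l y"
    by (intro ext)
qed

lemma abs_ualg_surj: "\<exists>y. x = abs_ualg y"
  by (induct x) blast

lemma uact_hom:
  shows "uact l (x + y) F = (\<lambda>b c d e f. uact l x F b c d e f + uact l y F b c d e f)"
    and "uact l (x - y) F = (\<lambda>b c d e f. uact l x F b c d e f - uact l y F b c d e f)"
    and "uact l (x * y) F = uact l y (uact l x F)"
    and "uact l 0 F = (\<lambda>b c d e f. 0)" and "uact l 1 F = F"
    and "uact l (uscale k x) F = (\<lambda>b c d e f. k * uact l x F b c d e f)"
    and "uact l (ugen g) F = act l g F"
proof -
  obtain x' y' where x: "x = abs_ualg x'" and y: "y = abs_ualg y'"
    using abs_ualg_surj by metis
  show "uact l (x + y) F = (\<lambda>b c d e f. uact l x F b c d e f + uact l y F b c d e f)"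
    unfolding x y plus_ualg.abs_eq uact.abs_eq by (rule alg_act_add)
  show "uact l (x - y) F = (\<lambda>b c d e f. uact l x F b c d e f - uact l y F b c d e f)"
    unfolding x y minus_ualg.abs_eq uact.abs_eq by (rule alg_act_diff)
  show "uact l (x * y) F = uact l y (uact l x F)"
    unfolding x y times_ualg.abs_eq uact.abs_eq by (rule alg_act_mult)
  show "uact l (uscale k x) F = (\<lambda>b c d e f. k * uact l x F b c d e f)"
    unfolding x uscale.abs_eq uact.abs_eq by (rule alg_act_cst_mult)
  show "uact l (ugen g) F = act l g F"
    unfolding ugen_def uact.abs_eq by (rule alg_act_letter)
  show "uact l 0 F = (\<lambda>b c d e f. 0)"
    unfolding zero_ualg_def uact.abs_eq by (rule alg_act_0)
  show "uact l 1 F = F"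
    using alg_act_cst_mult[of l 1 1 F] alg_act_single[of l 0 1 F]
    unfolding one_ualg_def uact.abs_eq by (simp add: zero_gword_def flip: single_one)
qed

text \<open>On the constant functional, at exponents (1, 0, 0, 0, 0) and l = 1, the values are -3
  and 3. Root vectors are later shown to be nonzero by bringing them down to some H_i.\<close>

lemma ugen_Hg_nonzero: "ugen (Hg i) \<noteq> 0"
proof
  assume "ugen (Hg i) = 0"
  then have "act 1 (Hg i) (\<lambda>b c d e f. 1) 1 0 0 0 0 = 0"
    by (metis uact_hom(4,7))
  then show False by (cases i) simp_all
qed

section \<open>Independence of the ordered monomials\<close>

text \<open>The toral element comes first: in a sorted word it acts before the root vectors and
  meets the full weight of the monomial.\<close>

definition ubasis :: "nat \<Rightarrow> Ug" where
  "ubasis i = [chev_h Short + uscale 2 (chev_h Long), chev_e Long, comm (chev_e Short) (chev_e Long),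
    comm (chev_e Short) (comm (chev_e Short) (chev_e Long)),
    comm (chev_e Short) (comm (chev_e Short) (comm (chev_e Short) (chev_e Long))),
    comm (chev_e Long) (comm (chev_e Short) (comm (chev_e Short) (comm (chev_e Short) (chev_e Long))))] ! i"

lemma comm_ugen: "comm (abs_ualg p) (abs_ualg q) = abs_ualg (comm p q)"
  by (simp add: comm_def times_ualg.abs_eq minus_ualg.abs_eq)

text \<open>The numbers 9, 5, 1, -3, 6 are the eigenvalues of H_1 + 6 H_2 on x_2, ..., x_6, and 6 l
  is its value on the inducing character.\<close>

lemma uact_ubasis:
  shows "uact l (ubasis 0) F = (\<lambda>b c d e f. (9 * of_int b + 5 * of_int c + of_int d - 3 * of_int e
      + 6 * of_int f + 6 * l) * F b c d e f)"
    and "uact l (ubasis 1) F = (\<lambda>b c d e f. (of_int b + 1) * F (b + 1) c d e f)"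
    and "uact l (ubasis 2) F = (\<lambda>b c d e f. (of_int c + 1) * F b (c + 1) d e f)"
    and "uact l (ubasis 3) F = (\<lambda>b c d e f. 2 * (of_int d + 1) * F b c (d + 1) e f + 6 * (of_int f + 1) * F b (c - 1) d e (f + 1))"
    and "uact l (ubasis 4) F = (\<lambda>b c d e f. 6 * (of_int e + 1) * F b c d (e + 1) f - 6 * (of_int f + 1) * F (b - 1) c d e (f + 1))"
    and "uact l (ubasis 5) F = (\<lambda>b c d e f. 6 * (of_int f + 1) * F b c d e (f + 1))"
proof -
  show "uact l (ubasis 0) F = (\<lambda>b c d e f. (9 * of_int b + 5 * of_int c + of_int d - 3 * of_int e
      + 6 * of_int f + 6 * l) * F b c d e f)"
    by (simp add: ubasis_def chev_h_def uact_hom fun_eq_iff algebra_simps)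
qed (simp_all add: ubasis_def chev_e_def uact_hom,
    simp_all add: ugen_def comm_ugen uact.abs_eq act_x3 act_x4 act_x5 act_x6 numeral_eq_Suc)

text \<open>Such functions correspond to functionals on the actual module, whose monomials have
  natural exponents.\<close>

definition nonneg_supported :: "functional \<Rightarrow> bool" where
  "nonneg_supported F \<longleftrightarrow> (\<forall>b c d e f. b < 0 \<or> c < 0 \<or> d < 0 \<or> e < 0 \<or> f < 0 \<longrightarrow> F b c d e f = 0)"

text \<open>A shift from exponent -1 to 0 would enlarge the support, but its coefficient, exponent +
  1, vanishes there.\<close>

lemma nonneg_supported_ubasis:
  assumes "nonneg_supported F" "i < 6"
  shows "nonneg_supported (uact l (ubasis i) F)"
proof -
  have F: "F b c d e f = 0" if "b < 0 \<or> c < 0 \<or> d < 0 \<or> e < 0 \<or> f < 0" for b c d e f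
    using that assms(1) unfolding nonneg_supported_def by blast
  have up: "(of_int b + 1) * F (b + 1) c d e f = 0" (is ?g1) "(of_int c + 1) * F b (c + 1) d e f = 0" (is ?g2)
    "(of_int d + 1) * F b c (d + 1) e f = 0" (is ?g3) "(of_int e + 1) * F b c d (e + 1) f = 0" (is ?g4)
    "(of_int f + 1) * F b c d e (f + 1) = 0" (is ?g5)
    if "b < 0 \<or> c < 0 \<or> d < 0 \<or> e < 0 \<or> f < 0" for b c d e f
  proof -
    have *: "(of_int x + 1) * G = (0 :: complex)" if "x \<noteq> -1 \<Longrightarrow> G = 0" for x :: int and G
      using that by (cases "x = -1") auto
    show ?g1 ?g2 ?g3 ?g4 ?g5
      by (intro * F, use that in linarith)+
  qed
  have "i \<in> {0, 1, 2, 3, 4, 5}" using assms(2) by auto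
  moreover have "uact l (ubasis i) F b c d e f = 0"
    if neg: "b < 0 \<or> c < 0 \<or> d < 0 \<or> e < 0 \<or> f < 0" and i: "i \<in> {0, 1, 2, 3, 4, 5}" for b c d e f
  proof -
    have "(of_int f + 1) * F b (c - 1) d e (f + 1) = 0" "(of_int f + 1) * F (b - 1) c d e (f + 1) = 0"
      by (rule up; use neg in linarith)+
    then show ?thesis
      using i by (elim insertE emptyE; hypsubst) (simp_all only: uact_ubasis mult.assoc up[OF neg] F[OF neg], simp_all)
  qed
  ultimately show ?thesis
    unfolding nonneg_supported_def by blast
qed

definition ordered_value :: "complex \<Rightarrow> nat list \<Rightarrow> functional \<Rightarrow> complex" where
  "ordered_value l ws F = (let n = \<lambda>i. int (count_list ws i) in
    (of_int (9 * n 1 + 5 * n 2 + n 3 - 3 * n 4 + 6 * n 5) + 6 * l) ^ count_list ws 0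
    * F (n 1) (n 2) (n 3) (n 4) (n 5))"

text \<open>In a sorted word every letter is followed only by letters that are at least as large.
  The correction terms of x_4 and x_5 are then evaluated at exponent -1 of x_3 or x_2, where F
  vanishes. The factor z is uniform in l and F, as the polynomial argument for independence
  requires.\<close>

lemma uact_ordered:
  assumes "sorted ws" "set ws \<subseteq> {..<6}"
  shows "\<exists>z. z \<noteq> 0 \<and> (\<forall>l F. nonneg_supported F \<longrightarrow>
    uact l (prod_list (map ubasis ws)) F 0 0 0 0 0 = z * ordered_value l ws F)"
  using assms
proof (induction ws)
  case (Cons i ws)
  have ge: "\<And>j. j \<in> set ws \<Longrightarrow> i \<le> j" and i: "i \<in> {0, 1, 2, 3, 4, 5}"
    using Cons.prems by auto
  have zero: "count_list ws j = 0" if "j < i" for j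
    using ge[of j] that by (auto simp: count_list_0_iff)
  define n where "n = count_list ws i"
  have n: "of_nat (Suc n) \<noteq> (0 :: complex)" by (simp del: of_nat_Suc)
  obtain z where z: "z \<noteq> 0" "\<And>l F. nonneg_supported F \<Longrightarrow>
      uact l (prod_list (map ubasis ws)) F 0 0 0 0 0 = z * ordered_value l ws F"
    using Cons by auto
  have eq: "uact l (prod_list (map ubasis (i # ws))) F 0 0 0 0 0
      = uact l (prod_list (map ubasis ws)) (uact l (ubasis i) F) 0 0 0 0 0" for l F
    by (simp add: uact_hom)
  have supp: "nonneg_supported (uact l (ubasis i) F)" if "nonneg_supported F" for l F
    using that Cons.prems by (intro nonneg_supported_ubasis) auto
  have neg: "F a b c d e = 0" if "nonneg_supported F" "a < 0 \<or> b < 0" for F a b c d e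
    using that unfolding nonneg_supported_def by blast
  \<comment> \<open>Apart from the toral case, the raised exponent times the denominators 1, 1, 2,
    6, 6 of x_2, x_3, x_4/2, x_5/6, x_6/6.\<close>
  define y :: complex where "y = [1, of_nat (Suc n), of_nat (Suc n), 2 * of_nat (Suc n),
      6 * of_nat (Suc n), 6 * of_nat (Suc n)] ! i"
  have "z * y \<noteq> 0"
    using i n z(1) by (auto simp: y_def simp del: of_nat_Suc)
  moreover have "uact l (prod_list (map ubasis (i # ws))) F 0 0 0 0 0 = z * y * ordered_value l (i # ws) F"
    if F: "nonneg_supported F" for l F
  proof (cases "i = 0")
    case True
    then show ?thesis
      unfolding eq z(2)[OF supp[OF F]] y_def by (simp add: ordered_value_def uact_ubasis mult_ac)
  next
    case False
    then show ?thesis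
      unfolding eq z(2)[OF supp[OF F]] y_def using i zero
      by (auto simp: ordered_value_def uact_ubasis uact_ubasis(2)[unfolded One_nat_def] neg[OF F] n_def
          algebra_simps)
  qed
  ultimately show ?case by blast
qed (auto simp: uact_hom ordered_value_def intro!: exI[of _ 1])

lemma ordered_word_unique:
  assumes "sorted (ws :: nat list)" "sorted ws'" "set ws \<subseteq> {..<6}" "set ws' \<subseteq> {..<6}"
    and "\<forall>i\<in>{0,1,2,3,4,5}. count_list ws i = count_list ws' i"
  shows "ws = ws'"
proof -
  have "count_list ws i = count_list ws' i" for i
  proof (cases "i < 6")
    case True
    then have "i \<in> {0,1,2,3,4,5}" by auto
    then show ?thesis using assms(5) by blast
  next
    case False
    then have "i \<notin> set ws" "i \<notin> set ws'" using assms(3,4) by auto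
    then show ?thesis by (simp add: count_list_0_iff)
  qed
  then have "mset ws = mset ws'"
    by (simp add: multiset_eq_iff count_mset)
  then show ?thesis
    using assms(1,2) properties_for_sort sorted_sort_id by metis
qed

text \<open>The delta function at the root vector exponents of \<open>ws\<close> singles out the
  monomials that differ from it only in the power of the toral element. Their coefficients, up to
  the nonzero z, are those of a polynomial in the toral eigenvalue, which takes every complex value
  as l varies.\<close>

lemma ordered_monomials_independent:
  assumes W: "finite W" "\<And>ws. ws \<in> W \<Longrightarrow> sorted ws \<and> set ws \<subseteq> {..<6}"
    and zero: "(\<Sum>ws\<in>W. uscale (k ws) (prod_list (map ubasis ws))) = 0" and ws: "ws \<in> W"
  shows "k ws = 0"
proof -
  define n where "n v i = int (count_list v i)" for v and i :: nat
  define F :: functional where "F b c d e f = (if b = n ws 1 \<and> c = n ws 2 \<and> d = n ws 3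
      \<and> e = n ws 4 \<and> f = n ws 5 then 1 else 0)" for b c d e f
  define W' where "W' = {v \<in> W. F (n v 1) (n v 2) (n v 3) (n v 4) (n v 5) = 1}"
  obtain z where z: "\<And>v. v \<in> W \<Longrightarrow> z v \<noteq> 0"
    "\<And>v l F. v \<in> W \<Longrightarrow> nonneg_supported F \<Longrightarrow>
      uact l (prod_list (map ubasis v)) F 0 0 0 0 0 = z v * ordered_value l v F"
    using uact_ordered W(2) by metis
  define p where "p = (\<Sum>v\<in>W'. monom (k v * z v) (count_list v 0))"
  have fin: "finite W'" using W(1) by (simp add: W'_def)
  have W': "v \<in> W' \<longleftrightarrow> v \<in> W \<and> n v 1 = n ws 1 \<and> n v 2 = n ws 2 \<and> n v 3 = n ws 3
      \<and> n v 4 = n ws 4 \<and> n v 5 = n ws 5" for v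
    by (auto simp: W'_def F_def)
  have sum: "uact l (\<Sum>v\<in>A. uscale (k v) (m v)) F b c d e f
      = (\<Sum>v\<in>A. k v * uact l (m v) F b c d e f)" for l and A :: "nat list set" and m b c d e f
    by (induction A rule: infinite_finite_induct) (simp_all add: uact_hom)
  have F: "nonneg_supported F"
    by (auto simp: nonneg_supported_def F_def n_def)
  have "poly p t = 0" for t
  proof -
    let ?w = "9 * n ws 1 + 5 * n ws 2 + n ws 3 - 3 * n ws 4 + 6 * n ws 5"
    \<comment> \<open>This l makes the toral eigenvalue at the exponents of \<open>ws\<close> equal
      to t.\<close>
    let ?l = "(t - of_int ?w) / 6"
    have "0 = (\<Sum>v\<in>W. k v * uact ?l (prod_list (map ubasis v)) F 0 0 0 0 0)"
      using zero by (metis sum uact_hom(4))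
    also have "\<dots> = (\<Sum>v\<in>W. if v \<in> W' then k v * z v * t ^ count_list v 0 else 0)"
    proof (rule sum.cong)
      fix v assume v: "v \<in> W"
      show "k v * uact ?l (prod_list (map ubasis v)) F 0 0 0 0 0
          = (if v \<in> W' then k v * z v * t ^ count_list v 0 else 0)"
      proof (cases "v \<in> W'")
        case True
        then have "n v 1 = n ws 1" "n v 2 = n ws 2" "n v 3 = n ws 3" "n v 4 = n ws 4" "n v 5 = n ws 5"
          unfolding W' by auto
        moreover have "F (n v 1) (n v 2) (n v 3) (n v 4) (n v 5) = 1"
          using True by (simp add: W'_def)
        moreover have "of_int ?w + 6 * ?l = t"
          by (simp add: field_simps)
        ultimately have "ordered_value ?l v F = t ^ count_list v 0"
          unfolding ordered_value_def Let_def n_def by (simp only: mult_1_right)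
        then show ?thesis
          using True by (simp add: z(2)[OF v F])
      next
        case False
        then have "F (n v 1) (n v 2) (n v 3) (n v 4) (n v 5) = 0"
          using v by (auto simp: W'_def F_def split: if_splits)
        then show ?thesis
          using False by (simp add: z(2)[OF v F] ordered_value_def flip: n_def)
      qed
    qed simp
    also have "\<dots> = (\<Sum>v\<in>W'. k v * z v * t ^ count_list v 0)"
      using W(1) by (simp add: sum.If_cases W'_def Int_def)
    also have "\<dots> = poly p t"
      by (simp add: p_def poly_sum poly_monom)
    finally show ?thesis ..
  qed
  then have "p = 0" using poly_all_0_iff_0 by blast
  then have "0 = coeff p (count_list ws 0)" by simp
  also have "\<dots> = (\<Sum>v\<in>W'. coeff (monom (k v * z v) (count_list v 0)) (count_list ws 0))"
    by (simp only: p_def coeff_sum)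
  also have "\<dots> = (\<Sum>v\<in>W'. if v = ws then k v * z v else 0)"
  proof (rule sum.cong)
    fix v assume v: "v \<in> W'"
    have "v = ws" if "count_list v 0 = count_list ws 0"
      using v that W(2) ws by (intro ordered_word_unique) (auto simp: W' n_def)
    then show "coeff (monom (k v * z v) (count_list v 0)) (count_list ws 0) = (if v = ws then k v * z v else 0)"
      by auto
  qed simp
  also have "\<dots> = k ws * z ws" using fin ws by (simp add: W')
  finally show ?thesis using z(1)[OF ws] by simp
qed

section \<open>Specialization\<close>

lemma specialize_hom:
  shows "specialize (x + y) = specialize x + specialize y"
    "specialize (x - y) = specialize x - specialize y"
    "specialize (x * y) = specialize x * specialize y"
    "specialize (hs f) = uscale (fps_nth f 0) 1" "specialize (hg g) = ugen g"
    "specialize 0 = 0" "specialize 1 = 1"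
  by (use abs_halg_surj[of x] abs_halg_surj[of y] in
    \<open>auto simp: hs_def hg_def ugen_def specialize.abs_eq plus_halg.abs_eq minus_halg.abs_eq
      times_halg.abs_eq plus_ualg.abs_eq minus_ualg.abs_eq times_ualg.abs_eq scal_def uscale.abs_eq
      one_ualg_def zero_ualg_def zero_halg_def one_halg_def\<close>)+

lemma uscale_mult: "uscale c x * y = uscale c (x * y)" "x * uscale c y = uscale c (x * y)"
proof -
  obtain x' y' where "x = abs_ualg x'" "y = abs_ualg y'" using abs_ualg_surj by metis
  then show "uscale c x * y = uscale c (x * y)" "x * uscale c y = uscale c (x * y)"
    by (simp_all add: uscale.abs_eq times_ualg.abs_eq mult.assoc cst_left_commute)
qed

lemma specialize_hs_mult: "specialize (hs f * x) = uscale (fps_nth f 0) (specialize x)"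
  by (simp add: specialize_hom uscale_mult)

lemma specialize_comm: "specialize (comm x y) = comm (specialize x) (specialize y)"
  by (simp add: comm_def specialize_hom)

section \<open>The toral generator\<close>

text \<open>The quotient (e^(c h H_i) - 1) / h, from which \<open>divided_toral\<close> is
  assembled.\<close>

definition Dexp :: "int \<Rightarrow> node \<Rightarrow> Uh" where
  "Dexp c i = abs_halg (fps_shift 1 (hexp c (letter (Hg i)) - 1))"

text \<open>The quotient (q^m - 1) / h, a deformation of the integer m.\<close>

definition qdiv :: "int \<Rightarrow> complex fps" where
  "qdiv m = fps_shift 1 (qpow m - 1)"

lemma X_qdiv: "fps_X * qdiv m = qpow m - 1"
  unfolding qdiv_def by (rule fps_X_shift) (simp add: qpow_nth_0)

lemma qdiv_nth_0: "fps_nth (qdiv m) 0 = of_int m"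
  by (simp add: qdiv_def qpow_def)

lemma qdiv_add: "qdiv (m + n) = qdiv m + qpow m * qdiv n"
proof (rule fps_X_left_cancel)
  have "fps_X * (qdiv m + qpow m * qdiv n) = fps_X * qdiv m + qpow m * (fps_X * qdiv n)"
    by (simp add: algebra_simps)
  then show "fps_X * qdiv (m + n) = fps_X * (qdiv m + qpow m * qdiv n)"
    by (simp only: X_qdiv) (simp add: qpow_mult algebra_simps)
qed

lemma Kpow_Dexp: "Kpow c i = 1 + hs fps_X * Dexp c i"
proof -
  have "fps_X * fps_shift 1 (hexp c (letter (Hg i)) - 1) = hexp c (letter (Hg i)) - 1"
    by (rule fps_X_shift) (simp add: hexp_nth_0)
  then have "hs fps_X * Dexp c i = Kpow c i - 1"
    unfolding hs_def scal_X Dexp_def Kpow_def by (simp only: abs_halg_hom[symmetric])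
  then show ?thesis by simp
qed

text \<open>\<open>q\<close>-commutation \<open>K y = q\<^sup>m y K\<close> of \<open>K = 1 + h D\<close>, divided by \<open>h\<close>.\<close>

definition tor :: "Uh \<Rightarrow> Uh \<Rightarrow> int \<Rightarrow> bool" where
  "tor D y m \<longleftrightarrow> D * y = hs (qpow m) * (y * D) + hs (qdiv m) * y"

text \<open>The intertwining rule for (e^(hx) - 1)/h moves E to the left and leaves (q^m K - 1)/h on
  its right, which splits as q^m D + (q^m - 1)/h.\<close>

lemma tor_Dexp: "tor (Dexp c i) (hg (Xp j)) (c * cartan i j)"
proof -
  let ?m = "c * cartan i j"
  have "fps_shift 1 (scal (qpow ?m) * hexp c (letter (Hg i)) - 1)
      = scal (qpow ?m) * fps_shift 1 (hexp c (letter (Hg i)) - 1) + scal (qdiv ?m)"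
    (is "fps_shift 1 (?q * ?e - 1) = _")
  proof (rule fps_X_left_cancel)
    have *: "fps_X * scal (qdiv ?m) = ?q - (1 :: gword alg fps)"
      by (metis X_qdiv scal_X scal_hom(2,4,5))
    have e: "fps_X * fps_shift 1 (?e - 1) = ?e - 1"
      by (rule fps_X_shift) (simp add: hexp_nth_0)
    have "fps_X * fps_shift 1 (?q * ?e - 1) = ?q * ?e - 1"
      by (rule fps_X_shift) (simp add: hexp_nth_0 scal_def qpow_nth_0 cst_1)
    also have "\<dots> = ?q * (fps_X * fps_shift 1 (?e - 1)) + fps_X * scal (qdiv ?m)"
      unfolding e * by (simp add: algebra_simps)
    finally show "fps_X * fps_shift 1 (?q * ?e - 1) = fps_X * (?q * fps_shift 1 (?e - 1) + scal (qdiv ?m))"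
      by (simp only: distrib_left fps_X_left_commute)
  qed
  then have "Dexp c i * hg (Xp j)
      = hg (Xp j) * (hs (qpow ?m) * Dexp c i + hs (qdiv ?m))"
    unfolding Dexp_def
    using hexp_intertwine(2)[OF H_Xp[of i j, unfolded hg_def[of "Hg i"]], of c]
    unfolding hexp_add_cst by (simp only: abs_halg_hom hs_def)
  then show ?thesis
    by (simp add: tor_def distrib_left hs_left_commute hs_central)
qed

lemma tor_mult:
  assumes "tor D y m" "tor D z n"
  shows "tor D (y * z) (m + n)"
proof -
  have "D * (y * z) = (hs (qpow m) * (y * D) + hs (qdiv m) * y) * z"
    using assms(1) by (simp add: tor_def flip: mult.assoc)
  also have "\<dots> = hs (qpow m) * (y * (D * z)) + hs (qdiv m) * (y * z)"
    by (simp add: distrib_right mult.assoc)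
  also have "\<dots> = hs (qpow m) * (hs (qpow n) * (y * (z * D)) + hs (qdiv n) * (y * z)) + hs (qdiv m) * (y * z)"
    using assms(2) by (simp add: tor_def distrib_left hs_left_commute[of y])
  also have "\<dots> = hs (qpow m) * hs (qpow n) * (y * (z * D)) + (hs (qdiv m) + hs (qpow m) * hs (qdiv n)) * (y * z)"
    by (simp add: distrib_left distrib_right mult.assoc)
  also have "\<dots> = hs (qpow (m + n)) * (y * z * D) + hs (qdiv (m + n)) * (y * z)"
    by (simp add: qdiv_add hs_hom mult.assoc flip: qpow_mult)
  finally show ?thesis by (simp add: tor_def)
qed

lemma tor_diff: "tor D y m \<Longrightarrow> tor D z m \<Longrightarrow> tor D (y - z) m"
  by (simp add: tor_def right_diff_distrib left_diff_distrib)

lemma hs_hs_commute: "hs f * (hs g * x) = hs g * (hs f * x)"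
  using hs_left_commute[of "hs f" g x] .

lemma tor_scale: "tor D y m \<Longrightarrow> tor D (hs f * y) m"
proof -
  assume *: "tor D y m"
  have "D * (hs f * y) = hs f * (hs (qpow m) * (y * D) + hs (qdiv m) * y)"
    using * by (simp only: hs_left_commute tor_def)
  also have "\<dots> = hs (qpow m) * (hs f * y * D) + hs (qdiv m) * (hs f * y)"
    by (simp only: distrib_left mult.assoc hs_hs_commute[of f "qpow m"] hs_hs_commute[of f "qdiv m"])
  finally show ?thesis by (simp add: tor_def)
qed

lemma tor_qbr: "tor D x m \<Longrightarrow> tor D y n \<Longrightarrow> tor D (qbr (hs f) x y) (m + n)"
  unfolding qbr_def using tor_mult[of D x m y n] tor_mult[of D y n x m] tor_scale tor_diff
  by (simp add: add.commute mult.assoc)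

text \<open>If D = (K - 1)/h and D' = (K' - 1)/h, then D + K D' = (K K' - 1)/h, so this is the rule
  for a product of toral elements.\<close>

lemma tor_toral_mult:
  assumes D: "tor D y m" and D': "tor D' y n" and K: "K = 1 + hs fps_X * D"
  shows "tor (D + K * D') y (m + n)"
proof -
  have Ky: "K * y = hs (qpow m) * (y * K)"
  proof -
    have "K * y = y + hs fps_X * (hs (qpow m) * (y * D) + hs (qdiv m) * y)"
      using D by (simp add: K tor_def distrib_right mult.assoc)
    also have "\<dots> = hs (1 + fps_X * qdiv m) * y + hs (qpow m) * (hs fps_X * (y * D))"
      by (simp add: distrib_left distrib_right hs_hom mult.assoc hs_hs_commute[of fps_X "qpow m"])
    also have "\<dots> = hs (qpow m) * (y * K)"
      by (simp add: X_qdiv K distrib_left hs_left_commute[of y])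
    finally show ?thesis .
  qed
  have "(D + K * D') * y = D * y + K * (D' * y)"
    by (simp add: distrib_right mult.assoc)
  also have "K * (D' * y) = hs (qpow n) * (K * y * D') + hs (qdiv n) * (K * y)"
    using D' by (simp add: tor_def distrib_left hs_left_commute[of K] mult.assoc)
  also have "K * y * D' = hs (qpow m) * (y * (K * D'))"
    by (simp add: Ky mult.assoc)
  also have "hs (qdiv n) * (K * y) = hs (qpow m * qdiv n) * y + hs (qpow m * (fps_X * qdiv n)) * (y * D)"
    unfolding Ky by (simp add: K distrib_left hs_hom mult.assoc hs_left_commute[of y]
        hs_hs_commute[of "qdiv n" "qpow m"] hs_hs_commute[of "qdiv n" "fps_X"])
  also have "D * y = hs (qpow m) * (y * D) + hs (qdiv m) * y"
    using D by (simp add: tor_def)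
  also have "hs (qpow m) * (y * D) + hs (qdiv m) * y + (hs (qpow n) * (hs (qpow m) * (y * (K * D')))
      + (hs (qpow m * qdiv n) * y + hs (qpow m * (fps_X * qdiv n)) * (y * D)))
      = (hs (qpow m) + hs (qpow m * (fps_X * qdiv n))) * (y * D)
      + hs (qpow m * qpow n) * (y * (K * D')) + (hs (qdiv m) + hs (qpow m * qdiv n)) * y"
    by (simp add: distrib_right hs_hom(5) mult.assoc hs_hs_commute[of "qpow n" "qpow m"] add_ac)
  also have "\<dots> = hs (qpow (m + n)) * (y * D) + hs (qpow (m + n)) * (y * (K * D')) + hs (qdiv (m + n)) * y"
    by (simp add: X_qdiv qdiv_add right_diff_distrib qpow_mult flip: hs_hom(3))
  finally show ?thesis
    by (simp add: tor_def distrib_left)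
qed

lemma divided_toral_eq:
  "divided_toral = Dexp 1 Short + Kpow 1 Short * (Dexp 3 Long + Kpow 3 Long * Dexp 3 Long)"
proof -
  let ?a = "freeK Short" and ?b = "freeK Long"
  have *: "fps_X * fps_shift 1 (x - 1) = x - 1" if "fps_nth x 0 = 1" for x :: "gword alg fps"
    by (rule fps_X_shift) (simp add: that)
  have 0: "fps_nth ?a 0 = 1" "fps_nth ?b 0 = 1"
    by (simp_all add: freeK_def hexp_nth_0)
  have "fps_shift 1 (?a * ?b ^ 2 - 1)
      = fps_shift 1 (?a - 1) + ?a * (fps_shift 1 (?b - 1) + ?b * fps_shift 1 (?b - 1))"
  proof (rule fps_X_left_cancel)
    have "fps_X * fps_shift 1 (?a * ?b ^ 2 - 1) = ?a * ?b ^ 2 - 1"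
      by (rule *) (simp add: 0 power2_eq_square)
    also have "\<dots> = (?a - 1) + ?a * ((?b - 1) + ?b * (?b - 1))"
      by (simp add: algebra_simps power2_eq_square)
    also have "\<dots> = fps_X * fps_shift 1 (?a - 1)
        + ?a * (fps_X * fps_shift 1 (?b - 1) + ?b * (fps_X * fps_shift 1 (?b - 1)))"
      by (simp only: * 0)
    finally show "fps_X * fps_shift 1 (?a * ?b ^ 2 - 1)
      = fps_X * (fps_shift 1 (?a - 1) + ?a * (fps_shift 1 (?b - 1) + ?b * fps_shift 1 (?b - 1)))"
      by (simp only: distrib_left fps_X_left_commute)
  qed
  then show ?thesis
    unfolding divided_toral_def Dexp_def Kpow_def
    by (simp only: abs_halg_hom freeK_def symm.simps)
qed

lemma tor_divided_toral: "tor divided_toral (hg (Xp j)) (cartan Short j + 6 * cartan Long j)"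
proof -
  have "tor (Dexp 3 Long + Kpow 3 Long * Dexp 3 Long) (hg (Xp j)) (3 * cartan Long j + 3 * cartan Long j)"
    by (rule tor_toral_mult[OF tor_Dexp tor_Dexp Kpow_Dexp])
  from tor_toral_mult[OF tor_Dexp[of 1 Short j] this Kpow_Dexp]
  show ?thesis by (simp add: divided_toral_eq)
qed

section \<open>Straightening modulo h\<close>

lemma hmult_eq: "hmult x = hs fps_X * x"
  by (simp add: hmult_def hscalar_eq_hs)

locale scalar_subalgebra =
  fixes B :: "Uh set"
  assumes B: "subalgebra (range hscalar) B"
begin

text \<open>This is hB, not the part of B divisible by h in the whole algebra; that the two agree is
  the saturation still to be proved.\<close>

definition J :: "Uh set" where "J = hmult ` B"

lemma B_closed:
  shows "hs f \<in> B" "1 \<in> B" "0 \<in> B"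
    and "x \<in> B \<Longrightarrow> y \<in> B \<Longrightarrow> x + y \<in> B" "x \<in> B \<Longrightarrow> y \<in> B \<Longrightarrow> x * y \<in> B"
    and "x \<in> B \<Longrightarrow> - x \<in> B" "x \<in> B \<Longrightarrow> y \<in> B \<Longrightarrow> x - y \<in> B"
proof -
  show hs: "hs f \<in> B" for f
    using B by (auto simp: subalgebra_def hscalar_eq_hs)
  show "1 \<in> B" "0 \<in> B" using hs[of 1] hs[of 0] by (simp_all add: hs_hom)
  show add: "x + y \<in> B" and mult: "x * y \<in> B" if "x \<in> B" "y \<in> B" for x y
    using B that by (auto simp: subalgebra_def)
  show neg: "- x \<in> B" if "x \<in> B" for x
    using mult[OF hs[of "- 1"] that] by (simp add: hs_uminus hs_hom)
  show "x - y \<in> B" if "x \<in> B" "y \<in> B" for x y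
    using add[OF that(1) neg[OF that(2)]] by simp
qed

lemma J_closed:
  shows "0 \<in> J" "x \<in> J \<Longrightarrow> y \<in> J \<Longrightarrow> x + y \<in> J" "x \<in> J \<Longrightarrow> y \<in> J \<Longrightarrow> x - y \<in> J" "x \<in> J \<Longrightarrow> - x \<in> J"
    and "x \<in> B \<Longrightarrow> y \<in> J \<Longrightarrow> x * y \<in> J" "x \<in> J \<Longrightarrow> y \<in> B \<Longrightarrow> x * y \<in> J"
    and "x \<in> B \<Longrightarrow> hs fps_X * x \<in> J" "x \<in> J \<Longrightarrow> x \<in> B"
proof -
  show X: "hs fps_X * x \<in> J" if "x \<in> B" for x using that by (auto simp: J_def hmult_eq)
  show "0 \<in> J" using X[of 0] B_closed by simp
  show add: "x + y \<in> J" if "x \<in> J" "y \<in> J" for x y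
    using that B_closed by (auto simp: J_def hmult_eq image_iff simp flip: distrib_left)
  show diff: "x - y \<in> J" if "x \<in> J" "y \<in> J" for x y
    using that B_closed by (auto simp: J_def hmult_eq image_iff simp flip: right_diff_distrib)
  show "- x \<in> J" if "x \<in> J" using diff[OF \<open>0 \<in> J\<close> that] by simp
  show "x * y \<in> J" if "x \<in> B" "y \<in> J" for x y
    using that X B_closed by (auto simp: J_def hmult_eq hs_left_commute)
  show "x * y \<in> J" if "x \<in> J" "y \<in> B" for x y
    using that X B_closed by (auto simp: J_def hmult_eq mult.assoc)
  show "x \<in> B" if "x \<in> J"
    using that B_closed by (auto simp: J_def hmult_eq)
qed

lemma hs_mod_J:
  assumes "x \<in> B"
  shows "hs f * x - hs (fps_const (fps_nth f 0)) * x \<in> J"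
proof -
  have "f - fps_const (fps_nth f 0) = fps_X * fps_shift 1 f"
    by (auto simp: fps_eq_iff fps_X_mult_nth)
  then have "hs f * x - hs (fps_const (fps_nth f 0)) * x = hs fps_X * (hs (fps_shift 1 f) * x)"
    by (simp flip: left_diff_distrib hs_hom(4)) (simp add: hs_hom mult.assoc)
  then show ?thesis using assms J_closed B_closed by simp
qed

lemma J_shift: "x - y \<in> J \<Longrightarrow> x \<in> J \<longleftrightarrow> y \<in> J"
  using J_closed(2)[of "x - y" y] J_closed(3)[of x "x - y"] by auto

lemma J_scale: "hs (fps_const c) * x \<in> J \<Longrightarrow> c \<noteq> 0 \<Longrightarrow> x \<in> J"
proof -
  assume *: "hs (fps_const c) * x \<in> J" and c: "c \<noteq> 0"
  have "hs (fps_const (inverse c)) * (hs (fps_const c) * x) = x"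
    using c by (simp flip: mult.assoc hs_hom(5) add: hs_hom(2))
  then show "x \<in> J" using J_closed(5)[OF B_closed(1) *] by metis
qed

text \<open>At h = 0 the scalars q^m and (q^m - 1)/h become 1 and m, and the toral relation becomes
  a classical eigenvalue equation.\<close>

lemma tor_mod_J:
  assumes "tor D y m" "D \<in> B" "y \<in> B"
  shows "comm D y - hs (fps_const (of_int m)) * y \<in> J"
proof -
  have "comm D y - hs (fps_const (of_int m)) * y
      = (hs (qpow m) * (y * D) - hs (fps_const 1) * (y * D))
      + (hs (qdiv m) * y - hs (fps_const (of_int m)) * y)"
    using assms(1) by (simp add: comm_def tor_def hs_hom)
  moreover have "hs (qpow m) * (y * D) - hs (fps_const 1) * (y * D) \<in> J"
    using hs_mod_J[of "y * D" "qpow m"] assms B_closed by (simp add: qpow_nth_0)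
  moreover have "hs (qdiv m) * y - hs (fps_const (of_int m)) * y \<in> J"
    using hs_mod_J[of y "qdiv m"] assms by (simp add: qdiv_nth_0)
  ultimately show ?thesis by (simp only: J_closed(2))
qed

lemma comm_J:
  assumes "x - x' \<in> J" "y \<in> B"
  shows "comm x y \<in> J \<longleftrightarrow> comm x' y \<in> J" "comm y x \<in> J \<longleftrightarrow> comm y x' \<in> J"
proof -
  have "comm x y - comm x' y = (x - x') * y - y * (x - x')"
    "comm y x - comm y x' = y * (x - x') - (x - x') * y"
    by (simp_all add: comm_def algebra_simps)
  then show "comm x y \<in> J \<longleftrightarrow> comm x' y \<in> J" "comm y x \<in> J \<longleftrightarrow> comm y x' \<in> J"
    using assms J_closed by (intro J_shift; simp)+
qed

lemma comm_zero_J: "x \<in> J \<Longrightarrow> y \<in> B \<Longrightarrow> comm x y \<in> J" "x \<in> J \<Longrightarrow> y \<in> B \<Longrightarrow> comm y x \<in> J"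
  using J_closed by (simp_all add: comm_def)

lemma comm_skew_J: "comm x y \<in> J \<longleftrightarrow> comm y x \<in> J"
  using J_closed(4)[of "comm x y"] J_closed(4)[of "comm y x"] by (auto simp: comm_def)

end

text \<open>Each bracket is asked to be a multiple of a single generator, as happens for one toral
  element and root vectors. Replacing a product of two letters by its bracket thus shortens a word
  by one.\<close>

locale straightening = scalar_subalgebra +
  fixes g :: "nat \<Rightarrow> Uh" and N :: nat
  assumes g_B: "i < N \<Longrightarrow> g i \<in> B"
    and g_comm: "i < N \<Longrightarrow> j < N \<Longrightarrow> \<exists>k<N. \<exists>c. comm (g i) (g j) - hs (fps_const c) * g k \<in> J"
begin

abbreviation mono :: "nat list \<Rightarrow> Uh" where "mono ws \<equiv> prod_list (map g ws)"

text \<open>The filtration by word length modulo hB. Complex coefficients suffice, because a power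
  series acts modulo hB through its constant term.\<close>

inductive_set V :: "nat \<Rightarrow> Uh set" for n where
  base: "x \<in> J \<Longrightarrow> x \<in> V n"
| step: "sorted ws \<Longrightarrow> set ws \<subseteq> {..<N} \<Longrightarrow> length ws \<le> n \<Longrightarrow> x \<in> V n
    \<Longrightarrow> hs (fps_const c) * mono ws + x \<in> V n"

lemma mono_B: "set ws \<subseteq> {..<N} \<Longrightarrow> mono ws \<in> B"
  by (induction ws) (auto intro!: B_closed(2,5) g_B)

lemma V_B: "x \<in> V n \<Longrightarrow> x \<in> B"
  by (induction rule: V.induct) (simp_all add: B_closed(1,4,5) mono_B J_closed(8))

lemma V_add: "x \<in> V n \<Longrightarrow> y \<in> V n \<Longrightarrow> x + y \<in> V n"
proof (induction rule: V.induct)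
  case (base x)
  show ?case using base(2)
  proof (induction rule: V.induct)
    case (step ws y c)
    then have "hs (fps_const c) * mono ws + (x + y) \<in> V n" by (intro V.step)
    then show ?case by (simp add: add_ac)
  next
    case (base y)
    then show ?case using \<open>x \<in> J\<close> by (intro V.base J_closed(2))
  qed
next
  case (step ws x c)
  then have "hs (fps_const c) * mono ws + (x + y) \<in> V n" by (intro V.step) auto
  then show ?case by (simp add: add_ac)
qed

lemma V_scale: "x \<in> V n \<Longrightarrow> hs (fps_const k) * x \<in> V n"
proof (induction rule: V.induct)
  case (step ws x c)
  have "hs (fps_const k) * (hs (fps_const c) * mono ws + x)
      = hs (fps_const (k * c)) * mono ws + hs (fps_const k) * x"
    by (simp add: distrib_left hs_hom(5) mult.assoc flip: fps_const_mult)
  then show ?case using step by (simp add: V.step)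
next
  case (base x)
  then show ?case by (intro V.base J_closed(5) B_closed(1))
qed

lemma V_mono: "x \<in> V m \<Longrightarrow> m \<le> n \<Longrightarrow> x \<in> V n"
  by (induction rule: V.induct) (auto intro: V.intros)

lemma V_sorted: "sorted ws \<Longrightarrow> set ws \<subseteq> {..<N} \<Longrightarrow> mono ws \<in> V (length ws)"
  using V.step[of ws "length ws" 0 1] V.base[OF J_closed(1)] by (simp add: hs_hom)

text \<open>Exchanging neighbours costs a bracket, that is, up to hB, a multiple of a word of length
  at most n. The first assumption is the induction hypothesis of \<open>V_words\<close>; insertion
  sort is built from such exchanges.\<close>

lemma V_swap:
  assumes "\<And>ws. length ws \<le> n \<Longrightarrow> set ws \<subseteq> {..<N} \<Longrightarrow> mono ws \<in> V n"
    and "length u + length v + 2 \<le> Suc n" "set u \<subseteq> {..<N}" "set v \<subseteq> {..<N}" "i < N" "j < N"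
  shows "mono (u @ i # j # v) - mono (u @ j # i # v) \<in> V n"
proof -
  obtain k c where k: "k < N" "comm (g i) (g j) - hs (fps_const c) * g k \<in> J"
    using g_comm[OF assms(5,6)] by blast
  have "mono (u @ i # j # v) - mono (u @ j # i # v) = mono u * (comm (g i) (g j) * mono v)"
    by (simp add: comm_def algebra_simps)
  also have "\<dots> = hs (fps_const c) * mono (u @ k # v)
      + mono u * ((comm (g i) (g j) - hs (fps_const c) * g k) * mono v)"
    by (simp add: left_diff_distrib right_diff_distrib mult.assoc hs_left_commute)
  also have "\<dots> \<in> V n"
    using assms k by (intro V_add V_scale V.base J_closed(5,6) mono_B assms(1)) auto
  finally show ?thesis .
qed

lemma V_insort:
  assumes "\<And>ws. length ws \<le> n \<Longrightarrow> set ws \<subseteq> {..<N} \<Longrightarrow> mono ws \<in> V n"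
    and "length u + length ws + 1 \<le> Suc n" "set u \<subseteq> {..<N}" "set ws \<subseteq> {..<N}" "i < N"
  shows "mono (u @ i # ws) - mono (u @ insort i ws) \<in> V n"
  using assms(2-4)
proof (induction ws arbitrary: u)
  case (Cons j ws)
  show ?case
  proof (cases "i \<le> j")
    case True
    then show ?thesis using J_closed(1) V.base by simp
  next
    case False
    have "mono (u @ i # j # ws) - mono (u @ j # i # ws) \<in> V n"
      using Cons.prems assms(5) by (intro V_swap assms(1)) auto
    moreover have "mono ((u @ [j]) @ i # ws) - mono ((u @ [j]) @ insort i ws) \<in> V n"
      using Cons.prems by (intro Cons.IH) auto
    ultimately have "(mono (u @ i # j # ws) - mono (u @ j # i # ws))
        + (mono ((u @ [j]) @ i # ws) - mono ((u @ [j]) @ insort i ws)) \<in> V n"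
      by (rule V_add)
    then show ?thesis using False by simp
  qed
qed (use J_closed(1) V.base in simp)

lemma V_sort:
  assumes "\<And>ws. length ws \<le> n \<Longrightarrow> set ws \<subseteq> {..<N} \<Longrightarrow> mono ws \<in> V n"
    and "length u + length ws \<le> Suc n" "set u \<subseteq> {..<N}" "set ws \<subseteq> {..<N}"
  shows "mono (u @ ws) - mono (u @ sort ws) \<in> V n"
  using assms(2-4)
proof (induction ws arbitrary: u)
  case (Cons i ws)
  have "mono ((u @ [i]) @ ws) - mono ((u @ [i]) @ sort ws) \<in> V n"
    using Cons.prems by (intro Cons.IH) auto
  moreover have "mono (u @ i # sort ws) - mono (u @ insort i (sort ws)) \<in> V n"
    using Cons.prems by (intro V_insort assms(1)) auto
  ultimately have "(mono ((u @ [i]) @ ws) - mono ((u @ [i]) @ sort ws))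
      + (mono (u @ i # sort ws) - mono (u @ insort i (sort ws))) \<in> V n"
    by (rule V_add)
  then show ?case by simp
qed (use J_closed(1) V.base in simp)

lemma V_words: "length ws \<le> n \<Longrightarrow> set ws \<subseteq> {..<N} \<Longrightarrow> mono ws \<in> V n"
proof (induction n arbitrary: ws)
  case 0
  then show ?case using V_sorted[of "[]"] by simp
next
  case (Suc n)
  have "mono ([] @ ws) - mono ([] @ sort ws) \<in> V n"
    using Suc by (intro V_sort) auto
  then have "(mono ws - mono (sort ws)) + mono (sort ws) \<in> V (Suc n)"
    using V_sorted[of "sort ws"] Suc.prems by (intro V_add) (auto intro: V_mono)
  then show ?case by simp
qed

lemma V_mult:
  assumes "x \<in> V m" "y \<in> V n"
  shows "x * y \<in> V (m + n)"
  using assms(1)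
proof (induction rule: V.induct)
  case (base x)
  then show ?case using V_B[OF assms(2)] by (intro V.base J_closed(6))
next
  case (step ws x c)
  have "mono ws * y \<in> V (m + n)"
    using assms(2)
  proof (induction rule: V.induct)
    case (base y)
    then show ?case using step by (intro V.base J_closed(5) mono_B)
  next
    case (step vs y d)
    have "mono ws * (hs (fps_const d) * mono vs + y) = hs (fps_const d) * mono (ws @ vs) + mono ws * y"
      by (simp add: distrib_left hs_left_commute)
    moreover have "mono (ws @ vs) \<in> V (m + n)"
      using step \<open>length ws \<le> m\<close> \<open>set ws \<subseteq> {..<N}\<close> by (intro V_words) auto
    ultimately show ?case using step by (simp add: V_add V_scale)
  qed
  then show ?case
    using step by (simp add: distrib_right mult.assoc V_add V_scale)
qed

lemma V_scalar: "hs f \<in> V n"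
proof -
  have "hs f - hs (fps_const (fps_nth f 0)) \<in> J"
    using hs_mod_J[of 1 f] B_closed by simp
  then have "hs (fps_const (fps_nth f 0)) * mono [] + (hs f - hs (fps_const (fps_nth f 0))) \<in> V n"
    by (intro V.step V.base) auto
  then show ?thesis by simp
qed

lemma V_subalgebra: "subalgebra (range hscalar) (\<Union>n. V n)"
  unfolding subalgebra_def
proof (intro conjI ballI)
  show "range hscalar \<subseteq> (\<Union>n. V n)" using V_scalar by (auto simp: hscalar_eq_hs)
  fix x y assume "x \<in> (\<Union>n. V n)" "y \<in> (\<Union>n. V n)"
  then obtain m n where *: "x \<in> V m" "y \<in> V n" by blast
  have "x \<in> V (max m n)" "y \<in> V (max m n)"
    using V_mono[OF *(1)] V_mono[OF *(2)] by simp_all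
  then show "x + y \<in> (\<Union>n. V n)" using V_add by blast
  show "x * y \<in> (\<Union>n. V n)" using V_mult[OF *] by blast
qed

text \<open>The inductive presentation may repeat a word. Coefficients are collected into a function
  on a finite set, the form in which independence applies.\<close>

lemma V_normal_form:
  "x \<in> V n \<Longrightarrow> \<exists>W k. finite W \<and> (\<forall>ws\<in>W. sorted ws \<and> set ws \<subseteq> {..<N})
    \<and> x - (\<Sum>ws\<in>W. hs (fps_const (k ws)) * mono ws) \<in> J"
proof (induction rule: V.induct)
  case (base x)
  then show ?case by (intro exI[of _ "{}"]) simp
next
  case (step ws x c)
  then obtain W k where W: "finite W" "\<forall>ws\<in>W. sorted ws \<and> set ws \<subseteq> {..<N}"
    "x - (\<Sum>ws\<in>W. hs (fps_const (k ws)) * mono ws) \<in> J"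
    by blast
  define k' where "k' v = (if v \<in> W then k v else 0) + (if v = ws then c else 0)" for v
  have "(\<Sum>v\<in>insert ws W. hs (fps_const (k' v)) * mono v)
      = (\<Sum>v\<in>insert ws W. hs (fps_const (if v \<in> W then k v else 0)) * mono v)
      + (\<Sum>v\<in>insert ws W. hs (fps_const (if v = ws then c else 0)) * mono v)"
    unfolding k'_def by (simp add: hs_hom(3) distrib_right sum.distrib flip: fps_const_add)
  also have "(\<Sum>v\<in>insert ws W. hs (fps_const (if v \<in> W then k v else 0)) * mono v)
      = (\<Sum>v\<in>W. hs (fps_const (k v)) * mono v)"
    using W(1) by (intro sum.mono_neutral_cong_right) (auto simp: hs_hom)
  also have "(\<Sum>v\<in>insert ws W. hs (fps_const (if v = ws then c else 0)) * mono v)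
      = (\<Sum>v\<in>{ws}. hs (fps_const c) * mono v)"
    using W(1) by (intro sum.mono_neutral_cong_right) (auto simp: hs_hom)
  finally have eq: "hs (fps_const c) * mono ws + x - (\<Sum>v\<in>insert ws W. hs (fps_const (k' v)) * mono v)
      = x - (\<Sum>v\<in>W. hs (fps_const (k v)) * mono v)"
    by simp
  show ?case
  proof (intro exI conjI)
    show "hs (fps_const c) * mono ws + x - (\<Sum>v\<in>insert ws W. hs (fps_const (k' v)) * mono v) \<in> J"
      unfolding eq by (rule W(3))
  qed (use W step in auto)
qed

end

section \<open>The quantized subalgebra\<close>

abbreviation (input) "qe1 \<equiv> hg (Xp Short)"
abbreviation (input) "qe2 \<equiv> hg (Xp Long)"

definition "qx1 = nest1 qq qe1 qe2"
definition "qx2 = nest2 qq qe1 qe2"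
definition "qx3 = nest3 qq pp qe1 qe2"
definition "qt = comm qx3 qe2"

text \<open>The signs compensate for E_1 standing on the right in the q-commutators: X and Z
  specialize to -x_3 and -x_5, whereas Y and T give x_4 and x_6.\<close>

definition qgen :: "nat \<Rightarrow> Uh" where
  "qgen i = [divided_toral, qe2, - qx1, qx2, - qx3, qt] ! i"

text \<open>The relations of \<open>nest_relations\<close>, with scalars collected into power series
  whose constant terms can be read off modulo h.\<close>

lemma q_relations:
  shows "qx1 * qe2 = hs (qpow 3) * (qe2 * qx1)"
    and "hs (qpow 3) * comm qx2 qe2 = hs (qpow 4 - 1) * (qx1 * qx1)"
    and "hs (qpow 6) * (qx3 * qe2) - hs (qpow 3) * (qe2 * qx3)
      + hs (qpow 3 - qpow 5 + qpow 1) * (qx2 * qx1) - hs (qpow 2 + qpow 4 - 1) * (qx1 * qx2) = 0"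
    and "hs (qpow 4 + qpow 2) * comm qx3 qx1 = hs (qpow 5 - qpow (-1)) * (qx2 * qx2)"
    and "hs (qpow 2 + qpow (-2)) * (qx3 * qx2 - hs (qpow 3) * (qx2 * qx3)) = 0"
proof -
  have serre: "nest4 qq pp qe1 qe2 = 0" "qbr (pp * pp * pp) (nest1 qq qe2 qe1) qe2 = 0"
    using serre_relations[of Xp] by simp_all
  have w: "hs (qpow 4) = qq * qq * qq * qq" "hs (qpow 5) = qq * qq * qq * qq * qq"
    using hs_hom(5)[of "qpow 3" "qpow 1"] hs_hom(5)[of "qpow 3" "qpow 2"]
    by (simp_all add: qpow_mult hs_qpow_words mult.assoc)
  note R = Q.nest_relations[OF serre, folded qx1_def qx2_def qx3_def]
  show "qx1 * qe2 = hs (qpow 3) * (qe2 * qx1)"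
    using R(1) by (simp add: hs_qpow_words)
  show "hs (qpow 3) * comm qx2 qe2 = hs (qpow 4 - 1) * (qx1 * qx1)"
    using R(2) by (simp add: hs_qpow_words hs_hom w comm_def right_diff_distrib)
  show "hs (qpow 6) * (qx3 * qe2) - hs (qpow 3) * (qe2 * qx3)
      + hs (qpow 3 - qpow 5 + qpow 1) * (qx2 * qx1) - hs (qpow 2 + qpow 4 - 1) * (qx1 * qx2) = 0"
    using R(3) by (simp add: hs_qpow_words hs_hom w)
  show "hs (qpow 4 + qpow 2) * comm qx3 qx1 = hs (qpow 5 - qpow (-1)) * (qx2 * qx2)"
    using R(4) by (simp add: hs_qpow_words hs_hom w comm_def algebra_simps)
  show "hs (qpow 2 + qpow (-2)) * (qx3 * qx2 - hs (qpow 3) * (qx2 * qx3)) = 0"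
    using R(5) by (simp add: hs_qpow_words hs_hom)
qed


lemma (in scalar_subalgebra) J_unit:
  assumes "hs f * x \<in> J" "x \<in> B" "fps_nth f 0 \<noteq> 0"
  shows "x \<in> J"
proof -
  have "hs (fps_const (fps_nth f 0)) * x \<in> J"
    using J_shift[OF hs_mod_J[OF assms(2), of f]] assms(1) by simp
  then show ?thesis using assms(3) by (rule J_scale)
qed

lemma (in scalar_subalgebra) J_nonunit: "x \<in> B \<Longrightarrow> fps_nth f 0 = 0 \<Longrightarrow> hs f * x \<in> J"
  using hs_mod_J[of x f] by (simp add: hs_hom)

lemma (in scalar_subalgebra) J_one: "x \<in> B \<Longrightarrow> fps_nth f 0 = 1 \<Longrightarrow> hs f * x - x \<in> J"
  using hs_mod_J[of x f] by (simp add: hs_hom)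

lemma (in scalar_subalgebra) comm_B: "x \<in> B \<Longrightarrow> y \<in> B \<Longrightarrow> comm x y \<in> B"
  unfolding comm_def by (intro B_closed)

lemma (in scalar_subalgebra) comm_jacobi_J:
  assumes "comm x z \<in> J" "comm y z \<in> J" "x \<in> B" "y \<in> B"
  shows "comm (comm x y) z \<in> J"
proof -
  have "comm (comm x y) z = comm x (comm y z) - comm y (comm x z)"
    by (simp add: comm_def algebra_simps)
  then show ?thesis using assms comm_zero_J J_closed(3) by simp
qed

text \<open>At h = 0 the third relation reads T = -[Y, X]. Since X and Y commute with E_2 and Z
  modulo hB, the Jacobi identity for this expression gives the brackets of T with E_2 and Z. The
  brackets with X and Y use T = [Z, E_2] instead.\<close>

lemma (in scalar_subalgebra) q_brackets:
  assumes b: "qe2 \<in> B" "qx1 \<in> B" "qx2 \<in> B" "qx3 \<in> B"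
  shows "comm qx1 qe2 \<in> J" "comm qx2 qe2 \<in> J" "comm qx2 qx1 + qt \<in> J" "comm qx3 qx1 \<in> J" "comm qx3 qx2 \<in> J"
    and "comm qt qe2 \<in> J" "comm qt qx1 \<in> J" "comm qt qx2 \<in> J" "comm qt qx3 \<in> J"
proof -
  note p = b B_closed(5) comm_B
  have "comm qx1 qe2 = hs (qpow 3) * (qe2 * qx1) - qe2 * qx1"
    by (simp add: comm_def q_relations)
  then show 1: "comm qx1 qe2 \<in> J"
    by (simp add: J_one p qpow_nth_0)
  have "hs (qpow 3) * comm qx2 qe2 \<in> J"
    unfolding q_relations by (rule J_nonunit) (simp_all add: p qpow_nth_0)
  then show 2: "comm qx2 qe2 \<in> J"
    by (rule J_unit) (simp_all add: p qpow_nth_0)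
  have "comm qx2 qx1 + qt = (hs (qpow 3) * (qe2 * qx3) - qe2 * qx3)
      + (hs (qpow 2 + qpow 4 - 1) * (qx1 * qx2) - qx1 * qx2)
      - (hs (qpow 6) * (qx3 * qe2) - qx3 * qe2)
      - (hs (qpow 3 - qpow 5 + qpow 1) * (qx2 * qx1) - qx2 * qx1)"
    using q_relations(3) by (simp add: comm_def qt_def algebra_simps)
  also have "\<dots> \<in> J"
    by (intro J_closed(2,3) J_one) (simp_all add: p qpow_nth_0)
  finally show 3: "comm qx2 qx1 + qt \<in> J" .
  have "hs (qpow 4 + qpow 2) * comm qx3 qx1 \<in> J"
    unfolding q_relations by (rule J_nonunit) (simp_all add: p qpow_nth_0)
  then show 4: "comm qx3 qx1 \<in> J"
    by (rule J_unit) (simp_all add: p qpow_nth_0)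
  have "hs (qpow 2 + qpow (-2)) * (qx3 * qx2 - hs (qpow 3) * (qx2 * qx3)) \<in> J"
    unfolding q_relations by (rule J_closed)
  then have "qx3 * qx2 - hs (qpow 3) * (qx2 * qx3) \<in> J"
    by (rule J_unit) (simp_all add: p B_closed(1,7) qpow_nth_0)
  moreover have "hs (qpow 3) * (qx2 * qx3) - qx2 * qx3 \<in> J"
    by (rule J_one) (simp_all add: p qpow_nth_0)
  ultimately have "(qx3 * qx2 - hs (qpow 3) * (qx2 * qx3)) + (hs (qpow 3) * (qx2 * qx3) - qx2 * qx3) \<in> J"
    by (rule J_closed(2))
  then show 5: "comm qx3 qx2 \<in> J" by (simp add: comm_def)
  have skew: "comm qe2 qx1 \<in> J" "comm qe2 qx2 \<in> J" "comm qx1 qx3 \<in> J" "comm qx2 qx3 \<in> J"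
    by (rule comm_skew_J[THEN iffD1], fact)+
  have "qt - - comm qx2 qx1 \<in> J" using 3 by (simp add: add.commute)
  then have t: "comm qt z \<in> J \<longleftrightarrow> comm (comm qx2 qx1) z \<in> J" if "z \<in> B" for z
    using comm_J(1)[OF _ that, of qt "- comm qx2 qx1"] J_closed(4)[of "comm (comm qx2 qx1) z"]
      J_closed(4)[of "comm (- comm qx2 qx1) z"] by (auto simp: comm_def algebra_simps)
  show "comm qt qe2 \<in> J" using t b 1 2 comm_jacobi_J by simp
  show "comm qt qx3 \<in> J" using t b skew comm_jacobi_J by simp
  show "comm qt qx1 \<in> J" "comm qt qx2 \<in> J"
    unfolding qt_def using b skew 4 5 comm_jacobi_J by simp_all
qed

lemma tor_gens:
  "tor divided_toral qe2 9" "tor divided_toral (- qx1) 5" "tor divided_toral qx2 1"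
  "tor divided_toral (- qx3) (-3)" "tor divided_toral qt 6"
proof -
  have a: "tor divided_toral qe1 (-4)" and c: "tor divided_toral qe2 9"
    using tor_divided_toral[of Short] tor_divided_toral[of Long] by simp_all
  have neg: "tor divided_toral (- x) m" if "tor divided_toral x m" for x m
    using tor_scale[OF that, of "-1"] by (simp add: hs_uminus hs_hom)
  have 1: "tor divided_toral qx1 5"
    using tor_qbr[OF c a, of "qpow 3"] by (simp add: qx1_def nest1_def hs_qpow_words)
  have 2: "tor divided_toral qx2 1"
    using tor_qbr[OF 1 a, of "qpow 1"] by (simp add: qx2_def qx1_def nest2_def hs_qpow_words)
  have 3: "tor divided_toral qx3 (-3)"
    using tor_qbr[OF 2 a, of "qpow (-1)"] by (simp add: qx3_def qx2_def nest3_def hs_qpow_words)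
  show "tor divided_toral qt 6"
    using tor_qbr[OF 3 c, of 1] by (simp add: qt_def comm_def qbr_def hs_hom)
  show "tor divided_toral qe2 9" "tor divided_toral (- qx1) 5" "tor divided_toral qx2 1"
    "tor divided_toral (- qx3) (-3)"
    using 1 2 3 c neg by simp_all
qed

text \<open>Besides the toral eigenvalue relations, the brackets of E_2 with Z and of X with Y have
  to be expressed through T modulo hB; the other pairs commute there.\<close>

lemma (in scalar_subalgebra) qgen_comm:
  assumes gens: "\<And>i. i < 6 \<Longrightarrow> qgen i \<in> B" and ij: "i < 6" "j < 6"
  shows "\<exists>k<6. \<exists>c. comm (qgen i) (qgen j) - hs (fps_const c) * qgen k \<in> J"
proof -
  define Q where "Q x y \<longleftrightarrow> (\<exists>k<6. \<exists>c. comm x y - hs (fps_const c) * qgen k \<in> J)" for x y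
  have g: "qgen 0 = divided_toral" "qgen 1 = qe2" "qgen 2 = - qx1" "qgen 3 = qx2"
    "qgen 4 = - qx3" "qgen 5 = qt"
    by (simp_all add: qgen_def)
  have B: "divided_toral \<in> B" "qe2 \<in> B" "- qx1 \<in> B" "qx2 \<in> B" "- qx3 \<in> B" "qt \<in> B"
    by (subst g[symmetric], rule gens, simp)+
  then have "qx1 \<in> B" "qx3 \<in> B"
    using B_closed(6)[of "- qx1"] B_closed(6)[of "- qx3"] by simp_all
  note br = q_brackets[OF B(2) this(1) B(4) this(2)]
  note brs = br(1,2,4-9) br(1,2,4-9)[THEN comm_skew_J[THEN iffD1]]
  have neg: "comm (- x) y \<in> J \<longleftrightarrow> comm x y \<in> J" "comm x (- y) \<in> J \<longleftrightarrow> comm x y \<in> J" for x y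
    using J_closed(4)[of "comm x y"] J_closed(4)[of "- comm x y"] by (auto simp: comm_def)
  have QI: "Q x y" if "comm x y - hs (fps_const c) * qgen k \<in> J" "k < 6" for x y k c
    using that unfolding Q_def by blast
  have Q0: "Q x y" if "comm x y \<in> J" for x y
    using that by (intro QI[of _ _ 0 0]) (simp_all add: hs_hom)
  have Qsym: "Q y x" if q: "Q x y" for x y
  proof -
    obtain k c where k: "k < 6" and *: "comm x y - hs (fps_const c) * qgen k \<in> J"
      using q unfolding Q_def by blast
    have "comm y x - hs (fps_const (- c)) * qgen k = - (comm x y - hs (fps_const c) * qgen k)"
      by (simp add: comm_def hs_uminus flip: fps_const_neg)
    then show ?thesis using J_closed(4)[OF *] k by (intro QI[of _ _ "- c" k]) simp_all
  qed
  have refl: "Q x x" for x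
    by (rule Q0) (simp add: comm_def J_closed)
  have 0: "Q divided_toral qe2" "Q divided_toral (- qx1)" "Q divided_toral qx2"
    "Q divided_toral (- qx3)" "Q divided_toral qt"
    subgoal by (rule QI[of _ _ "of_int 9" 1, unfolded g, OF tor_mod_J[OF tor_gens(1) B(1,2)]]) simp
    subgoal by (rule QI[of _ _ "of_int 5" 2, unfolded g, OF tor_mod_J[OF tor_gens(2) B(1,3)]]) simp
    subgoal by (rule QI[of _ _ "of_int 1" 3, unfolded g, OF tor_mod_J[OF tor_gens(3) B(1,4)]]) simp
    subgoal by (rule QI[of _ _ "of_int (-3)" 4, unfolded g, OF tor_mod_J[OF tor_gens(4) B(1,5)]]) simp
    subgoal by (rule QI[of _ _ "of_int 6" 5, unfolded g, OF tor_mod_J[OF tor_gens(5) B(1,6)]]) simp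
    done
  have z: "Q qe2 (- qx1)" "Q qe2 qx2" "Q qe2 qt" "Q (- qx1) (- qx3)" "Q (- qx1) qt"
    "Q qx2 (- qx3)" "Q qx2 qt" "Q (- qx3) qt"
    by (rule Q0, simp add: neg brs)+
  have e: "Q qe2 (- qx3)"
    by (rule QI[of _ _ 1 5]) (simp_all add: g qt_def hs_hom comm_def J_closed)
  have "comm (- qx1) qx2 - hs (fps_const (- 1)) * qgen 5 = comm qx2 qx1 + qt"
    by (simp add: g comm_def hs_uminus hs_hom flip: fps_const_neg)
  then have f: "Q (- qx1) qx2"
    using br(3) by (intro QI[of _ _ "-1" 5]) simp_all
  note all = 0 z e f refl 0[THEN Qsym] z[THEN Qsym] e[THEN Qsym] f[THEN Qsym]
  let ?L = "[divided_toral, qe2, - qx1, qx2, - qx3, qt]"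
  have "\<forall>x\<in>set ?L. \<forall>y\<in>set ?L. Q x y"
    by (simp add: all)
  moreover have "qgen k \<in> set ?L" if "k < 6" for k
    unfolding qgen_def using that by (intro nth_mem) simp
  ultimately have "Q (qgen i) (qgen j)" using ij by blast
  then show ?thesis by (simp only: Q_def)
qed

section \<open>Specialization of the generators, normal forms in B, and the coideal property\<close>

lemma specialize_qbr:
  "fps_nth f 0 = 1 \<Longrightarrow> specialize (qbr (hs f) x y) = comm (specialize x) (specialize y)"
  by (simp add: qbr_def comm_def specialize_hom uscale_mult mult.assoc)

lemma specialize_uminus: "specialize (- x) = - specialize x"
  using specialize_hom(2)[of 0 x] by (simp add: specialize_hom)

lemma specialize_qgen: "i < 6 \<Longrightarrow> specialize (qgen i) = ubasis i"
proof -
  have 1: "specialize qx1 = comm (chev_e Long) (chev_e Short)"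
    using specialize_qbr[of "qpow 3" qe2 qe1]
    by (simp add: qx1_def nest1_def hs_qpow_words qpow_nth_0 specialize_hom chev_e_def)
  have 2: "specialize qx2 = comm (comm (chev_e Long) (chev_e Short)) (chev_e Short)"
    using specialize_qbr[of "qpow 1" qx1 qe1]
    by (simp add: qx2_def nest2_def hs_qpow_words qpow_nth_0 specialize_hom chev_e_def 1 flip: qx1_def)
  have 3: "specialize qx3 = comm (comm (comm (chev_e Long) (chev_e Short)) (chev_e Short)) (chev_e Short)"
    using specialize_qbr[of "qpow (-1)" qx2 qe1]
    by (simp add: qx3_def nest3_def hs_qpow_words qpow_nth_0 specialize_hom chev_e_def 2 flip: qx2_def)
  assume "i < 6"
  then have "i \<in> {0,1,2,3,4,5}" by auto
  then show ?thesis
    by (elim insertE emptyE; hypsubst)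
      (simp_all add: qgen_def ubasis_def specialize_divided_toral specialize_uminus specialize_hom
        specialize_comm qt_def 1 2 3 chev_e_def, simp_all add: comm_def algebra_simps)
qed

lemma specialize_hmult: "specialize (hmult x) = 0"
  by (simp add: hmult_eq specialize_hs_mult)

lemma specialize_Kh: "specialize (Kh i) = 1"
  by (simp add: Kh_eq Kpow_Dexp specialize_hom uscale_mult)

lemma specialize_sum: "specialize (\<Sum>i\<in>A. f i) = (\<Sum>i\<in>A. specialize (f i))"
  by (induction A rule: infinite_finite_induct) (simp_all add: specialize_hom)

text \<open>Signed generators are used so that each \<open>qgen\<close> specializes to the
  \<open>ubasis\<close> vector of the same index; the generated algebra is unaffected by
  signs.\<close>

definition Bgens :: "Uh set" where
  "Bgens = insert (Kh Short * Kh Long ^ 2) (qgen ` {..<6})"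

definition Bq :: "Uh set" where
  "Bq = generated_subalgebra (range hscalar) Bgens"

lemma qgen_range: "qgen ` {..<6} = {divided_toral, qe2, - qx1, qx2, - qx3, qt}"
proof -
  have "{..<6::nat} = {0, 1, 2, 3, 4, 5}" by auto
  then show ?thesis by (simp add: qgen_def)
qed

interpretation Bq: scalar_subalgebra Bq
  by unfold_locales (simp add: Bq_def generated_subalgebra_subalgebra)

lemma Bq_minimal: "subalgebra (range hscalar) A \<Longrightarrow> Bgens \<subseteq> A \<Longrightarrow> Bq \<subseteq> A"
  unfolding Bq_def by (rule generated_subalgebra_minimal)

lemma Bgens_Bq: "x \<in> Bgens \<Longrightarrow> x \<in> Bq"
  unfolding Bq_def using generated_subalgebra_superset by blast

lemma qgen_Bq: "i < 6 \<Longrightarrow> qgen i \<in> Bq"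
  by (rule Bgens_Bq) (auto simp: Bgens_def)

interpretation Bq: straightening Bq qgen 6
  by unfold_locales (use qgen_Bq Bq.qgen_comm[OF qgen_Bq] in blast)+

lemma Bq_V: "Bq \<subseteq> (\<Union>n. Bq.V n)"
proof (rule Bq_minimal[OF Bq.V_subalgebra])
  show "Bgens \<subseteq> (\<Union>n. Bq.V n)"
    unfolding Bgens_def
  proof (intro insert_subsetI subsetI)
    have "Kh Short * Kh Long ^ 2 = hs 1 + hmult divided_toral"
      by (simp add: divided_toral hs_hom)
    moreover have "hmult divided_toral \<in> Bq.J"
      using qgen_Bq[of 0] by (simp add: qgen_def Bq.J_def)
    ultimately have "Kh Short * Kh Long ^ 2 \<in> Bq.V 0"
      using Bq.V_add[OF Bq.V_scalar Bq.V.base] by metis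
    then show "Kh Short * Kh Long ^ 2 \<in> (\<Union>n. Bq.V n)" by blast
    fix x assume "x \<in> qgen ` {..<6}"
    then obtain i where i: "i < 6" "x = qgen i" by auto
    then have "x \<in> Bq.V 1" using Bq.V_sorted[of "[i]"] by simp
    then show "x \<in> (\<Union>n. Bq.V n)" by blast
  qed
qed

lemma specialize_mono: "set ws \<subseteq> {..<6} \<Longrightarrow> specialize (Bq.mono ws) = prod_list (map ubasis ws)"
  by (induction ws) (auto simp: specialize_hom specialize_qgen)

lemma Bq_saturated: "Bq \<inter> range hmult = hmult ` Bq"
proof
  show "hmult ` Bq \<subseteq> Bq \<inter> range hmult"
    using Bq.J_closed(8)[unfolded Bq.J_def] by blast
  show "Bq \<inter> range hmult \<subseteq> hmult ` Bq"
  proof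
    fix x assume x: "x \<in> Bq \<inter> range hmult"
    then have 0: "specialize x = 0" by (auto simp: specialize_hmult)
    obtain W k where W: "finite W" "\<forall>ws\<in>W. sorted ws \<and> set ws \<subseteq> {..<6}"
      and xW: "x - (\<Sum>ws\<in>W. hs (fps_const (k ws)) * Bq.mono ws) \<in> Bq.J"
    proof -
      obtain n where "x \<in> Bq.V n" using x Bq_V by blast
      then show thesis using Bq.V_normal_form that by blast
    qed
    have "specialize (x - (\<Sum>ws\<in>W. hs (fps_const (k ws)) * Bq.mono ws)) = 0"
      using xW by (auto simp: Bq.J_def specialize_hmult)
    then have "(\<Sum>ws\<in>W. uscale (k ws) (prod_list (map ubasis ws))) = 0"
      using W(2) by (simp add: specialize_hom 0 specialize_sum specialize_hs_mult specialize_mono uscale_mult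
          cong: sum.cong)
    then have "k ws = 0" if "ws \<in> W" for ws
      using ordered_monomials_independent[OF W(1) _ _ that] W(2) by blast
    then have "(\<Sum>ws\<in>W. hs (fps_const (k ws)) * Bq.mono ws) = 0"
      by (simp add: hs_hom)
    then show "x \<in> hmult ` Bq" using xW by (simp add: Bq.J_def)
  qed
qed

text \<open>Minimality on both sides: the preimage of the envelope is a subalgebra containing the
  generators, and the image of B is a subalgebra containing the Lie algebra.\<close>

lemma specialize_Bq: "specialize ` Bq = env (ualg.span (ubasis ` {..<6}))"
proof
  let ?L = "ualg.span (ubasis ` {..<6})"
  have env: "subalgebra uscalars (env ?L)" "?L \<subseteq> env ?L"
    by (simp_all add: env_def generated_subalgebra_subalgebra generated_subalgebra_superset)
  have add: "x + y \<in> env ?L" and mult: "x * y \<in> env ?L" if "x \<in> env ?L" "y \<in> env ?L" for x y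
    using env(1) that unfolding subalgebra_def by blast+
  have uscal: "uscale c 1 \<in> env ?L" for c
    using env(1) unfolding subalgebra_def uscalars_def by blast
  then have one: "1 \<in> env ?L" by (metis ualg.scale_one)
  have "subalgebra (range hscalar) {x. specialize x \<in> env ?L}"
    unfolding subalgebra_def by (auto simp: specialize_hom hscalar_eq_hs uscal add mult)
  moreover have "Bgens \<subseteq> {x. specialize x \<in> env ?L}"
  proof
    fix x assume "x \<in> Bgens"
    then consider "x = Kh Short * Kh Long ^ 2" | i where "i < 6" "x = qgen i"
      by (auto simp: Bgens_def)
    then show "x \<in> {x. specialize x \<in> env ?L}"
    proof cases
      case 1
      then show ?thesis using one by (simp add: specialize_hom specialize_Kh power2_eq_square)
    next
      case 2
      then have "specialize x \<in> ?L" by (auto simp: specialize_qgen intro!: ualg.span_base)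
      then show ?thesis using env(2) by blast
    qed
  qed
  ultimately have "Bq \<subseteq> {x. specialize x \<in> env ?L}"
    by (rule Bq_minimal)
  then show "specialize ` Bq \<subseteq> env ?L" by auto
  have scal: "uscale c x \<in> specialize ` Bq" if x: "x \<in> specialize ` Bq" for c x
  proof -
    obtain b where "b \<in> Bq" "x = specialize b" using x by auto
    then have "hs (fps_const c) * b \<in> Bq" "specialize (hs (fps_const c) * b) = uscale c x"
      by (simp_all add: Bq.B_closed specialize_hs_mult)
    then show ?thesis by (metis imageI)
  qed
  have sub: "x + y \<in> specialize ` Bq" "x * y \<in> specialize ` Bq"
    if xy: "x \<in> specialize ` Bq" "y \<in> specialize ` Bq" for x y
  proof -
    obtain a b where "a \<in> Bq" "x = specialize a" "b \<in> Bq" "y = specialize b" using xy by auto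
    then show "x + y \<in> specialize ` Bq" "x * y \<in> specialize ` Bq"
      using imageI[OF Bq.B_closed(4)[of a b], of specialize] imageI[OF Bq.B_closed(5)[of a b], of specialize]
      by (simp_all add: specialize_hom)
  qed
  have one': "1 \<in> specialize ` Bq" "0 \<in> specialize ` Bq"
    using imageI[OF Bq.B_closed(2), of specialize] imageI[OF Bq.B_closed(3), of specialize]
    by (simp_all add: specialize_hom)
  have "subalgebra uscalars (specialize ` Bq)"
    unfolding subalgebra_def uscalars_def using sub scal[OF one'(1)] by blast
  moreover have "?L \<subseteq> specialize ` Bq"
  proof (rule ualg.span_minimal)
    show "ubasis ` {..<6} \<subseteq> specialize ` Bq"
    proof
      fix x assume "x \<in> ubasis ` {..<6}"
      then obtain i where "i < 6" "x = ubasis i" by auto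
      then show "x \<in> specialize ` Bq"
        using imageI[OF qgen_Bq[of i], of specialize] by (simp add: specialize_qgen)
    qed
    show "ualg.subspace (specialize ` Bq)"
      by (intro ualg.subspaceI sub scal one')
  qed
  ultimately show "env ?L \<subseteq> specialize ` Bq"
    unfolding env_def by (rule generated_subalgebra_minimal)
qed

lemma left_coideal_Bq: "left_coideal Bq"
  unfolding Bq_def
proof (rule left_coideal_generated, fold Bq_def)
  have neg: "x \<in> Bq" if "- x \<in> Bq" for x using Bq.B_closed(6)[OF that] by simp
  have gens: "divided_toral \<in> Bq" "qe2 \<in> Bq" "- qx1 \<in> Bq" "qx2 \<in> Bq" "- qx3 \<in> Bq" "qt \<in> Bq"
    using Bgens_Bq by (simp_all add: Bgens_def qgen_range)
  note gens' = gens neg[OF gens(3)] neg[OF gens(5)]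
  let ?T = "tensor_set Bq UNIV"
  have mult: "x * y \<in> ?T" if "x \<in> ?T" "y \<in> ?T" for x y
    using that Bq.B_closed by (auto intro: tensor_set_mult)
  have diff: "x - y \<in> ?T" if "x \<in> ?T" "y \<in> ?T" for x y
    using that by (auto intro: tensor_set_diff)
  note pure = tensor_set_pure[OF _ UNIV_I]
  have c: "comult qe2 \<in> ?T"
    unfolding comult_hom cop_eq by (intro tensor_set_add pure gens Bq.B_closed)
  note nested = comult_nested[OF Bq.B gens'(2,7)[unfolded qx1_def] gens'(4,8)[unfolded qx2_def qx3_def],
      folded qx1_def qx2_def qx3_def]
  have zero: "0 \<in> ?T" by (rule tensor_set.zero)
  have neg': "comult (- x) \<in> ?T" if "comult x \<in> ?T" for x
    using diff[OF zero that] comult_hom(2)[of 0 x] comult_hom(4)[of 0] by (simp add: hs_hom)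
  have t: "comult qt \<in> ?T"
    unfolding qt_def comm_def comult_hom(2,3) by (intro diff mult nested c)
  have k: "Kh Short * Kh Long ^ 2 \<in> Bq" by (rule Bgens_Bq) (simp add: Bgens_def)
  have "comult (Kh Short * Kh Long ^ 2)
      = (Kh Short * Kh Long ^ 2) \<otimes>\<^sub>h (Kh Short * Kh Long ^ 2)"
    by (simp add: Kh_eq power2_eq_square comult_hom htensor_mult)
  then have "comult (Kh Short * Kh Long ^ 2) \<in> ?T"
    using pure[OF k] by simp
  moreover have "comult divided_toral \<in> ?T"
    unfolding comult_divided_toral by (intro tensor_set_add pure gens Bq.B_closed)
  ultimately show "comult s \<in> ?T" if "s \<in> Bgens" for s
    using that c nested neg' t by (auto simp: Bgens_def qgen_range)
qed

section \<open>Brackets of root vectors\<close>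

lemma comm_rules:
  fixes x y z :: "'a::presented ualg"
  shows "comm (x + y) z = comm x z + comm y z" "comm z (x + y) = comm z x + comm z y"
    "comm (- x) y = - comm x y" "comm x (- y) = - comm x y" "comm 0 x = 0" "comm x 0 = 0" "comm x x = 0"
    "comm (x - y) z = comm x z - comm y z" "comm z (x - y) = comm z x - comm z y"
  by (simp_all add: comm_def algebra_simps)

lemma comm_swap: "comm y x = - comm x y" for x y :: "'a::presented ualg"
  by (simp add: comm_def)

lemma comm_jacobi: "comm x (comm y z) = comm (comm x y) z + comm y (comm x z)" for x y z :: "'a::presented ualg"
  by (simp add: comm_def algebra_simps)

lemma uscale_numeral: "uscale 1 x = x" "uscale (- 1) x = - x" "uscale 0 x = 0"
  using ualg.scale_minus_left[of 1 x] by simp_all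

text \<open>Stated for arbitrary elements so that one computation covers both the positive and the
  negative root vectors.\<close>

locale g2_triple =
  fixes e1 e2 f1 f2 h1 h2 :: Ug
  assumes h_e: "comm h1 e1 = uscale 2 e1" "comm h1 e2 = uscale (-3) e2"
      "comm h2 e1 = uscale (-1) e1" "comm h2 e2 = uscale 2 e2"
    and e_f: "comm e1 f1 = h1" "comm e1 f2 = 0" "comm e2 f1 = 0" "comm e2 f2 = h2"
    and serre: "comm e1 (comm e1 (comm e1 (comm e1 e2))) = 0" "comm e2 (comm e2 e1) = 0"
begin

definition "x3 = comm e1 e2"
definition "x4 = comm e1 x3"
definition "x5 = comm e1 x4"
definition "x6 = comm e2 x5"

lemma h_x:
  "comm h1 x3 = uscale (-1) x3" "comm h1 x4 = x4" "comm h1 x5 = uscale 3 x5" "comm h1 x6 = 0"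
  "comm h2 x3 = x3" "comm h2 x4 = 0" "comm h2 x5 = uscale (-1) x5" "comm h2 x6 = x6"
proof -
  have *: "comm h (comm x y) = uscale (a + b) (comm x y)"
    if "comm h x = uscale a x" "comm h y = uscale b y" for h x y a b
    using that by (simp add: comm_jacobi[of h] uscale_comm ualg.scale_left_distrib)
  have 3: "comm h1 x3 = uscale (-1) x3" "comm h2 x3 = uscale 1 x3"
    using *[OF h_e(1,2)] *[OF h_e(3,4)] by (simp_all add: x3_def)
  have 4: "comm h1 x4 = uscale 1 x4" "comm h2 x4 = uscale 0 x4"
    using *[OF h_e(1) 3(1)] *[OF h_e(3) 3(2)] by (simp_all add: x4_def)
  have 5: "comm h1 x5 = uscale 3 x5" "comm h2 x5 = uscale (-1) x5"
    using *[OF h_e(1) 4(1)] *[OF h_e(3) 4(2)] by (simp_all add: x5_def)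
  have 6: "comm h1 x6 = uscale 0 x6" "comm h2 x6 = uscale 1 x6"
    using *[OF h_e(2) 5(1)] *[OF h_e(4) 5(2)] by (simp_all add: x6_def)
  show "comm h1 x3 = uscale (-1) x3" "comm h1 x4 = x4" "comm h1 x5 = uscale 3 x5" "comm h1 x6 = 0"
    "comm h2 x3 = x3" "comm h2 x4 = 0" "comm h2 x5 = uscale (-1) x5" "comm h2 x6 = x6"
    using 3 4 5 6 by (simp_all add: uscale_numeral)
qed

lemma double_zero: "x + x = 0 \<Longrightarrow> x = 0" for x :: Ug
  using ualg.scale_left_distrib[of 1 1 x] by (simp add: uscale_numeral)

lemma e_x:
  "comm e1 e2 = x3" "comm e1 x3 = x4" "comm e1 x4 = x5" "comm e1 x5 = 0" "comm e1 x6 = 0"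
  "comm e2 e1 = - x3" "comm e2 x3 = 0" "comm e2 x4 = 0" "comm e2 x5 = x6" "comm e2 x6 = 0"
  and x_x: "comm x3 x4 = - x6" "comm x3 x5 = 0" "comm x3 x6 = 0" "comm x4 x5 = 0" "comm x4 x6 = 0"
    "comm x5 x6 = 0"
proof -
  show 1: "comm e1 e2 = x3" "comm e1 x3 = x4" "comm e1 x4 = x5" "comm e1 x5 = 0" "comm e2 x5 = x6"
    using serre by (simp_all add: x3_def x4_def x5_def x6_def)
  show 2: "comm e2 e1 = - x3"
    by (simp add: x3_def comm_swap[of e2 e1])
  then show 3: "comm e2 x3 = 0"
    using serre(2) by (simp add: comm_rules)
  show 5: "comm e2 x4 = 0"
    using comm_jacobi[of e1 e2 x3] by (simp add: 1 3 comm_rules)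
  have "comm e1 (comm e2 x4) = comm x3 x4 + x6"
    using comm_jacobi[of e1 e2 x4] by (simp add: 1)
  then show 6: "comm x3 x4 = - x6"
    using 5 by (simp add: comm_rules eq_neg_iff_add_eq_0)
  have 7: "comm e1 x6 = comm x3 x5"
    using comm_jacobi[of e1 e2 x5] by (simp add: 1 comm_rules)
  have "comm e1 (comm x3 x4) = comm x3 x5"
    using comm_jacobi[of e1 x3 x4] by (simp add: 1 comm_rules)
  \<comment> \<open>The bracket [e1, x6] equals [x3, x5] by the definition of x6, and -[x3, x5] by
    applying ad e1 to [x3, x4] = -x6. Hence twice [x3, x5] is zero.\<close>
  then have "- comm x3 x5 = comm x3 x5"
    using 6 7 by (simp add: comm_rules)
  then have "comm x3 x5 + comm x3 x5 = 0"
    unfolding add_eq_0_iff by (rule sym)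
  then show 8: "comm x3 x5 = 0"
    by (rule double_zero)
  show 9: "comm e1 x6 = 0" using 7 8 by simp
  have "comm e2 (comm x3 x4) = 0"
    using comm_jacobi[of e2 x3 x4] by (simp add: 3 5 comm_rules)
  then show 10: "comm e2 x6 = 0" using 6 by (simp add: comm_rules)
  show 11: "comm x3 x6 = 0"
    using comm_jacobi[of e1 e2 x6] by (simp add: 1 9 10 comm_rules)
  show "comm x4 x5 = 0"
    using comm_jacobi[of e1 x3 x5] by (simp add: 1 8 comm_rules)
  show 13: "comm x4 x6 = 0"
    using comm_jacobi[of e1 x3 x6] by (simp add: 1 9 11 comm_rules)
  show "comm x5 x6 = 0"
    using comm_jacobi[of e1 x4 x6] by (simp add: 1 9 13 comm_rules)
qed

text \<open>The vectors e2, x3, x4, x5 form a four-dimensional string for the sl_2 of e1, f1, h1;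
  this explains the lowering coefficients 3, 4, 3.\<close>

lemma f_x:
  "comm f1 e1 = - h1" "comm f1 e2 = 0" "comm f1 x3 = uscale 3 e2" "comm f1 x4 = uscale 4 x3"
  "comm f1 x5 = uscale 3 x4" "comm f1 x6 = 0"
  "comm f2 e1 = 0" "comm f2 e2 = - h2" "comm f2 x3 = - e1" "comm f2 x4 = 0"
  "comm f2 x5 = 0" "comm f2 x6 = x5"
proof -
  show 1: "comm f1 e1 = - h1" "comm f1 e2 = 0" "comm f2 e1 = 0" "comm f2 e2 = - h2"
    using e_f comm_swap[of f1 e1] comm_swap[of f1 e2] comm_swap[of f2 e1] comm_swap[of f2 e2] by simp_all
  have add: "uscale a x + uscale b x = uscale (a + b) x" for a b and x :: Ug
    by (simp add: ualg.scale_left_distrib)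
  show 2: "comm f1 x3 = uscale 3 e2"
    using comm_jacobi[of f1 e1 e2] by (simp add: 1 e_x h_e comm_rules)
  have "comm f1 x4 = uscale 1 x3 + uscale 3 x3"
    using comm_jacobi[of f1 e1 x3] by (simp add: 1 2 e_x h_x uscale_comm comm_rules uscale_numeral)
  then show 3: "comm f1 x4 = uscale 4 x3" unfolding add by simp
  have "comm f1 x5 = uscale (-1) x4 + uscale 4 x4"
    using comm_jacobi[of f1 e1 x4] by (simp add: 1 3 e_x h_x uscale_comm comm_rules uscale_numeral)
  then show 4: "comm f1 x5 = uscale 3 x4" unfolding add by simp
  show "comm f1 x6 = 0"
    using comm_jacobi[of f1 e2 x5] by (simp add: 1 4 e_x uscale_comm comm_rules)
  show 5: "comm f2 x3 = - e1"
    using comm_jacobi[of f2 e1 e2] comm_swap[of e1 h2] h_e(3) by (simp add: 1 e_x comm_rules uscale_numeral)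
  show 6: "comm f2 x4 = 0"
    using comm_jacobi[of f2 e1 x3] by (simp add: 1 5 e_x comm_rules)
  show 7: "comm f2 x5 = 0"
    using comm_jacobi[of f2 e1 x4] by (simp add: 1 6 e_x comm_rules)
  show "comm f2 x6 = x5"
    using comm_jacobi[of f2 e2 x5] by (simp add: 1 7 e_x h_x comm_rules uscale_numeral)
qed

end

abbreviation (input) "ue i \<equiv> ugen (Xp i)"
abbreviation (input) "uf i \<equiv> ugen (Xm i)"
abbreviation (input) "uh i \<equiv> ugen (Hg i)"

lemma ugen_relations:
  shows "comm (uh i) (uh j) = 0"
    and "comm (uh i) (ue j) = uscale (of_int (cartan i j)) (ue j)"
    and "comm (uh i) (uf j) = uscale (- of_int (cartan i j)) (uf j)"
    and "comm (ue i) (uf j) = (if i = j then uh i else 0)"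
    and "comm (ue Short) (comm (ue Short) (comm (ue Short) (comm (ue Short) (ue Long)))) = 0"
    and "comm (ue Long) (comm (ue Long) (ue Short)) = 0"
    and "comm (uf Short) (comm (uf Short) (comm (uf Short) (comm (uf Short) (uf Long)))) = 0"
    and "comm (uf Long) (comm (uf Long) (uf Short)) = 0"
proof -
  have rel: "abs_ualg x = 0" if "x \<in> crels" for x :: "gword alg"
    using that by (simp add: zero_ualg_def ualg.abs_eq_iff cideal_def two_sided_ideal_base)
  have "comm (letter (Hg i)) (letter (Hg j)) \<in> crels"
    "comm (letter (Hg i)) (letter (Xp j)) - cst (of_int (cartan i j)) * letter (Xp j) \<in> crels"
    "comm (letter (Hg i)) (letter (Xm j)) + cst (of_int (cartan i j)) * letter (Xm j) \<in> crels"
    "comm (letter (Xp i)) (letter (Xm j)) - (if i = j then letter (Hg i) else 0) \<in> crels" for i j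
    unfolding crels_gword_def by blast+
  note r = this[THEN rel]
  have a: "comm (ugen g) (ugen h) = abs_ualg (comm (letter g) (letter h))" for g h
    by (simp add: ugen_def comm_ugen)
  show "comm (uh i) (uh j) = 0"
    using r(1)[of i j] by (simp add: a)
  show "comm (uh i) (ue j) = uscale (of_int (cartan i j)) (ue j)"
    using r(2)[of i j] by (simp add: ugen_def comm_ugen uscale.abs_eq flip: minus_ualg.abs_eq)
  show "comm (uh i) (uf j) = uscale (- of_int (cartan i j)) (uf j)"
  proof -
    have "comm (uh i) (uf j) + uscale (of_int (cartan i j)) (uf j) = 0"
      using r(3)[of i j] by (simp add: ugen_def comm_ugen uscale.abs_eq flip: plus_ualg.abs_eq)
    then show ?thesis by (simp add: eq_neg_iff_add_eq_0)
  qed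
  show "comm (ue i) (uf j) = (if i = j then uh i else 0)"
  proof (cases "i = j")
    case True
    then show ?thesis
      using r(4)[of i i] by (simp add: ugen_def comm_ugen flip: minus_ualg.abs_eq)
  next
    case False
    then show ?thesis
      using r(4)[of i j] by (simp add: ugen_def comm_ugen)
  qed
  have s: "cserre (Xp Short) (Xp Long) 4 \<in> crels" "cserre (Xp Long) (Xp Short) 2 \<in> crels"
    "cserre (Xm Short) (Xm Long) 4 \<in> crels" "cserre (Xm Long) (Xm Short) 2 \<in> crels"
  proof -
    have "cserre (x i) (x j) (nat (1 - cartan i j)) \<in> crels" if "i \<noteq> j" "x = Xp \<or> x = Xm" for i j x
      using that unfolding crels_gword_def by blast
    from this[of Short Long Xp] this[of Long Short Xp] this[of Short Long Xm] this[of Long Short Xm]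
    show "cserre (Xp Short) (Xp Long) 4 \<in> crels" "cserre (Xp Long) (Xp Short) 2 \<in> crels"
      "cserre (Xm Short) (Xm Long) 4 \<in> crels" "cserre (Xm Long) (Xm Short) 2 \<in> crels" by simp_all
  qed
  note s' = s[THEN rel, unfolded cserre_comm comm_ugen[symmetric] ugen_def[symmetric]]
  show "comm (ue Short) (comm (ue Short) (comm (ue Short) (comm (ue Short) (ue Long)))) = 0"
    "comm (ue Long) (comm (ue Long) (ue Short)) = 0"
    "comm (uf Short) (comm (uf Short) (comm (uf Short) (comm (uf Short) (uf Long)))) = 0"
    "comm (uf Long) (comm (uf Long) (uf Short)) = 0"
    using s' by simp_all
qed

interpretation P: g2_triple "ue Short" "ue Long" "uf Short" "uf Long" "uh Short" "uh Long"
  by unfold_locales (simp_all add: ugen_relations)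

text \<open>The image under the Chevalley involution, which exchanges e_i with f_i and negates
  h_i.\<close>

interpretation N: g2_triple "uf Short" "uf Long" "ue Short" "ue Long" "- uh Short" "- uh Long"
  using comm_swap[of "uf Short" "ue Short"] comm_swap[of "uf Short" "ue Long"]
    comm_swap[of "uf Long" "ue Short"] comm_swap[of "uf Long" "ue Long"]
  by unfold_locales (simp_all add: ugen_relations comm_rules)

text \<open>The final case also catches all non-roots, so every value lies in
  \<open>g2\<close>.\<close>

definition rv :: "int \<times> int \<Rightarrow> Ug" where
  "rv \<nu> = (if \<nu> = (1, 0) then ue Short else if \<nu> = (0, 1) then ue Long else if \<nu> = (1, 1) then P.x3
    else if \<nu> = (2, 1) then P.x4 else if \<nu> = (3, 1) then P.x5 else if \<nu> = (3, 2) then P.x6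
    else if \<nu> = (-1, 0) then uf Short else if \<nu> = (0, -1) then uf Long else if \<nu> = (-1, -1) then N.x3
    else if \<nu> = (-2, -1) then N.x4 else if \<nu> = (-3, -1) then N.x5 else N.x6)"

definition positive :: "(int \<times> int) set" where
  "positive = {(1, 0), (0, 1), (1, 1), (2, 1), (3, 1), (3, 2)}"

definition roots :: "(int \<times> int) set" where
  "roots = positive \<union> uminus ` positive"

lemma roots_eq: "roots = {(1, 0), (0, 1), (1, 1), (2, 1), (3, 1), (3, 2),
    (-1, 0), (0, -1), (-1, -1), (-2, -1), (-3, -1), (-3, -2)}"
  unfolding roots_def positive_def by auto

definition wgt :: "int \<times> int \<Rightarrow> node \<Rightarrow> complex" where
  "wgt \<nu> i = of_int (fst \<nu> * cartan i Short + snd \<nu> * cartan i Long)"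

lemma root_space_eq: "root_space \<nu> = {x \<in> g2. \<forall>i. comm (uh i) x = uscale (wgt \<nu> i) x}"
  by (simp add: root_space_def wgt_def)

lemma wgt_inj: "wgt \<mu> = wgt \<nu> \<Longrightarrow> \<mu> = \<nu>"
proof -
  assume "wgt \<mu> = wgt \<nu>"
  then have "wgt \<mu> i = wgt \<nu> i" for i by simp
  from this[of Short] this[of Long]
  have "2 * fst \<mu> - 3 * snd \<mu> = 2 * fst \<nu> - 3 * snd \<nu>" "2 * snd \<mu> - fst \<mu> = 2 * snd \<nu> - fst \<nu>"
    unfolding wgt_def of_int_eq_iff by simp_all
  then show "\<mu> = \<nu>" by (intro prod_eqI) linarith+
qed

lemma rv_simps:
  "rv (1, 0) = ue Short" "rv (0, 1) = ue Long" "rv (1, 1) = P.x3" "rv (2, 1) = P.x4"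
  "rv (3, 1) = P.x5" "rv (3, 2) = P.x6"
  "rv (-1, 0) = uf Short" "rv (0, -1) = uf Long" "rv (-1, -1) = N.x3" "rv (-2, -1) = N.x4"
  "rv (-3, -1) = N.x5" "rv (-3, -2) = N.x6"
  by (simp_all add: rv_def)

lemma comm_H_rv: "\<nu> \<in> roots \<Longrightarrow> comm (uh i) (rv \<nu>) = uscale (wgt \<nu> i) (rv \<nu>)"
proof -
  have N: "comm (uh i) y = - comm (- uh i) y" for i y
    by (simp add: comm_rules)
  have "comm (uh Short) N.x3 = N.x3" "comm (uh Short) N.x4 = - N.x4"
    "comm (uh Short) N.x5 = uscale (-3) N.x5" "comm (uh Short) N.x6 = 0"
    "comm (uh Long) N.x3 = - N.x3" "comm (uh Long) N.x4 = 0"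
    "comm (uh Long) N.x5 = N.x5" "comm (uh Long) N.x6 = - N.x6"
    by (simp_all only: N N.h_x) (simp_all add: uscale_numeral)
  then have *: "\<forall>i. \<forall>\<nu>\<in>roots. comm (uh i) (rv \<nu>) = uscale (wgt \<nu> i) (rv \<nu>)"
    unfolding roots_eq ball_simps rv_simps
    using P.h_x by (intro allI conjI TrueI; case_tac i; simp add: wgt_def ugen_relations uscale_numeral)
  then show "\<nu> \<in> roots \<Longrightarrow> comm (uh i) (rv \<nu>) = uscale (wgt \<nu> i) (rv \<nu>)" by blast
qed

section \<open>The root space decomposition\<close>

definition g2_basis :: "Ug set" where
  "g2_basis = insert (uh Short) (insert (uh Long) (rv ` roots))"

lemma g2_basis_eq: "g2_basis = {uh Short, uh Long, ue Short, ue Long, P.x3, P.x4, P.x5, P.x6,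
    uf Short, uf Long, N.x3, N.x4, N.x5, N.x6}"
  by (simp add: g2_basis_def roots_eq rv_simps)

lemma subspace_g2: "ualg.subspace g2"
  by (rule ualg.subspaceI) (auto intro: g2.intros)

lemma rv_g2: "rv \<nu> \<in> g2"
proof -
  have 3: "P.x3 \<in> g2" "N.x3 \<in> g2" unfolding P.x3_def N.x3_def by (intro g2.bracket g2.gen)+
  have 4: "P.x4 \<in> g2" "N.x4 \<in> g2" unfolding P.x4_def N.x4_def by (intro g2.bracket g2.gen 3)+
  have 5: "P.x5 \<in> g2" "N.x5 \<in> g2" unfolding P.x5_def N.x5_def by (intro g2.bracket g2.gen 4)+
  have 6: "P.x6 \<in> g2" "N.x6 \<in> g2" unfolding P.x6_def N.x6_def by (intro g2.bracket g2.gen 5)+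
  show ?thesis using 3 4 5 6 by (simp add: rv_def g2.gen)
qed

lemma comm_gen_basis:
  assumes "b \<in> g2_basis"
  shows "comm (ugen g) b \<in> ualg.span g2_basis"
proof -
  define S where "S = ualg.span g2_basis"
  have base: "x \<in> S" if "x \<in> g2_basis" for x
    unfolding S_def using that by (rule ualg.span_base)
  have bs: "uh i \<in> S" "ue i \<in> S" "uf i \<in> S" "P.x3 \<in> S" "P.x4 \<in> S" "P.x5 \<in> S" "P.x6 \<in> S"
    "N.x3 \<in> S" "N.x4 \<in> S" "N.x5 \<in> S" "N.x6 \<in> S" for i
    by (cases i; rule base; simp add: g2_basis_eq)+
  have closed: "0 \<in> S" "x \<in> S \<Longrightarrow> - x \<in> S" "x \<in> S \<Longrightarrow> uscale c x \<in> S" for x c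
    unfolding S_def by (auto intro: ualg.span_zero ualg.span_neg ualg.span_scale)
  have swap: "comm (ue i) (uh j) = - comm (uh j) (ue i)" "comm (uf i) (uh j) = - comm (uh j) (uf i)" for i j
    by (rule comm_swap)+
  have H: "comm (uh i) x \<in> S" if x: "x \<in> g2_basis" for i x
  proof -
    consider j where "x = uh j" | \<nu> where "\<nu> \<in> roots" "x = rv \<nu>"
      using x unfolding g2_basis_def by blast
    then show ?thesis
      by cases (use base[OF x] in \<open>simp_all add: ugen_relations comm_H_rv closed\<close>)
  qed
  have E: "comm (ue i) x \<in> S" if x: "x \<in> g2_basis" for i x
    using x unfolding g2_basis_eq
    by (cases i) (elim insertE emptyE; simp add: P.e_x P.e_f N.f_x swap ugen_relations comm_rules closed bs)+
  have F: "comm (uf i) x \<in> S" if x: "x \<in> g2_basis" for i x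
    using x unfolding g2_basis_eq
    by (cases i) (elim insertE emptyE; simp add: N.e_x N.e_f P.f_x swap ugen_relations comm_rules closed bs)+
  show ?thesis using assms H E F unfolding S_def[symmetric] by (cases g) simp_all
qed

text \<open>The induction claim is strengthened: x lies in the span and ad x preserves it. The
  second half passes to brackets by the Jacobi identity.\<close>

lemma g2_eq_span: "g2 = ualg.span g2_basis"
proof
  let ?S = "ualg.span g2_basis"
  have stable: "comm x s \<in> ?S" if "s \<in> ?S" "\<And>b. b \<in> g2_basis \<Longrightarrow> comm x b \<in> ?S" for x s
    using that(1)
  proof (induction rule: ualg.span_induct_alt)
    case (step c b y)
    then show ?case
      using that(2) by (simp add: comm_rules uscale_comm ualg.span_add ualg.span_scale)
  qed (simp add: comm_rules ualg.span_zero)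
  have "x \<in> ?S \<and> (\<forall>s\<in>?S. comm x s \<in> ?S)" if "x \<in> g2" for x
    using that
  proof induction
    case (gen g)
    have "ugen g \<in> g2_basis"
    proof (cases g)
      case (Xp i) then show ?thesis by (cases i) (simp_all add: g2_basis_eq)
    next
      case (Xm i) then show ?thesis by (cases i) (simp_all add: g2_basis_eq)
    next
      case (Hg i) then show ?thesis by (cases i) (simp_all add: g2_basis_eq)
    qed
    then show ?case using stable comm_gen_basis by (auto intro: ualg.span_base)
  next
    case (bracket x y)
    have "comm (comm x y) s = comm x (comm y s) - comm y (comm x s)" for s
      using comm_jacobi[of x y s] by simp
    then show ?case using bracket by (auto intro: ualg.span_diff)
  qed (auto simp: comm_rules uscale_comm intro: ualg.span_zero ualg.span_add ualg.span_scale)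
  then show "g2 \<subseteq> ?S" by blast
  show "?S \<subseteq> g2"
    by (rule ualg.span_minimal[OF _ subspace_g2]) (auto simp: g2_basis_def rv_g2 g2.gen)
qed

text \<open>Some H_i separates a given weight from the newly inserted one. Applying ad H_i minus the
  inserted eigenvalue removes that summand and multiplies the given one by a nonzero number.\<close>

lemma weight_vectors_independent:
  assumes "finite A" "\<And>\<mu> i. \<mu> \<in> A \<Longrightarrow> comm (uh i) (F \<mu>) = uscale (wgt \<mu> i) (F \<mu>)"
    and "(\<Sum>\<mu>\<in>A. F \<mu>) = 0" "\<mu> \<in> A"
  shows "F \<mu> = 0"
  using assms
proof (induction A arbitrary: F \<mu> rule: finite_induct)
  case (insert \<nu> A)
  have comm_sum: "comm x (\<Sum>\<mu>\<in>A. G \<mu>) = (\<Sum>\<mu>\<in>A. comm x (G \<mu>))" for x :: Ug and G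
    by (induction A rule: infinite_finite_induct) (simp_all add: comm_rules)
  have zero: "F \<mu> = 0" if "\<mu> \<in> A" for \<mu>
  proof -
    have "\<mu> \<noteq> \<nu>" using that insert.hyps by blast
    then obtain i where i: "wgt \<mu> i \<noteq> wgt \<nu> i" using wgt_inj by blast
    define G where "G \<mu> = uscale (wgt \<mu> i - wgt \<nu> i) (F \<mu>)" for \<mu>
    have "(\<Sum>\<mu>\<in>A. F \<mu>) = - F \<nu>"
      using insert.prems(2) insert.hyps by (simp add: eq_neg_iff_add_eq_0 add.commute)
    then have "(\<Sum>\<mu>\<in>A. uscale (wgt \<mu> i) (F \<mu>)) = - uscale (wgt \<nu> i) (F \<nu>)"
      using comm_sum[of "uh i" F] insert.prems(1) by (simp add: comm_rules)
    moreover have "(\<Sum>\<mu>\<in>A. uscale (wgt \<nu> i) (F \<mu>)) = - uscale (wgt \<nu> i) (F \<nu>)"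
      using \<open>(\<Sum>\<mu>\<in>A. F \<mu>) = - F \<nu>\<close> by (simp flip: ualg.scale_sum_right)
    ultimately have "(\<Sum>\<mu>\<in>A. G \<mu>) = 0"
      by (simp add: G_def ualg.scale_left_diff_distrib sum_subtractf)
    moreover have "comm (uh j) (G \<kappa>) = uscale (wgt \<kappa> j) (G \<kappa>)" if "\<kappa> \<in> A" for j \<kappa>
      using insert.prems(1)[of \<kappa> j] that by (simp add: G_def uscale_comm mult.commute)
    ultimately have "G \<mu> = 0" using insert.IH that by blast
    then show ?thesis using i by (simp add: G_def)
  qed
  show ?case
  proof (cases "\<mu> = \<nu>")
    case True
    then show ?thesis using insert.prems(2) insert.hyps zero by simp
  qed (use zero insert.prems(3) in auto)
qed simp

lemma weight_decomposition:
  assumes "x \<in> g2"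
  obtains F where "x = (\<Sum>\<mu>\<in>insert 0 roots. F \<mu>)" "F 0 \<in> ualg.span {uh Short, uh Long}"
    "\<And>\<mu>. \<mu> \<in> roots \<Longrightarrow> F \<mu> \<in> range (\<lambda>c. uscale c (rv \<mu>))"
proof -
  have fin: "finite roots" and 0: "0 \<notin> roots" by (simp_all add: roots_eq zero_prod_def)
  have "\<exists>F. x = (\<Sum>\<mu>\<in>insert 0 roots. F \<mu>) \<and> F 0 \<in> ualg.span {uh Short, uh Long}
      \<and> (\<forall>\<mu>\<in>roots. F \<mu> \<in> range (\<lambda>c. uscale c (rv \<mu>)))"
    using assms unfolding g2_eq_span
  proof (induction rule: ualg.span_induct_alt)
    case base
    show ?case by (rule exI[of _ "\<lambda>_. 0"]) (auto simp: ualg.span_zero intro: range_eqI[of _ _ 0])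
  next
    case (step c b y)
    then obtain F where F: "y = (\<Sum>\<mu>\<in>insert 0 roots. F \<mu>)" "F 0 \<in> ualg.span {uh Short, uh Long}"
      "\<forall>\<mu>\<in>roots. F \<mu> \<in> range (\<lambda>c. uscale c (rv \<mu>))" by blast
    obtain \<nu> where \<nu>: "\<nu> = 0 \<and> b \<in> {uh Short, uh Long} \<or> \<nu> \<in> roots \<and> b = rv \<nu>"
    proof -
      consider "b \<in> {uh Short, uh Long}" | \<kappa> where "\<kappa> \<in> roots" "b = rv \<kappa>"
        using step(1) unfolding g2_basis_def by blast
      then show thesis using that by cases blast+
    qed
    define G where "G \<mu> = (if \<mu> = \<nu> then uscale c b else 0) + F \<mu>" for \<mu>
    have "\<nu> \<in> insert 0 roots" using \<nu> by auto
    then have "uscale c b + y = (\<Sum>\<mu>\<in>insert 0 roots. G \<mu>)"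
      using fin 0 unfolding G_def sum.distrib F(1) by simp
    moreover have "G 0 \<in> ualg.span {uh Short, uh Long}"
      using F(2) \<nu> 0 by (auto simp: G_def intro!: ualg.span_add ualg.span_scale intro: ualg.span_base)
    moreover have "G \<mu> \<in> range (\<lambda>c. uscale c (rv \<mu>))" if m: "\<mu> \<in> roots" for \<mu>
    proof -
      obtain d where "F \<mu> = uscale d (rv \<mu>)" using F(3) m by blast
      then have "G \<mu> = uscale ((if \<mu> = \<nu> then c else 0) + d) (rv \<mu>)"
        using m \<nu> 0 by (auto simp: G_def ualg.scale_left_distrib)
      then show ?thesis by blast
    qed
    ultimately show ?case by blast
  qed
  then show thesis using that by blast
qed

lemma root_space_line:
  assumes "\<nu> \<noteq> 0"
  shows "root_space \<nu> = (if \<nu> \<in> roots then range (\<lambda>c. uscale c (rv \<nu>)) else {0})"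
proof
  have fin: "finite roots" and 0: "0 \<notin> roots" by (simp_all add: roots_eq zero_prod_def)
  show "(if \<nu> \<in> roots then range (\<lambda>c. uscale c (rv \<nu>)) else {0}) \<subseteq> root_space \<nu>"
    by (auto simp: root_space_eq uscale_comm comm_H_rv mult.commute comm_rules intro: g2.intros rv_g2)
  show "root_space \<nu> \<subseteq> (if \<nu> \<in> roots then range (\<lambda>c. uscale c (rv \<nu>)) else {0})"
  proof
    fix x assume x: "x \<in> root_space \<nu>"
    then have "x \<in> g2" by (simp add: root_space_eq)
    then obtain F where F: "x = (\<Sum>\<mu>\<in>insert 0 roots. F \<mu>)" "F 0 \<in> ualg.span {uh Short, uh Long}"
      "\<And>\<mu>. \<mu> \<in> roots \<Longrightarrow> F \<mu> \<in> range (\<lambda>c. uscale c (rv \<mu>))"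
      using weight_decomposition by blast
    \<comment> \<open>The decomposition of x with x itself subtracted at weight \<nu>: a vanishing
      sum of weight vectors, so x equals its component of weight \<nu>.\<close>
    define G where "G \<mu> = (if \<mu> \<in> insert 0 roots then F \<mu> else 0) - (if \<mu> = \<nu> then x else 0)" for \<mu>
    let ?A = "insert \<nu> (insert 0 roots)"
    have "(\<Sum>\<mu>\<in>?A. G \<mu>) = (\<Sum>\<mu>\<in>?A. if \<mu> \<in> insert 0 roots then F \<mu> else 0) - x"
      using fin unfolding G_def sum_subtractf by simp
    also have "(\<Sum>\<mu>\<in>?A. if \<mu> \<in> insert 0 roots then F \<mu> else 0) = (\<Sum>\<mu>\<in>insert 0 roots. F \<mu>)"
      using fin by (intro sum.mono_neutral_cong_right) auto
    finally have "(\<Sum>\<mu>\<in>?A. G \<mu>) = 0" using F(1) by simp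
    moreover have "comm (uh i) (G \<mu>) = uscale (wgt \<mu> i) (G \<mu>)" if "\<mu> \<in> ?A" for \<mu> i
    proof -
      have "comm (uh i) (F 0) = 0"
        using F(2)
      proof (induction rule: ualg.span_induct_alt)
        case (step c b y)
        then show ?case by (auto simp: comm_rules uscale_comm ugen_relations)
      qed (simp add: comm_rules)
      then have "comm (uh i) (F \<mu>) = uscale (wgt \<mu> i) (F \<mu>)" if "\<mu> \<in> insert 0 roots"
        using F(3)[of \<mu>] that comm_H_rv[of \<mu> i] by (auto simp: wgt_def uscale_comm mult.commute)
      moreover have "comm (uh i) x = uscale (wgt \<nu> i) x" using x by (simp add: root_space_eq)
      ultimately show ?thesis
        by (auto simp: G_def comm_rules ualg.scale_right_diff_distrib)
    qed
    ultimately have "G \<nu> = 0"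
      using weight_vectors_independent[of ?A G \<nu>] fin by blast
    then show "x \<in> (if \<nu> \<in> roots then range (\<lambda>c. uscale c (rv \<nu>)) else {0})"
      using F(3)[of \<nu>] assms by (auto simp: G_def split: if_splits)
  qed
qed

text \<open>Brackets with simple root vectors of the opposite sign lead from each root vector down
  to a nonzero multiple of one already known to be nonzero, starting from the H_i.\<close>

lemma rv_nonzero: "\<nu> \<in> roots \<Longrightarrow> rv \<nu> \<noteq> 0"
proof -
  have H: "uh Short \<noteq> 0" "uh Long \<noteq> 0" by (rule ugen_Hg_nonzero)+
  have *: "x \<noteq> 0" if "comm y x \<noteq> 0" for x y :: Ug
    using that by (auto simp: comm_rules)
  have 1: "ue Short \<noteq> 0" "uf Short \<noteq> 0" "ue Long \<noteq> 0" "uf Long \<noteq> 0"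
    using *[of "uf Short" "ue Short"] *[of "ue Short" "uf Short"] *[of "uf Long" "ue Long"]
      *[of "ue Long" "uf Long"] H P.f_x N.f_x by auto
  have 3: "P.x3 \<noteq> 0" "N.x3 \<noteq> 0"
    using *[of "uf Short" P.x3] *[of "ue Short" N.x3] 1 P.f_x N.f_x by auto
  have 4: "P.x4 \<noteq> 0" "N.x4 \<noteq> 0"
    using *[of "uf Short" P.x4] *[of "ue Short" N.x4] 3 P.f_x N.f_x by auto
  have 5: "P.x5 \<noteq> 0" "N.x5 \<noteq> 0"
    using *[of "uf Short" P.x5] *[of "ue Short" N.x5] 4 P.f_x N.f_x by auto
  have 6: "P.x6 \<noteq> 0" "N.x6 \<noteq> 0"
    using *[of "uf Long" P.x6] *[of "ue Long" N.x6] 5 P.f_x N.f_x by auto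
  show "\<nu> \<in> roots \<Longrightarrow> rv \<nu> \<noteq> 0"
    using 1 3 4 5 6 by (auto simp: roots_eq rv_simps)
qed

lemma pos_roots_eq: "pos_roots = positive"
proof -
  have 0: "0 \<notin> roots" by (simp add: roots_eq zero_prod_def)
  have line: "root_space \<nu> \<noteq> {0} \<longleftrightarrow> \<nu> \<in> roots" if \<nu>: "\<nu> \<noteq> 0" for \<nu>
  proof (cases "\<nu> \<in> roots")
    case True
    then have "rv \<nu> \<in> root_space \<nu>"
      unfolding root_space_line[OF \<nu>] by (auto intro: range_eqI[of _ _ 1])
    then show ?thesis using True rv_nonzero[OF True] by blast
  qed (simp add: root_space_line[OF \<nu>])
  have "pos_roots = {\<nu> \<in> roots. fst \<nu> \<ge> 0 \<and> snd \<nu> \<ge> 0}"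
  proof (rule set_eqI)
    fix \<nu>
    show "\<nu> \<in> pos_roots \<longleftrightarrow> \<nu> \<in> {\<nu> \<in> roots. fst \<nu> \<ge> 0 \<and> snd \<nu> \<ge> 0}"
    proof (cases "\<nu> = 0")
      case False
      then show ?thesis using line[OF False] by (simp only: pos_roots_def mem_Collect_eq) blast
    qed (simp add: pos_roots_def 0)
  qed
  also have "\<dots> = positive"
    unfolding roots_def positive_def by auto
  finally show ?thesis .
qed

lemma root_vector_scale:
  assumes "\<nu> \<in> roots"
  obtains k where "k \<noteq> 0" "root_vector \<nu> = uscale k (rv \<nu>)"
proof -
  have "\<nu> \<noteq> 0" using assms by (auto simp: roots_eq zero_prod_def)
  then have line: "root_space \<nu> = range (\<lambda>c. uscale c (rv \<nu>))"
    using assms root_space_line by simp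
  have "\<exists>x. x \<in> root_space \<nu> \<and> x \<noteq> 0"
    using rv_nonzero[OF assms] unfolding line by (intro exI[of _ "rv \<nu>"]) (auto intro: range_eqI[of _ _ 1])
  then have "root_vector \<nu> \<in> root_space \<nu> \<and> root_vector \<nu> \<noteq> 0"
    unfolding root_vector_def by (rule someI_ex)
  then show thesis using that unfolding line by auto
qed

section \<open>Tensor products of the classical algebra\<close>

lemma uleg1_hom:
  shows "uleg1 (x + y) = uleg1 x + uleg1 y" "uleg1 (x - y) = uleg1 x - uleg1 y"
    "uleg1 (x * y) = uleg1 x * uleg1 y" "uleg1 1 = 1" "uleg1 (uscale c x) = uscale c (uleg1 x)"
  by (use abs_ualg_surj[of x] abs_ualg_surj[of y] in
    \<open>auto simp: uleg1.abs_eq plus_ualg.abs_eq minus_ualg.abs_eq times_ualg.abs_eq uscale.abs_eq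
      one_ualg_def leg1_add leg1_diff leg1_mult leg_cst leg_1\<close>)+

lemma uleg2_hom:
  shows "uleg2 (x + y) = uleg2 x + uleg2 y" "uleg2 (x - y) = uleg2 x - uleg2 y"
    "uleg2 (x * y) = uleg2 x * uleg2 y" "uleg2 1 = 1" "uleg2 (uscale c x) = uscale c (uleg2 x)"
  by (use abs_ualg_surj[of x] abs_ualg_surj[of y] in
    \<open>auto simp: uleg2.abs_eq plus_ualg.abs_eq minus_ualg.abs_eq times_ualg.abs_eq uscale.abs_eq
      one_ualg_def leg2_add leg2_diff leg2_mult leg_cst leg_1\<close>)+

lemma uleg_commute: "uleg2 y * uleg1 x = uleg1 x * uleg2 y"
proof -
  obtain x' y' where "x = abs_ualg x'" "y = abs_ualg y'" using abs_ualg_surj by metis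
  then show ?thesis by (simp add: uleg1.abs_eq uleg2.abs_eq times_ualg.abs_eq leg_commute)
qed

lemma wedge_bilinear:
  "wedge (x + y) z = wedge x z + wedge y z" "wedge z (x + y) = wedge z x + wedge z y"
  "wedge (uscale c x) y = uscale c (wedge x y)" "wedge x (uscale c y) = uscale c (wedge x y)"
  by (simp_all add: wedge_def utensor_def uleg1_hom uleg2_hom uscale_mult algebra_simps
      ualg.scale_right_diff_distrib)

lemma wedge_skew: "wedge y x = - wedge x y"
  by (simp add: wedge_def)

lemma wedge_uminus: "wedge (- x) y = - wedge x y" "wedge x (- y) = - wedge x y"
  using wedge_bilinear(3)[of "-1" x y] wedge_bilinear(4)[of x "-1" y]
  by (simp_all add: ualg.scale_minus_left)

lemma wedge_0: "wedge 0 x = 0" "wedge x 0 = 0"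
  using wedge_bilinear(3)[of 0 0 x] wedge_bilinear(4)[of x 0 0] by simp_all

definition diag :: "Ug \<Rightarrow> (gword \<times> gword) ualg" where
  "diag x = x \<otimes>\<^sub>U 1 + 1 \<otimes>\<^sub>U x"

lemma diag_eq: "diag x = uleg1 x + uleg2 x"
  by (simp add: diag_def utensor_def uleg1_hom uleg2_hom)

lemma cobracket_eq: "cobracket x = comm (diag x) rmatrix"
  by (simp add: cobracket_def diag_def)

lemma diag_linear: "diag (x + y) = diag x + diag y" "diag (uscale c x) = uscale c (diag x)"
  by (simp_all add: diag_eq uleg1_hom uleg2_hom ualg.scale_right_distrib)

lemma diag_tensor: "comm (diag x) (a \<otimes>\<^sub>U b) = comm x a \<otimes>\<^sub>U b + a \<otimes>\<^sub>U comm x b"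
proof -
  have "uleg2 x * (uleg1 a * z) = uleg1 a * (uleg2 x * z)" "uleg2 b * (uleg1 x) = uleg1 x * uleg2 b" for z
    by (simp_all add: uleg_commute flip: mult.assoc)
  then show ?thesis
    by (simp add: comm_def utensor_def diag_eq uleg1_hom uleg2_hom algebra_simps)
qed

lemma diag_wedge: "comm (diag x) (wedge a b) = wedge (comm x a) b + wedge a (comm x b)"
  unfolding wedge_def by (simp only: comm_rules diag_tensor) (simp add: algebra_simps)

lemma diag_comm: "diag (comm x y) = comm (diag x) (diag y)"
  by (simp add: comm_def diag_eq uleg1_hom uleg2_hom algebra_simps uleg_commute)

lemma cobracket_linear:
  "cobracket (x + y) = cobracket x + cobracket y" "cobracket (uscale c x) = uscale c (cobracket x)"
  "cobracket 0 = 0"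
  using diag_linear(2)[of 0 0] by (simp_all add: cobracket_eq diag_linear comm_rules uscale_comm)

lemma cobracket_cocycle:
  "cobracket (comm x y) = comm (diag x) (cobracket y) - comm (diag y) (cobracket x)"
  using comm_jacobi[of "diag x" "diag y" rmatrix] by (simp add: cobracket_eq diag_comm)

section \<open>The Killing form\<close>

text \<open>The very basis that \<open>trace_on\<close> selects for \<open>g2\<close>, named so that
  its properties can be used.\<close>

definition g2_frame :: "Ug set" where
  "g2_frame = (SOME b. ualg.independent b \<and> ualg.span b = g2)"

lemma g2_frame: "ualg.independent g2_frame" "ualg.span g2_frame = g2" "finite g2_frame"
proof -
  have "\<exists>b. ualg.independent b \<and> ualg.span b = g2"
    using ualg.basis_exists[of g2] ualg.span_minimal[OF _ subspace_g2]
    by (metis subset_antisym)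
  then have *: "ualg.independent g2_frame \<and> ualg.span g2_frame = g2"
    unfolding g2_frame_def by (rule someI_ex)
  then show "ualg.independent g2_frame" "ualg.span g2_frame = g2" by simp_all
  have "finite g2_basis" by (simp add: g2_basis_eq)
  moreover have "g2_frame \<subseteq> ualg.span g2_basis"
    using * ualg.span_superset[of g2_frame] by (simp add: g2_eq_span)
  ultimately show "finite g2_frame"
    using * ualg.independent_span_bound by blast
qed

lemma trace_on_g2: "trace_on g2 f = (\<Sum>v\<in>g2_frame. ualg.representation g2_frame (f v) v)"
  by (simp add: trace_on_def Let_def g2_frame_def)

lemma frame_g2: "v \<in> g2_frame \<Longrightarrow> v \<in> g2"
  using ualg.span_base[of v g2_frame] g2_frame(2) by blast

lemma trace_on_g2_linear:
  assumes "\<And>v. v \<in> g2 \<Longrightarrow> f v \<in> g2" "\<And>v. v \<in> g2 \<Longrightarrow> g v \<in> g2"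
  shows "trace_on g2 (\<lambda>v. f v + g v) = trace_on g2 f + trace_on g2 g"
    and "trace_on g2 (\<lambda>v. f v - g v) = trace_on g2 f - trace_on g2 g"
    and "trace_on g2 (\<lambda>v. uscale c (f v)) = c * trace_on g2 f"
  using assms frame_g2 g2_frame(2)
  by (simp_all add: trace_on_g2 ualg.representation_add[OF g2_frame(1)]
      ualg.representation_diff[OF g2_frame(1)] ualg.representation_scale[OF g2_frame(1)]
      sum.distrib sum_subtractf sum_distrib_left)

text \<open>In matrix entries both traces are the same double sum with the order of summation
  exchanged.\<close>

lemma trace_on_g2_comp:
  assumes f: "\<And>v. v \<in> g2 \<Longrightarrow> f v \<in> g2" "f 0 = 0" "\<And>x y. f (x + y) = f x + f y" "\<And>c x. f (uscale c x) = uscale c (f x)"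
    and g: "\<And>v. v \<in> g2 \<Longrightarrow> g v \<in> g2" "g 0 = 0" "\<And>x y. g (x + y) = g x + g y" "\<And>c x. g (uscale c x) = uscale c (g x)"
  shows "trace_on g2 (\<lambda>v. f (g v)) = trace_on g2 (\<lambda>v. g (f v))"
proof -
  let ?b = g2_frame and ?r = "ualg.representation g2_frame"
  have comp: "?r (f (g v)) w = (\<Sum>u\<in>?b. ?r (g v) u * ?r (f u) w)"
    if f: "\<And>v. v \<in> g2 \<Longrightarrow> f v \<in> g2" "f 0 = 0" "\<And>x y. f (x + y) = f x + f y" "\<And>c x. f (uscale c x) = uscale c (f x)"
      and gv: "g v \<in> g2" for f g :: "Ug \<Rightarrow> Ug" and v w
  proof -
    have sum: "f (\<Sum>u\<in>A. h u) = (\<Sum>u\<in>A. f (h u))" for h :: "Ug \<Rightarrow> Ug" and A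
      by (induction A rule: infinite_finite_induct) (simp_all add: f)
    have "g v = (\<Sum>u\<in>?b. uscale (?r (g v) u) u)"
      using ualg.sum_representation_eq[OF g2_frame(1) _ g2_frame(3) order.refl, of "g v"] gv g2_frame(2)
      by simp
    then have "f (g v) = f (\<Sum>u\<in>?b. uscale (?r (g v) u) u)"
      by (rule arg_cong)
    then have "f (g v) = (\<Sum>u\<in>?b. uscale (?r (g v) u) (f u))"
      by (simp only: sum f(4))
    moreover have "?r (\<Sum>u\<in>?b. uscale (?r (g v) u) (f u)) w = (\<Sum>u\<in>?b. ?r (g v) u * ?r (f u) w)"
    proof -
      have "uscale (?r (g v) u) (f u) \<in> ualg.span ?b" if "u \<in> ?b" for u
        using f(1)[OF frame_g2[OF that]] g2_frame(2) by (simp add: g2.scale)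
      moreover have "?r (uscale (?r (g v) u) (f u)) w = ?r (g v) u * ?r (f u) w" if "u \<in> ?b" for u
        using f(1)[OF frame_g2[OF that]] g2_frame(2)
        by (simp add: ualg.representation_scale[OF g2_frame(1)])
      ultimately show ?thesis
        by (simp add: ualg.representation_sum[OF g2_frame(1)])
    qed
    ultimately show ?thesis by simp
  qed
  have "trace_on g2 (\<lambda>v. f (g v)) = (\<Sum>v\<in>?b. \<Sum>u\<in>?b. ?r (g v) u * ?r (f u) v)"
    unfolding trace_on_g2 by (intro sum.cong refl comp[where f = f and g = g]) (simp_all add: f g frame_g2)
  also have "\<dots> = (\<Sum>u\<in>?b. \<Sum>v\<in>?b. ?r (f u) v * ?r (g v) u)"
    by (subst sum.swap) (simp add: mult.commute)
  also have "\<dots> = trace_on g2 (\<lambda>v. g (f v))"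
    unfolding trace_on_g2 by (intro sum.cong refl comp[where f = g and g = f, symmetric]) (simp_all add: f g frame_g2)
  finally show ?thesis .
qed

lemma killing_sym: "x \<in> g2 \<Longrightarrow> y \<in> g2 \<Longrightarrow> killing x y = killing y x"
  unfolding killing_def
  by (rule trace_on_g2_comp) (simp_all add: comm_rules uscale_comm g2.bracket)

lemma killing_scale:
  assumes "x \<in> g2" "y \<in> g2"
  shows "killing (uscale c x) y = c * killing x y" "killing x (uscale c y) = c * killing x y"
  unfolding killing_def using trace_on_g2_linear(3)[of "\<lambda>z. comm x (comm y z)" "\<lambda>z. z" c] assms
  by (simp_all add: uscale_comm g2.bracket)

lemma killing_uminus:
  assumes "x \<in> g2" "y \<in> g2"
  shows "killing (- x) y = - killing x y" "killing x (- y) = - killing x y"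
  using killing_scale[OF assms, of "-1"] by (simp_all add: ualg.scale_minus_left)

lemmas killing_linear = killing_scale killing_uminus

text \<open>By cyclicity tr(YXZ) = tr(XZY), hence tr(XYZ) - tr(YXZ) = tr(XYZ) - tr(XZY).\<close>

lemma killing_invariant:
  assumes "x \<in> g2" "y \<in> g2" "z \<in> g2"
  shows "killing (comm x y) z = killing x (comm y z)"
proof -
  let ?t = "\<lambda>f. trace_on g2 f"
  have cl: "comm a (comm b (comm c v)) \<in> g2" if "a \<in> g2" "b \<in> g2" "c \<in> g2" "v \<in> g2" for a b c v
    using that by (intro g2.bracket)
  have "killing (comm x y) z = ?t (\<lambda>v. comm x (comm y (comm z v)) - comm y (comm x (comm z v)))"
    unfolding killing_def by (intro arg_cong[of _ _ ?t] ext) (simp add: comm_jacobi[of x y])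
  also have "\<dots> = ?t (\<lambda>v. comm x (comm y (comm z v))) - ?t (\<lambda>v. comm y (comm x (comm z v)))"
    using cl assms by (intro trace_on_g2_linear) auto
  also have "?t (\<lambda>v. comm y (comm x (comm z v))) = ?t (\<lambda>v. comm x (comm z (comm y v)))"
    by (rule trace_on_g2_comp[of "comm y" "\<lambda>v. comm x (comm z v)"])
      (use assms in \<open>simp_all add: comm_rules uscale_comm g2.bracket\<close>)
  also have "?t (\<lambda>v. comm x (comm y (comm z v))) - ?t (\<lambda>v. comm x (comm z (comm y v)))
      = ?t (\<lambda>v. comm x (comm y (comm z v)) - comm x (comm z (comm y v)))"
    using cl assms by (intro trace_on_g2_linear[symmetric]) auto
  also have "\<dots> = killing x (comm y z)"
    unfolding killing_def by (intro arg_cong[of _ _ ?t] ext) (simp add: comm_jacobi[of y z] comm_rules)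
  finally show ?thesis .
qed

text \<open>Short and long simple roots are compared by computing K(H_1, H_2) in two ways. For the
  other roots invariance moves a simple root vector across, and the bracket tables supply signs and
  factors.\<close>

lemma killing_root_vectors:
  defines "k \<equiv> killing (ue Long) (uf Long)"
  shows "killing (rv (1, 0)) (rv (-1, 0)) = 3 * k" "killing (rv (0, 1)) (rv (0, -1)) = k"
    "killing (rv (1, 1)) (rv (-1, -1)) = - 3 * k" (is ?g3) "killing (rv (2, 1)) (rv (-2, -1)) = 12 * k" (is ?g4)
    "killing (rv (3, 1)) (rv (-3, -1)) = - 36 * k" (is ?g5) "killing (rv (3, 2)) (rv (-3, -2)) = 36 * k" (is ?g6)
proof -
  have m: "ugen g \<in> g2" "P.x3 \<in> g2" "P.x4 \<in> g2" "P.x5 \<in> g2" "P.x6 \<in> g2"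
    "N.x3 \<in> g2" "N.x4 \<in> g2" "N.x5 \<in> g2" "N.x6 \<in> g2" for g
    using rv_g2[of "(1, 1)"] rv_g2[of "(2, 1)"] rv_g2[of "(3, 1)"] rv_g2[of "(3, 2)"]
      rv_g2[of "(-1, -1)"] rv_g2[of "(-2, -1)"] rv_g2[of "(-3, -1)"] rv_g2[of "(-3, -2)"]
    by (simp_all add: rv_simps g2.gen)
  have step: "killing (comm x y) z = - killing y (comm x z)" if "x \<in> g2" "y \<in> g2" "z \<in> g2" for x y z
    using that killing_invariant[of y x z] by (simp add: comm_swap[of x y] killing_linear g2.bracket)
  have "killing (uh Short) (uh Long) = - killing (ue Short) (uf Short)"
    using killing_invariant[of "ue Short" "uf Short" "uh Long"] m
    by (simp add: P.e_f comm_swap[of "uf Short"] ugen_relations killing_linear uscale_numeral)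
  moreover have "killing (uh Long) (uh Short) = - 3 * k"
    using killing_invariant[of "ue Long" "uf Long" "uh Short"] m
    by (simp add: P.e_f comm_swap[of "uf Long"] ugen_relations killing_linear g2.scale k_def)
  ultimately show 1: "killing (rv (1, 0)) (rv (-1, 0)) = 3 * k"
    using killing_sym[of "uh Short" "uh Long"] m by (simp add: rv_simps)
  show "killing (rv (0, 1)) (rv (0, -1)) = k"
    by (simp add: rv_simps k_def)
  have 3: "killing P.x3 N.x3 = - 3 * k"
    using step[of "ue Short" "ue Long" N.x3] m by (simp add: P.e_x N.f_x killing_linear k_def)
  have 4: "killing P.x4 N.x4 = 12 * k"
    using step[of "ue Short" P.x3 N.x4] m 3 by (simp add: P.e_x N.f_x killing_linear)
  have 5: "killing P.x5 N.x5 = - 36 * k"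
    using step[of "ue Short" P.x4 N.x5] m 4 by (simp add: P.e_x N.f_x killing_linear)
  have 6: "killing P.x6 N.x6 = 36 * k"
    using step[of "ue Long" P.x5 N.x6] m 5 by (simp add: P.e_x N.f_x killing_linear)
  show ?g3 ?g4 ?g5 ?g6
    using 3 4 5 6 by (simp_all add: rv_simps)
qed

text \<open>The scalars relating \<open>root_vector\<close> to \<open>rv\<close> cancel in each
  summand, and all Killing values are multiples of k, so 1/k factors out.\<close>

lemma rmatrix_eq:
  defines "k \<equiv> killing (ue Long) (uf Long)"
  shows "rmatrix = uscale (1 / k) (uscale (1 / 3) (wedge (ue Short) (uf Short)) + wedge (ue Long) (uf Long)
    - uscale (1 / 3) (wedge P.x3 N.x3) + uscale (1 / 12) (wedge P.x4 N.x4)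
    - uscale (1 / 36) (wedge P.x5 N.x5) + uscale (1 / 36) (wedge P.x6 N.x6))" (is "_ = ?r")
proof -
  have scaled: "uscale (1 / killing (root_vector \<alpha>) (root_vector (- \<alpha>))) (wedge (root_vector \<alpha>) (root_vector (- \<alpha>)))
      = uscale (1 / killing (rv \<alpha>) (rv (- \<alpha>))) (wedge (rv \<alpha>) (rv (- \<alpha>)))" if "\<alpha> \<in> positive" for \<alpha>
  proof -
    have "\<alpha> \<in> roots" "- \<alpha> \<in> roots" using that by (auto simp: roots_def)
    then obtain a b where ab: "a \<noteq> 0" "root_vector \<alpha> = uscale a (rv \<alpha>)"
      "b \<noteq> 0" "root_vector (- \<alpha>) = uscale b (rv (- \<alpha>))"
      by (metis root_vector_scale)
    then show ?thesis
      by (simp add: killing_linear rv_g2 g2.scale wedge_bilinear)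
  qed
  have "rmatrix = (\<Sum>\<alpha>\<in>positive. uscale (1 / killing (rv \<alpha>) (rv (- \<alpha>))) (wedge (rv \<alpha>) (rv (- \<alpha>))))"
    unfolding rmatrix_def pos_roots_eq using scaled by (rule sum.cong[OF refl])
  also have "\<dots> = ?r"
    unfolding positive_def k_def
    by (simp add: killing_root_vectors) (simp add: rv_simps ualg.scale_right_distrib
        ualg.scale_right_diff_distrib ualg.scale_minus_left algebra_simps)
  finally show ?thesis .
qed

text \<open>Under ad e_i the terms of the r-matrix cancel along root strings, leaving only e_i wedge
  [e_i, f_i]. For H_i the opposite weights in each summand cancel.\<close>

lemma cobracket_generators:
  defines "k \<equiv> killing (ue Long) (uf Long)"
  shows "cobracket (ue Short) = uscale (1 / k) (uscale (1 / 3) (wedge (ue Short) (uh Short)))"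
    and "cobracket (ue Long) = uscale (1 / k) (wedge (ue Long) (uh Long))"
    and "cobracket (uh i) = 0"
proof -
  note W = diag_wedge comm_rules uscale_comm wedge_uminus wedge_bilinear wedge_0
  show "cobracket (ue Short) = uscale (1 / k) (uscale (1 / 3) (wedge (ue Short) (uh Short)))"
    unfolding cobracket_eq rmatrix_eq k_def[symmetric]
    by (simp add: W P.e_x P.e_f N.f_x) (simp add: ualg.scale_right_distrib)
  show "cobracket (ue Long) = uscale (1 / k) (wedge (ue Long) (uh Long))"
    unfolding cobracket_eq rmatrix_eq k_def[symmetric]
    by (simp add: W P.e_x P.e_f N.f_x ugen_relations)
  have zero: "comm (diag (uh i)) (wedge (rv \<alpha>) (rv (- \<alpha>))) = 0" if "\<alpha> \<in> positive" for \<alpha>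
  proof -
    have "\<alpha> \<in> roots" "- \<alpha> \<in> roots" using that by (auto simp: roots_def)
    moreover have "wgt (- \<alpha>) i = - wgt \<alpha> i" by (simp add: wgt_def)
    ultimately show ?thesis
      by (simp add: diag_wedge comm_H_rv wedge_bilinear wedge_uminus ualg.scale_minus_left)
  qed
  show "cobracket (uh i) = 0"
    unfolding cobracket_eq rmatrix_eq k_def[symmetric]
    using zero[of "(1, 0)"] zero[of "(0, 1)"] zero[of "(1, 1)"] zero[of "(2, 1)"] zero[of "(3, 1)"] zero[of "(3, 2)"]
    by (simp add: positive_def rv_simps comm_rules uscale_comm)
qed

section \<open>The coisotropic subalgebra\<close>

definition nil :: "Ug set" where
  "nil = ualg.span {ue Long, P.x3, P.x4, P.x5, P.x6}"

definition wedges :: "Ug set \<Rightarrow> (gword \<times> gword) ualg set" where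
  "wedges A = ualg.span {wedge x y | x y. x \<in> A \<and> y \<in> g2}"

lemma wedges_closed:
  "0 \<in> wedges A" "s \<in> wedges A \<Longrightarrow> t \<in> wedges A \<Longrightarrow> s + t \<in> wedges A"
  "s \<in> wedges A \<Longrightarrow> t \<in> wedges A \<Longrightarrow> s - t \<in> wedges A" "s \<in> wedges A \<Longrightarrow> uscale c s \<in> wedges A"
  "x \<in> A \<Longrightarrow> y \<in> g2 \<Longrightarrow> wedge x y \<in> wedges A" "x \<in> A \<Longrightarrow> y \<in> g2 \<Longrightarrow> wedge y x \<in> wedges A"
proof -
  show w: "wedge x y \<in> wedges A" if "x \<in> A" "y \<in> g2" for x y
    unfolding wedges_def using that by (intro ualg.span_base) blast
  show "wedge y x \<in> wedges A" if "x \<in> A" "y \<in> g2"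
    using w[OF that] unfolding wedge_skew[of y x] wedges_def by (rule ualg.span_neg)
qed (auto simp: wedges_def intro: ualg.span_zero ualg.span_add ualg.span_diff ualg.span_scale)

lemma nil_gens: "ue Long \<in> nil" "P.x3 \<in> nil" "P.x4 \<in> nil" "P.x5 \<in> nil" "P.x6 \<in> nil"
  by (auto simp: nil_def intro: ualg.span_base)

lemma nil_closed: "0 \<in> nil" "x \<in> nil \<Longrightarrow> y \<in> nil \<Longrightarrow> x + y \<in> nil" "x \<in> nil \<Longrightarrow> - x \<in> nil" "x \<in> nil \<Longrightarrow> uscale c x \<in> nil"
  by (auto simp: nil_def intro: ualg.span_zero ualg.span_add ualg.span_neg ualg.span_scale)

lemma nil_g2: "nil \<subseteq> g2"
  unfolding nil_def using rv_g2[of "(1, 1)"] rv_g2[of "(2, 1)"] rv_g2[of "(3, 1)"] rv_g2[of "(3, 2)"]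
  by (intro ualg.span_minimal[OF _ subspace_g2]) (auto simp: rv_simps g2.gen)

lemma nil_stable:
  assumes "\<And>y. y \<in> {ue Long, P.x3, P.x4, P.x5, P.x6} \<Longrightarrow> comm x y \<in> nil" and "y \<in> nil"
  shows "comm x y \<in> nil"
  using assms(2) unfolding nil_def
proof (induction rule: ualg.span_induct_alt)
  case (step c b y)
  then show ?case
    using assms(1)[of b] nil_closed unfolding nil_def[symmetric] by (simp add: comm_rules uscale_comm)
qed (simp add: comm_rules nil_closed flip: nil_def)

lemma nil_normalized:
  assumes "y \<in> nil"
  shows "comm (ue i) y \<in> nil" "comm (uh i) y \<in> nil" "x \<in> nil \<Longrightarrow> comm x y \<in> nil"
proof -
  note cl = nil_gens nil_closed
  show "comm (ue i) y \<in> nil"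
    by (rule nil_stable[OF _ assms], cases i) (auto simp: P.e_x comm_rules cl)
  show "comm (uh i) y \<in> nil"
    by (rule nil_stable[OF _ assms], cases i) (auto simp: P.h_x ugen_relations cl)
  have "comm z y \<in> nil" if z: "z \<in> {ue Long, P.x3, P.x4, P.x5, P.x6}" for z
  proof (rule nil_stable[OF _ assms])
    fix w assume w: "w \<in> {ue Long, P.x3, P.x4, P.x5, P.x6}"
    have "comm P.x3 (ue Long) = 0" "comm P.x4 (ue Long) = 0" "comm P.x5 (ue Long) = - P.x6" "comm P.x6 (ue Long) = 0"
      "comm P.x4 P.x3 = P.x6" "comm P.x5 P.x3 = 0" "comm P.x6 P.x3 = 0" "comm P.x5 P.x4 = 0"
      "comm P.x6 P.x4 = 0" "comm P.x6 P.x5 = 0"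
      unfolding comm_swap[of P.x3 "ue Long"] comm_swap[of P.x4 "ue Long"] comm_swap[of P.x5 "ue Long"]
        comm_swap[of P.x6 "ue Long"] comm_swap[of P.x4 P.x3] comm_swap[of P.x5 P.x3]
        comm_swap[of P.x6 P.x3] comm_swap[of P.x5 P.x4] comm_swap[of P.x6 P.x4] comm_swap[of P.x6 P.x5]
      by (simp_all add: P.e_x P.x_x)
    then show "comm z w \<in> nil"
      using z w by (elim insertE emptyE) (simp_all add: P.e_x P.x_x comm_rules cl)
  qed
  then have "comm y z \<in> nil" if "z \<in> {ue Long, P.x3, P.x4, P.x5, P.x6}" for z
    using that nil_closed(3) comm_swap[of y z] by metis
  then have "comm y x \<in> nil" if "x \<in> nil" using that by (rule nil_stable)
  then show "comm x y \<in> nil" if "x \<in> nil" using that nil_closed(3) comm_swap[of x y] by metis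
qed

lemma diag_wedges:
  assumes "x \<in> g2" "\<And>y. y \<in> nil \<Longrightarrow> comm x y \<in> nil" "t \<in> wedges nil"
  shows "comm (diag x) t \<in> wedges nil"
  using assms(3) unfolding wedges_def
proof (induction rule: ualg.span_induct_alt)
  case (step c b y)
  then obtain u v where uv: "b = wedge u v" "u \<in> nil" "v \<in> g2" by blast
  have "comm (diag x) b \<in> wedges nil"
    unfolding uv(1) diag_wedge using uv assms by (intro wedges_closed g2.bracket) auto
  then show ?case
    using step wedges_closed unfolding wedges_def[symmetric] by (simp add: comm_rules uscale_comm)
qed (simp add: comm_rules wedges_closed flip: wedges_def)

text \<open>The element e_1 lies outside the subalgebra, but its cobracket is a multiple of the
  wedge of e_1 and H_1. Bracketed diagonally with y in \<open>nil\<close>, this yields [y, e_1]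
  wedge H_1 and e_1 wedge [y, H_1], each with one leg in \<open>nil\<close>. So the cocycle identity
  climbs from e_2 to x_6.\<close>

lemma cobracket_nil:
  assumes "x \<in> nil"
  shows "cobracket x \<in> wedges nil"
proof -
  have g2: "ugen g \<in> g2" for g by (rule g2.gen)
  have skew: "comm y (ugen g) \<in> nil" if "comm (ugen g) y \<in> nil" for y g
    using nil_closed(3)[OF that] comm_swap[of y "ugen g"] by simp
  have e1: "cobracket (comm (ue Short) y) \<in> wedges nil" if y: "y \<in> nil" "cobracket y \<in> wedges nil" for y
    unfolding cobracket_cocycle cobracket_generators uscale_comm diag_wedge
    using y nil_g2 by (intro wedges_closed diag_wedges nil_normalized g2 skew) auto
  have e2: "cobracket (comm (ue Long) y) \<in> wedges nil" if y: "y \<in> nil" "cobracket y \<in> wedges nil" for y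
    unfolding cobracket_cocycle cobracket_generators uscale_comm diag_wedge
    using y nil_g2 by (intro wedges_closed diag_wedges nil_normalized g2 skew) auto
  have 2: "cobracket (ue Long) \<in> wedges nil"
    unfolding cobracket_generators by (intro wedges_closed nil_gens g2)
  have 3: "cobracket P.x3 \<in> wedges nil"
    using e1[OF nil_gens(1) 2] by (simp add: P.e_x)
  have 4: "cobracket P.x4 \<in> wedges nil"
    using e1[OF nil_gens(2) 3] by (simp add: P.e_x)
  have 5: "cobracket P.x5 \<in> wedges nil"
    using e1[OF nil_gens(3) 4] by (simp add: P.e_x)
  have 6: "cobracket P.x6 \<in> wedges nil"
    using e2[OF nil_gens(4) 5] by (simp add: P.e_x)
  show ?thesis
    using assms unfolding nil_def
  proof (induction rule: ualg.span_induct_alt)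
    case (step c b y)
    have "cobracket b \<in> wedges nil" using step(1) 2 3 4 5 6 by auto
    then show ?case
      using step(2) wedges_closed unfolding nil_def[symmetric] by (simp add: cobracket_linear)
  qed (simp add: cobracket_linear wedges_closed)
qed

lemma ubasis_eq:
  "ubasis 0 = uh Short + uscale 6 (uh Long)" "ubasis 1 = ue Long" "ubasis 2 = P.x3" "ubasis 3 = P.x4"
  "ubasis 4 = P.x5" "ubasis 5 = P.x6"
  by (simp_all add: ubasis_def chev_h_def chev_e_def P.x3_def P.x4_def P.x5_def P.x6_def uscale_numeral)

lemma ubasis_range:
  "ubasis ` {..<6} = {uh Short + uscale 6 (uh Long), ue Long, P.x3, P.x4, P.x5, P.x6}"
proof -
  have "{..<6::nat} = {0, 1, 2, 3, 4, 5}" by auto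
  then show ?thesis by (simp add: ubasis_eq ubasis_eq(2)[unfolded One_nat_def])
qed

lemma coisotropic: "coisotropic_subalgebra (ualg.span (ubasis ` {..<6}))"
proof -
  let ?t = "uh Short + uscale 6 (uh Long)"
  let ?L = "ualg.span (ubasis ` {..<6})"
  have mem: "x \<in> ?L \<longleftrightarrow> (\<exists>c. x - uscale c ?t \<in> nil)" for x
    unfolding ubasis_range nil_def by (rule ualg.span_insert[THEN eq_refl[THEN subsetD], simplified] | simp add: ualg.span_insert)+
  have nil_L: "nil \<subseteq> ?L"
    unfolding nil_def ubasis_range by (intro ualg.span_mono) auto
  have t_nil: "comm ?t y \<in> nil" if "y \<in> nil" for y
    using nil_normalized(2)[OF that] nil_closed by (simp add: comm_rules uscale_comm)
  have "?L \<subseteq> g2"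
    by (intro ualg.span_minimal[OF _ subspace_g2])
      (use nil_gens nil_g2 in \<open>auto simp: ubasis_range intro!: g2.add g2.scale g2.gen\<close>)
  moreover have "comm x y \<in> ?L" if xy: "x \<in> ?L" "y \<in> ?L" for x y
  proof -
    obtain a b where ab: "x - uscale a ?t \<in> nil" "y - uscale b ?t \<in> nil" using xy mem by blast
    define u v where "u = x - uscale a ?t" and "v = y - uscale b ?t"
    have *: "x = uscale a ?t + u" "y = uscale b ?t + v" by (simp_all add: u_def v_def)
    \<comment> \<open>Generalized over t, so that the bracket rules do not expand the toral
      sum.\<close>
    have "comm (uscale a t + u) (uscale b t + v) = uscale a (comm t v) + (- uscale b (comm t u)) + comm u v" for t
      by (simp add: comm_rules uscale_comm comm_swap[of u t] ualg.scale_minus_right)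
    then have "comm x y = uscale a (comm ?t v) + (- uscale b (comm ?t u)) + comm u v"
      unfolding * .
    also have "\<dots> \<in> nil"
      using ab unfolding u_def[symmetric] v_def[symmetric]
      by (intro nil_closed t_nil nil_normalized)
    finally show ?thesis using nil_L by blast
  qed
  moreover have "cobracket ` ?L \<subseteq> ualg.span {wedge x y | x y. x \<in> ?L \<and> y \<in> g2}"
  proof -
    have "wedges nil \<subseteq> wedges ?L"
      unfolding wedges_def using nil_L by (intro ualg.span_mono) blast
    moreover have "cobracket x \<in> wedges nil" if "x \<in> ?L" for x
    proof -
      obtain a where a: "x - uscale a ?t \<in> nil" using \<open>x \<in> ?L\<close> mem by blast
      have "cobracket x = cobracket (uscale a ?t + (x - uscale a ?t))" by simp
      also have "\<dots> = cobracket (x - uscale a ?t)"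
        by (simp only: cobracket_linear cobracket_generators) simp
      finally show ?thesis using cobracket_nil[OF a] by simp
    qed
    ultimately show ?thesis by (auto simp: wedges_def)
  qed
  ultimately show ?thesis
    unfolding coisotropic_subalgebra_def by (auto intro: ualg.subspace_span)
qed

lemma generated_subalgebra_eq_Bq:
  "generated_subalgebra (range hscalar)
    {Kh Short * Kh Long ^ 2, divided_toral, qe2, qx1, qx2, qx3, qt} = Bq"
proof -
  let ?S = "{Kh Short * Kh Long ^ 2, divided_toral, qe2, qx1, qx2, qx3, qt}"
  let ?B = "generated_subalgebra (range hscalar) ?S"
  interpret S: scalar_subalgebra ?B
    by unfold_locales (rule generated_subalgebra_subalgebra)
  have B: "x \<in> ?B" if "x \<in> ?S" for x
    using generated_subalgebra_superset[of ?S "range hscalar"] that by blast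
  have "- qx1 \<in> ?B" "- qx3 \<in> ?B" by (intro S.B_closed(6) B; simp)+
  then have "Bgens \<subseteq> ?B"
    using B unfolding Bgens_def qgen_range by auto
  then have 1: "Bq \<subseteq> ?B"
    by (rule Bq_minimal[OF generated_subalgebra_subalgebra])
  have "- qx1 \<in> Bq" "- qx3 \<in> Bq" by (rule Bgens_Bq; simp add: Bgens_def qgen_range)+
  then have "- (- qx1) \<in> Bq" "- (- qx3) \<in> Bq" by (simp_all only: Bq.B_closed(6))
  then have "?S \<subseteq> Bq"
    using Bgens_Bq unfolding Bgens_def qgen_range by auto
  then have "?B \<subseteq> Bq"
    using Bq.B by (intro generated_subalgebra_minimal)
  with 1 show ?thesis by blast
qed

theorem theorem7p4:
  fixes x2 x3 x4 x5 x6 :: Ug and X Y Z T :: Uh and \<hh> :: "Ug set" and B\<^sub>h :: "Uh set"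
  assumes "x2 = chev_e Long" and "x3 = comm (chev_e Short) x2" and "x4 = comm (chev_e Short) x3"
    and "x5 = comm (chev_e Short) x4" and "x6 = comm (chev_e Long) x5"
    and "\<hh> = ualg.span {chev_h Short + uscale 2 (chev_h Long), x2, x3, x4, x5, x6}"
    and "X = qcomm 3 (Eh Long) (Eh Short)" and "Y = qcomm 1 X (Eh Short)"
    and "Z = qcomm (-1) Y (Eh Short)" and "T = comm Z (Eh Long)"
    and "B\<^sub>h = generated_subalgebra (range hscalar)
           {Kh Short * Kh Long ^ 2, divided_toral, Eh Long, X, Y, Z, T}"
  shows "is_quantization B\<^sub>h \<hh>"
proof -
  have X: "X = qx1"
    unfolding assms(7) nested_generators qx1_def ..
  have Y: "Y = qx2"
    unfolding assms(8) X qx1_def nested_generators qx2_def ..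
  have Z: "Z = qx3"
    unfolding assms(9) Y qx2_def nested_generators qx3_def ..
  have T: "T = qt"
    unfolding assms(10) Z qt_def Eh_eq ..
  have B: "B\<^sub>h = Bq"
    unfolding assms(11) X Y Z T Eh_eq by (rule generated_subalgebra_eq_Bq)
  have h: "\<hh> = ualg.span (ubasis ` {..<6})"
    unfolding assms(1-6) ubasis_range
    by (simp add: chev_h_def chev_e_def P.x3_def P.x4_def P.x5_def P.x6_def uscale_numeral)
  show ?thesis
    unfolding is_quantization_def B h
    using coisotropic left_coideal_Bq Bq_saturated specialize_Bq
    by (simp add: Bq_def generated_subalgebra_subalgebra)
qed

end
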